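(* Let Assumptions (A1), (A2), (A3), (A4) of the context hold, let $s_{\max}\ge 1$, and let $\kappa_d$ be the constant described in the context. Define $$A_{\min}:=\frac{\xi_{\min}\tau_{\min}}{\tau_{\min}L+\Gamma},\qquad A_{\max}:=\frac{\xi_{-1}\tau_{-1}}{\tau_{-1}L+\Gamma},$$ suppose that $\beta_k=\beta$ for all $k\in[k_{\max}]$, where $$\beta:=\frac{\gamma}{\sqrt{k_{\max}+1}}\quad\text{for some}\quad \gamma\in\left(0,\frac{A_{\min}}{A_{\max}+\theta}\right],$$ and define $$\begin{aligned} \overline M:=\;&\tfrac14(A_{\max}+\theta\beta)(\tau_{-1}+\tau_{\min})\zeta^{-1}M\\ &+\tfrac12(A_{\max}+\theta\beta)(\tau_{-1}-\tau_{\min})\big(\kappa_d\sqrt M(2\kappa_g+\sqrt M)+\kappa_H\kappa_d^2(M+\tfrac32\kappa_g^2)\big)+\theta\tau_{-1}\kappa_g\kappa_d\sqrt M,\\ \kappa_{E_3}:=\;&((A_{\max}+\theta\beta)\tau_{-1}-A_{\min}\tau_{\min})\kappa_g\kappa_dM_\tau,\\ \kappa_{\Delta q,1}:=\;&((A_{\max}+\theta\beta)\tau_{-1}-A_{\min}\tau_{\min})\kappa_d\kappa_g^2(1+\tfrac12\kappa_H\kappa_d),\\ \kappa_{\Delta q,2}:=\;&((A_{\max}+\theta\beta)\tau_{-1}-A_{\min}\tau_{\min})\kappa_d(1+\tfrac12\kappa_H\kappa_d)(M+\kappa_g^2). \end{aligned}$$ For all $k\in[k_{\max}]$ let $\hat{\mathcal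 T}_k:=\min\{\mathcal T_k,\mathcal T_k^{\mathrm{trial,true}}\}$. For $\delta\in(0,1)$ and $s\in\mathbb N$ set $$\hat\delta:=\frac{\delta}{\sum_{j=0}^{\max\{s_{\max}-1,0\}}\binom{k_{\max}}{j}},\qquad \ell(s,\bar\delta):=s+\log(1/\bar\delta)+\sqrt{\log(1/\bar\delta)^2+2s\log(1/\bar\delta)}\quad(\bar\delta\in(0,1)).$$ Then for any $\delta\in(0,1)$, with $K^*$ having the discrete uniform distribution over $[k_{\max}]$, it holds with probability at least $1-\delta$ that $$\begin{aligned} &\mathbb E\big[\Delta q(X_{K^*},\hat{\mathcal T}_{K^*},\nabla f(X_{K^*}),H_{K^*},D_{K^*}^{\mathrm{true}})\,\big|\,E\big]\\ &\le 2\left(\frac{\tau_{-1}(f_0-f_{\mathrm{low}})+\|c_0\|_1+\overline M\gamma^2+\kappa_{E_3}\gamma\,(\ell(s_{\max},\hat\delta/2)+1)/\sqrt{k_{\max}+1}}{A_{\min}\gamma\sqrt{k_{\max}+1}}\right)\\ &\quad+\frac{2(\kappa_{\Delta q,1}\gamma+\kappa_{\Delta q,2}\gamma^2/\sqrt{k_{\max}+1})}{A_{\min}\gamma(k_{\max}+1)}\left\lceil\frac{\ell(s_{\max},\hat\delta/2)+1}{p_\tau}\right\rceil . \end{aligned}$$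
   Context: Notation: $\|\cdot\|$ is the $\ell_2$-norm for vectors and the induced norm for matrices; $\mathbb N=\{0,1,2,\dots\}$; $[k]=\{0,\dots,k\}$; $v_{[k]}=\{v_0,\dots,v_k\}$; $\mathbb S^n$ is the set of real symmetric $n\times n$ matrices. A subscript $k$ on $f,c,J$ denotes evaluation at $x_k$. Problem: $\min_{x\in\mathbb R^n} f(x)$ subject to $c(x)=0$, where $f(x)=\mathbb E[F(x,\omega)]$, $c:\mathbb R^n\to\mathbb R^m$, $m\le n$, $J(x):=\nabla c(x)^\top\in\mathbb R^{m\times n}$. (A1) $\mathcal X\subseteq\mathbb R^n$ is an open convex set containing the iterates $\{x_k\}$ for all realizations of the algorithm below. Over $\mathcal X$: $f$ is continuously differentiable and bounded below by $f_{\mathrm{low}}\in\mathbb R$; $\nabla f$ is bounded and Lipschitz with constant $L\in(0,\infty)$; $c$ and $J$ are bounded; each $\nabla c_i$ is Lipschitz with constant $\gamma_i$; the singular values of $J$ are bounded below away from zero. $\kappa_g>0$ denotes a constant with $\|\nabla f(x_k)\|\le\kappa_g$ for all $k$ in any realization. (A2) $H_k\in\mathbb S^n$ is chosen independently from the stochastic gradient $g_k$; $\|H_k\|\le\kappa_H$; and there is $\zeta>0$ such that $u^\top H_ku\ge\zeta\|u\|^2$ for all $u$ with $J_ku=0$, for all $k\in[k_{\max}]$. For $d$ with $c(x)+J(x)d=0$ let $\Delta q(x,\tau,g,H,d):=-\tau(g^\top d+\tfrac12\max\{d^\top Hd,0\})+\|c(x)\|_1$. Algorithm. Inputs: $x_0\in\mathbb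 R^n$, $k_{\max}\in\mathbb N$, $\tau_{-1}>0$, $\epsilon_\tau,\epsilon_\xi,\sigma\in(0,1)$, $\xi_{-1}>0$, $\{\beta_k\}\subset(0,1]$, $\theta\ge0$, the Lipschitz constant $L$, and $\Gamma\ge\sum_{i=1}^m\gamma_i$ (with $\gamma_i\in(0,\infty)$). For $k=0,\dots,k_{\max}$: given a stochastic gradient $g_k$, let $(d_k,y_k)$ solve $$\begin{bmatrix} H_k & J_k^\top \\ J_k & 0 \end{bmatrix}\begin{bmatrix} d_k \\ y_k \end{bmatrix}=-\begin{bmatrix} g_k \\ c_k \end{bmatrix}.$$ If $d_k=0$: $\tau_k=\tau_{k-1}$, $\xi_k=\xi_{k-1}$, $\alpha_k=1$. Otherwise: $\tau_k^{\mathrm{trial}}=\infty$ if $g_k^\top d_k+\max\{d_k^\top H_kd_k,0\}\le0$ and $\tau_k^{\mathrm{trial}}=\frac{(1-\sigma)\|c_k\|_1}{g_k^\top d_k+\max\{d_k^\top H_kd_k,0\}}$ otherwise; $\tau_k=\tau_{k-1}$ if $\tau_{k-1}\le\tau_k^{\mathrm{trial}}$, else $\tau_k=(1-\epsilon_\tau)\tau_k^{\mathrm{trial}}$; $\xi_k^{\mathrm{trial}}=\Delta q(x_k,\tau_k,g_k,H_k,d_k)/(\tau_k\|d_k\|^2)$; $\xi_k=\xi_{k-1}$ if $\xi_{k-1}\le\xi_k^{\mathrm{trial}}$, else $\xi_k=(1-\epsilon_\xi)\xi_k^{\mathrm{trial}}$; $\hat\alpha_{k,\mathrm{init}}=\frac{\beta_k\Delta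 q(x_k,\tau_k,g_k,H_k,d_k)}{(\tau_kL+\Gamma)\|d_k\|^2}$, $\tilde\alpha_{k,\mathrm{init}}=\hat\alpha_{k,\mathrm{init}}-\frac{4\|c_k\|_1}{(\tau_kL+\Gamma)\|d_k\|^2}$; $\hat\alpha_k,\tilde\alpha_k$ are the projections of these onto $\big[\frac{\beta_k\xi_k\tau_k}{\tau_kL+\Gamma},\frac{\beta_k\xi_k\tau_k}{\tau_kL+\Gamma}+\theta\beta_k^2\big]$; $\alpha_k=\hat\alpha_k$ if $\hat\alpha_k<1$, $\alpha_k=1$ if $\tilde\alpha_k\le1\le\hat\alpha_k$, $\alpha_k=\tilde\alpha_k$ if $\tilde\alpha_k>1$. In all cases $x_{k+1}=x_k+\alpha_kd_k$. Finally an index $k^*\in[k_{\max}]$ is sampled with $\mathbb P[k^*=k]=\beta_k/\sum_{j=0}^{k_{\max}}\beta_j$ (independently of the rest; uniform when $\beta_k$ is constant) and $x_{k^*}$ is returned. Random variables are written $X_k,G_k,D_k,Y_k,\mathcal T_k,\Xi_k,\mathcal A_k$, with realizations $x_k,g_k,d_k,y_k,\tau_k,\xi_k,\alpha_k$; conditioned on $G_{[k-1]}=g_{[k-1]}$ the values $x_k,\tau_{k-1},\xi_{k-1}$ are determined. "True" quantities: $(d_k^{\mathrm{true}},y_k^{\mathrm{true}})$ solves the linear system above with $g_k$ replaced by $\nabla f(x_k)$; $\tau_k^{\mathrm{trial,true}}$ is defined by the formula for $\tau_k^{\mathrm{trial}}$ with $(g_k,d_k)$ replaced by $(\nabla f(x_k),d_k^{\mathrm{true}})$;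 as random variables these are $D_k^{\mathrm{true}},Y_k^{\mathrm{true}},\mathcal T_k^{\mathrm{trial,true}}$. Event $E=E(k_{\max},s_{\max},\tau_{\min},\xi_{\min})$, for given $(k_{\max},s_{\max},\tau_{\min},\xi_{\min})\in\mathbb N\times\mathbb N\times\mathbb R_{>0}\times\mathbb R_{>0}$: for all $k\in[k_{\max}]$, $\tau_k\ge\tau_{\min}$, $\tau_k^{\mathrm{trial,true}}\ge\tau_{\min}$ and $\xi_k=\xi_{\min}$; and $|\{k\in[k_{\max}]:\tau_k<\tau_{k-1}\}|\le s_{\max}$. Write $\mathbb P_k[\cdot]=\mathbb P[\cdot\mid E,G_{[k-1]}=g_{[k-1]}]$ and $\mathbb E_k[\cdot]=\mathbb E[\cdot\mid E,G_{[k-1]}=g_{[k-1]}]$. (A3) There are $M>0$, $M_\tau>0$ such that for all $k\in[k_{\max}]$ and all realizations $g_{[k-1]}$: $\mathbb E_k[G_k]=\nabla f(x_k)$, $\mathbb E_k[\|G_k-\nabla f(x_k)\|^2]\le M$, and either $\mathbb P_k[\nabla f(x_k)^\top(D_k-d_k^{\mathrm{true}})<0,\ \mathcal T_k<\tau_{k-1}]=0$ or $\mathbb E_k[\|G_k-\nabla f(x_k)\|\mid\nabla f(x_k)^\top(D_k-d_k^{\mathrm{true}})<0,\ \mathcal T_k<\tau_{k-1}]\le M_\tau$. (A4) There is $p_\tau\in(0,1]$ such that for all $k\in[k_{\max}]$ and all realizations $g_{[k-1]}$: $\mathbb P_k[G_k^\top D_k+\max\{D_k^\top H_kD_k,0\}\ge\nabla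 f(x_k)^\top d_k^{\mathrm{true}}+\max\{(d_k^{\mathrm{true}})^\top H_kd_k^{\mathrm{true}},0\}]\ge p_\tau$. Constant $\kappa_d>0$: a constant such that, for all $k\in[k_{\max}]$ and all realizations, $\|d_k^{\mathrm{true}}\|\le\kappa_d\|\nabla f(x_k)\|\le\kappa_d\kappa_g$ and $\|D_k-d_k^{\mathrm{true}}\|\le\kappa_d\|G_k-\nabla f(x_k)\|$; consequently $\mathbb E_k[\|D_k-d_k^{\mathrm{true}}\|]\le\kappa_d\sqrt M$ and $\mathbb E_k[\|D_k-d_k^{\mathrm{true}}\|\mid\nabla f(x_k)^\top(D_k-d_k^{\mathrm{true}})<0,\mathcal T_k<\tau_{k-1}]\le\kappa_dM_\tau$.
   Formalization: The formal statement additionally assumes that on E the lower end of the projection interval satisfies β_kξ_kτ_k/(τ_kL+Γ) ≤ 1 for all k in [k_max]; without this the claim is false (e.g. c(x)=x, f(x)=εx, H=0, L=Γ=0.1, k_max=0, where the step is α_0=5). *)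

theory Defs
  imports "HOL-Probability.Probability"
begin

section \<open>Optimization quantities\<close>

definition l1_norm :: "real^'m \<Rightarrow> real" where
  "l1_norm v = (\<Sum>i\<in>UNIV. \<bar>v $ i\<bar>)"

text \<open>
  For a matrix with at least as many columns as rows (as the constraint Jacobian here), the
  singular values are the square roots of the eigenvalues of \<open>A A\<^sup>T\<close>.
\<close>
definition singular_value :: "real^'n^'m \<Rightarrow> real \<Rightarrow> bool" where
  "singular_value A s \<longleftrightarrow>
     0 \<le> s \<and> (\<exists>v. v \<noteq> 0 \<and> (A ** transpose A) *v v = s\<^sup>2 *\<^sub>R v)"

text \<open>The two block rows of the linear system with matrix \<open>[H, J\<^sup>T; J, 0]\<close> and right-hand side
  \<open>-[g; c]\<close>; here \<open>c\<close> is the constraint value at the current point.\<close>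
definition kkt_solution ::
  "real^'n^'n \<Rightarrow> real^'n^'m \<Rightarrow> real^'n \<Rightarrow> real^'m \<Rightarrow> real^'n \<Rightarrow> real^'m \<Rightarrow> bool" where
  "kkt_solution H J g c d y \<longleftrightarrow> H *v d + transpose J *v y = - g \<and> J *v d = - c"

definition delta_q ::
  "(real^'n \<Rightarrow> real^'m) \<Rightarrow> real^'n \<Rightarrow> real \<Rightarrow> real^'n \<Rightarrow> real^'n^'n \<Rightarrow> real^'n \<Rightarrow> real" where
  "delta_q c x \<tau> g H d = - \<tau> * (g \<bullet> d + 1/2 * max (d \<bullet> (H *v d)) 0) + l1_norm (c x)"


section \<open>One iteration of the stochastic SQP method\<close>

definition tau_trial ::
  "real \<Rightarrow> (real^'n \<Rightarrow> real^'m) \<Rightarrow> real^'n \<Rightarrow> real^'n \<Rightarrow> real^'n^'n \<Rightarrow> real^'n \<Rightarrow> ereal" where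
  "tau_trial \<sigma> c x g H d =
     (if g \<bullet> d + max (d \<bullet> (H *v d)) 0 \<le> 0 then \<infinity>
      else ereal ((1 - \<sigma>) * l1_norm (c x) / (g \<bullet> d + max (d \<bullet> (H *v d)) 0)))"

definition tau_update :: "real \<Rightarrow> ereal \<Rightarrow> real \<Rightarrow> real" where
  "tau_update \<epsilon>\<^sub>\<tau> trial \<tau>prev =
     (if ereal \<tau>prev \<le> trial then \<tau>prev else (1 - \<epsilon>\<^sub>\<tau>) * real_of_ereal trial)"

definition xi_update :: "real \<Rightarrow> real \<Rightarrow> real \<Rightarrow> real" where
  "xi_update \<epsilon>\<^sub>\<xi> trial \<xi>prev = (if \<xi>prev \<le> trial then \<xi>prev else (1 - \<epsilon>\<^sub>\<xi>) * trial)"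

definition xi_trial ::
  "(real^'n \<Rightarrow> real^'m) \<Rightarrow> real^'n \<Rightarrow> real \<Rightarrow> real^'n \<Rightarrow> real^'n^'n \<Rightarrow> real^'n \<Rightarrow> real" where
  "xi_trial c x \<tau> g H d = delta_q c x \<tau> g H d / (\<tau> * (norm d)\<^sup>2)"

text \<open>Step size for \<open>d \<noteq> 0\<close>; \<open>b\<close> is the value of \<open>\<beta>\<^sub>k\<close>.\<close>
definition step_size ::
  "(real^'n \<Rightarrow> real^'m) \<Rightarrow> real \<Rightarrow> real \<Rightarrow> real \<Rightarrow> real \<Rightarrow>
   real^'n \<Rightarrow> real \<Rightarrow> real \<Rightarrow> real^'n \<Rightarrow> real^'n^'n \<Rightarrow> real^'n \<Rightarrow> real" where
  "step_size c \<theta> L \<Gamma> b x \<tau> \<xi> g H d =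
    (let hat_init = b * delta_q c x \<tau> g H d / ((\<tau> * L + \<Gamma>) * (norm d)\<^sup>2);
         tilde_init = hat_init - 4 * l1_norm (c x) / ((\<tau> * L + \<Gamma>) * (norm d)\<^sup>2);
         lo = b * \<xi> * \<tau> / (\<tau> * L + \<Gamma>);
         hat = closest_point {lo .. lo + \<theta> * b\<^sup>2} hat_init;
         tilde = closest_point {lo .. lo + \<theta> * b\<^sup>2} tilde_init
     in if hat < 1 then hat else if tilde \<le> 1 then 1 else tilde)"

text \<open>\<open>\<tau>prev\<close>, \<open>\<xi>prev\<close> are the incoming parameter values \<open>\<tau>\<^sub>k\<^sub>-\<^sub>1\<close>, \<open>\<xi>\<^sub>k\<^sub>-\<^sub>1\<close>; the remaining
  arguments on the last line are the quantities produced by the iteration.\<close>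
definition sqp_iteration ::
  "(real^'n \<Rightarrow> real^'m) \<Rightarrow> (real^'n \<Rightarrow> real^'n^'m) \<Rightarrow>
   real \<Rightarrow> real \<Rightarrow> real \<Rightarrow> real \<Rightarrow> real \<Rightarrow> real \<Rightarrow> real \<Rightarrow>
   real^'n^'n \<Rightarrow> real^'n \<Rightarrow> real^'n \<Rightarrow> real \<Rightarrow> real \<Rightarrow>
   real^'n \<Rightarrow> real^'m \<Rightarrow> real \<Rightarrow> real \<Rightarrow> real \<Rightarrow> real^'n \<Rightarrow> bool" where
  "sqp_iteration c J \<epsilon>\<^sub>\<tau> \<epsilon>\<^sub>\<xi> \<sigma> \<theta> L \<Gamma> b
     H g x \<tau>prev \<xi>prev
     d y \<tau> \<xi> \<alpha> xnext \<longleftrightarrow>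
     kkt_solution H (J x) g (c x) d y \<and>
     (if d = 0 then \<tau> = \<tau>prev \<and> \<xi> = \<xi>prev \<and> \<alpha> = 1
      else \<tau> = tau_update \<epsilon>\<^sub>\<tau> (tau_trial \<sigma> c x g H d) \<tau>prev \<and>
           \<xi> = xi_update \<epsilon>\<^sub>\<xi> (xi_trial c x \<tau> g H d) \<xi>prev \<and>
           \<alpha> = step_size c \<theta> L \<Gamma> b x \<tau> \<xi> g H d) \<and>
     xnext = x + \<alpha> *\<^sub>R d"

text \<open>Value at index \<open>k - 1\<close> of a sequence of random variables with given value at index \<open>-1\<close>.\<close>
definition prev :: "real \<Rightarrow> (nat \<Rightarrow> 'a \<Rightarrow> real) \<Rightarrow> nat \<Rightarrow> 'a \<Rightarrow> real" where
  "prev init V k \<omega> = (case k of 0 \<Rightarrow> init | Suc j \<Rightarrow> V j \<omega>)"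


section \<open>Conditioning on the event and on the past gradients\<close>

text \<open>The sigma-algebra generated by \<open>G\<^sub>0, \<dots>, G\<^sub>k\<^sub>-\<^sub>1\<close>.\<close>
definition past :: "'a measure \<Rightarrow> (nat \<Rightarrow> 'a \<Rightarrow> real^'n) \<Rightarrow> nat \<Rightarrow> 'a measure" where
  "past P G k = vimage_algebra (space P) (\<lambda>\<omega>. \<lambda>i\<in>{..<k}. G i \<omega>) (Pi\<^sub>M {..<k} (\<lambda>_. borel))"

text \<open>
  Conditional expectation and probability given the event \<open>E\<close> and the past gradients. Conditioning
  on \<open>E\<close> means passing to \<open>uniform_measure P E\<close>, i.e. the measure \<open>A \<mapsto> P(A \<inter> E) / P(E)\<close>.
\<close>
definition cexp_past ::
  "'a measure \<Rightarrow> 'a set \<Rightarrow> (nat \<Rightarrow> 'a \<Rightarrow> real^'n) \<Rightarrow> nat \<Rightarrow> ('a \<Rightarrow> real) \<Rightarrow> 'a \<Rightarrow> real" where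
  "cexp_past P E G k = real_cond_exp (uniform_measure P E) (past P G k)"

definition cprob_past ::
  "'a measure \<Rightarrow> 'a set \<Rightarrow> (nat \<Rightarrow> 'a \<Rightarrow> real^'n) \<Rightarrow> nat \<Rightarrow> 'a set \<Rightarrow> 'a \<Rightarrow> real" where
  "cprob_past P E G k B = cexp_past P E G k (indicator B)"

text \<open>Further conditioning on an event \<open>B\<close>; meaningful where \<open>cprob_past P E G k B\<close> is nonzero.\<close>
definition cexp_past_given ::
  "'a measure \<Rightarrow> 'a set \<Rightarrow> (nat \<Rightarrow> 'a \<Rightarrow> real^'n) \<Rightarrow> nat \<Rightarrow> 'a set \<Rightarrow> ('a \<Rightarrow> real) \<Rightarrow> 'a \<Rightarrow> real"
  where
  "cexp_past_given P E G k B Z \<omega> =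
     cexp_past P E G k (\<lambda>\<omega>. Z \<omega> * indicator B \<omega>) \<omega> / cprob_past P E G k B \<omega>"


section \<open>The high-probability bound\<close>

definition ell :: "nat \<Rightarrow> real \<Rightarrow> real" where
  "ell s \<delta> = real s + ln (1 / \<delta>) + sqrt ((ln (1 / \<delta>))\<^sup>2 + 2 * real s * ln (1 / \<delta>))"

end

theory Submission
  imports Defs
begin

text \<open>
  The event whose probability is estimated does not depend on the outcome, so it has probability
  0 or 1 and the claim is that the bound on the conditional mean itself holds. Working under
  \<open>P(\<cdot> | E)\<close>, the merit function \<open>\<tau> f + \<parallel>c\<parallel>\<^sub>1\<close> decreases at each iteration by a multiple of
  \<open>\<Delta>q\<close> at the true step, up to terms that are linear in the gradient noise with coefficients
  depending only on the past (mean zero), terms bounded by the first two moments of the noise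
  (of size \<open>\<beta>\<^sup>2\<close>), and terms that occur only when \<open>\<tau>\<^sub>k < \<tau>\<^sub>k\<^sub>-\<^sub>1\<close> or
  \<open>\<tau>\<^sub>k\<^sup>t\<^sup>r\<^sup>i\<^sup>a\<^sup>l\<^sup>,\<^sup>t\<^sup>r\<^sup>u\<^sup>e < \<tau>\<^sub>k\<^sub>-\<^sub>1\<close>. On \<open>E\<close> the first of these events occurs at most \<open>s\<^sub>m\<^sub>a\<^sub>x\<close> times, and by
  (A4) the second occurs at most \<open>s\<^sub>m\<^sub>a\<^sub>x / p\<^sub>\<tau>\<close> times on average. Telescoping and taking means gives
  the bound with \<open>s\<^sub>m\<^sub>a\<^sub>x\<close> in place of the larger \<open>\<ell>(s\<^sub>m\<^sub>a\<^sub>x, \<delta>hat/2) + 1\<close>.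
\<close>

section \<open>One iteration\<close>

text \<open>The obstacle is that the step size and \<open>\<tau>\<close> both depend on the current
  stochastic gradient, so a term such as \<open>a * \<tau> * r\<close> in the descent estimate has
  no mean-zero structure of its own. Each random coefficient is therefore compared with one that is
  fixed before the gradient is drawn. For the term linear in the step error this is the lower end of
  the projection interval at the incoming \<open>\<tau>p\<close>, times \<open>\<tau>p\<close>; for
  the gap between the true and the stochastic model it is the midpoint of the range of
  \<open>\<tau>\<close>. What is left over has a favourable sign, is of order \<beta>^2 (collected
  in \<open>Mbar\<close>), or is confined to iterations in which \<open>\<tau>\<close> drops
  (collected in \<open>\<kappa>\<^sub>E\<^sub>3\<close>). The step error is linear in the noise
  because the system matrix is fixed by the past. Iterates and steps are given only pointwise, as
  solutions of the linear system; their measurability is derived from that of \<open>G\<close> and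
  \<open>H\<close> by Cramer's rule.\<close>

lemma quadratic_upper_bound:
  fixes f :: "'b::real_inner \<Rightarrow> real"
  assumes S: "convex S" "x \<in> S" "y \<in> S"
    and der: "\<And>z. z \<in> S \<Longrightarrow> (f has_derivative (\<lambda>h. g z \<bullet> h)) (at z)"
    and lip: "L-lipschitz_on S g"
  shows "f y \<le> f x + g x \<bullet> (y - x) + L / 2 * (norm (y - x))\<^sup>2"
proof -
  define v where "v = y - x"
  \<comment> \<open>\<open>h\<close> is \<open>f\<close> along the segment minus its linear and
    quadratic terms, so the claim becomes \<open>h 1 \<le> h 0\<close>. Convexity keeps the segment
    in \<open>S\<close>, the only place where derivatives are available.\<close>
  define h where "h t = f (x + t *\<^sub>R v) - t * (g x \<bullet> v) - L / 2 * t\<^sup>2 * (norm v)\<^sup>2" for t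
  have in_S: "x + t *\<^sub>R v \<in> S" if "0 \<le> t" "t \<le> 1" for t
  proof -
    have "x + t *\<^sub>R v = (1 - t) *\<^sub>R x + t *\<^sub>R y"
      by (simp add: v_def algebra_simps)
    then show ?thesis
      using S that by (simp add: convexD_alt)
  qed
  have "h 1 \<le> h 0"
  proof (rule DERIV_nonpos_imp_nonincreasing[of 0 1 h])
    fix t :: real assume t: "0 \<le> t" "t \<le> 1"
    let ?z = "x + t *\<^sub>R v"
    have "((\<lambda>t. f (x + t *\<^sub>R v)) has_derivative (\<lambda>s. g ?z \<bullet> (s *\<^sub>R v))) (at t)"
      by (rule has_derivative_compose[where f = "\<lambda>t. x + t *\<^sub>R v", OF _ der[OF in_S[OF t]]])
        (auto intro!: derivative_eq_intros)
    then have "((\<lambda>t. f (x + t *\<^sub>R v)) has_real_derivative g ?z \<bullet> v) (at t)"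
      by (simp add: has_field_derivative_def mult.commute[of _ "g ?z \<bullet> v"])
    then have D: "(h has_real_derivative g ?z \<bullet> v - g x \<bullet> v - L * t * (norm v)\<^sup>2) (at t)"
      unfolding h_def by (auto intro!: derivative_eq_intros)
    have "g ?z \<bullet> v - g x \<bullet> v = (g ?z - g x) \<bullet> v"
      by (simp add: inner_diff_left)
    also have "\<dots> \<le> norm (g ?z - g x) * norm v"
      by (rule norm_cauchy_schwarz)
    also have "\<dots> \<le> L * norm (t *\<^sub>R v) * norm v"
      using lipschitz_onD[OF lip in_S[OF t] S(2)]
      by (intro mult_right_mono) (auto simp: dist_norm)
    also have "\<dots> = L * t * (norm v)\<^sup>2"
      using t by (simp add: power2_eq_square)
    finally show "\<exists>D. (h has_real_derivative D) (at t) \<and> D \<le> 0"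
      using D by auto
  qed simp
  then show ?thesis
    by (simp add: h_def v_def)
qed

lemma quadratic_approximation:
  fixes f :: "'b::real_inner \<Rightarrow> real"
  assumes S: "convex S" "x \<in> S" "y \<in> S"
    and der: "\<And>z. z \<in> S \<Longrightarrow> (f has_derivative (\<lambda>h. g z \<bullet> h)) (at z)"
    and lip: "L-lipschitz_on S g"
  shows "\<bar>f y - f x - g x \<bullet> (y - x)\<bar> \<le> L / 2 * (norm (y - x))\<^sup>2"
proof -
  have "- f y \<le> - f x + (- g x) \<bullet> (y - x) + L / 2 * (norm (y - x))\<^sup>2"
  proof (rule quadratic_upper_bound[OF S])
    show "((\<lambda>z. - f z) has_derivative (\<lambda>h. - g z \<bullet> h)) (at z)" if "z \<in> S" for z
      using has_derivative_minus[OF der[OF that]] by simp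
    show "L-lipschitz_on S (\<lambda>z. - g z)"
      using lip by (simp add: lipschitz_on_def dist_minus)
  qed
  then show ?thesis
    using quadratic_upper_bound[OF S der lip] unfolding abs_le_iff inner_minus_left by linarith
qed

lemma l1_norm_nonneg: "l1_norm v \<ge> 0"
  unfolding l1_norm_def by (simp add: sum_nonneg)

text \<open>Since \<open>J x *v d = - c x\<close>, the linear model of \<open>c\<close> at
  \<open>x + a *\<^sub>R d\<close> is \<open>(1 - a) *\<^sub>R c x\<close>; each component deviates
  from it by a second-order term, and these add up to \<open>\<Gamma>\<close>. The absolute value
  stays because steps longer than 1 are allowed.\<close>

lemma l1_norm_linearization:
  fixes c :: "real^'n \<Rightarrow> real^'m" and J :: "real^'n \<Rightarrow> real^'n^'m"
  assumes S: "convex S" "x \<in> S" "x + a *\<^sub>R d \<in> S"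
    and der: "\<And>x. x \<in> S \<Longrightarrow> (c has_derivative (\<lambda>h. J x *v h)) (at x)"
    and lip: "\<And>i. (\<gamma> i)-lipschitz_on S (\<lambda>x. J x $ i)"
    and \<Gamma>: "\<Gamma> \<ge> (\<Sum>i\<in>UNIV. \<gamma> i)"
    and Jd: "J x *v d = - c x"
  shows "l1_norm (c (x + a *\<^sub>R d)) \<le> \<bar>1 - a\<bar> * l1_norm (c x) + \<Gamma> / 2 * a\<^sup>2 * (norm d)\<^sup>2"
proof -
  have comp: "\<bar>c (x + a *\<^sub>R d) $ i\<bar> \<le> \<bar>1 - a\<bar> * \<bar>c x $ i\<bar> + \<gamma> i / 2 * a\<^sup>2 * (norm d)\<^sup>2" for i
  proof -
    have "((\<lambda>x. c x $ i) has_derivative (\<lambda>h. J z $ i \<bullet> h)) (at z)" if "z \<in> S" for z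
      using bounded_linear.has_derivative[OF bounded_linear_vec_nth der[OF that], of i]
      by (simp add: matrix_vector_mult_def inner_vec_def)
    then have "\<bar>c (x + a *\<^sub>R d) $ i - c x $ i - J x $ i \<bullet> (x + a *\<^sub>R d - x)\<bar>
        \<le> \<gamma> i / 2 * (norm (x + a *\<^sub>R d - x))\<^sup>2"
      by (rule quadratic_approximation[OF S _ lip])
    moreover have "J x $ i \<bullet> d = - (c x $ i)"
      using arg_cong[OF Jd, of "\<lambda>v. v $ i"] by (simp add: matrix_vector_mult_def inner_vec_def)
    ultimately have "\<bar>c (x + a *\<^sub>R d) $ i - (1 - a) * c x $ i\<bar> \<le> \<gamma> i / 2 * a\<^sup>2 * (norm d)\<^sup>2"
      by (simp add: algebra_simps power_mult_distrib)
    moreover have "\<bar>(1 - a) * c x $ i\<bar> = \<bar>1 - a\<bar> * \<bar>c x $ i\<bar>"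
      by (rule abs_mult)
    ultimately show ?thesis by linarith
  qed
  have "l1_norm (c (x + a *\<^sub>R d))
      \<le> (\<Sum>i\<in>UNIV. \<bar>1 - a\<bar> * \<bar>c x $ i\<bar> + \<gamma> i / 2 * a\<^sup>2 * (norm d)\<^sup>2)"
    unfolding l1_norm_def by (intro sum_mono comp)
  also have "\<dots> = \<bar>1 - a\<bar> * l1_norm (c x) + (\<Sum>i\<in>UNIV. \<gamma> i) / 2 * a\<^sup>2 * (norm d)\<^sup>2"
    by (simp add: l1_norm_def sum.distrib sum_distrib_left sum_distrib_right sum_divide_distrib)
  also have "\<dots> \<le> \<bar>1 - a\<bar> * l1_norm (c x) + \<Gamma> / 2 * a\<^sup>2 * (norm d)\<^sup>2"
    using \<Gamma> by (intro add_left_mono mult_right_mono) auto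
  finally show ?thesis .
qed

lemma closest_point_interval:
  fixes lo hi a :: real
  assumes "lo \<le> hi"
  shows "closest_point {lo..hi} a = max lo (min hi a)"
proof (rule closest_point_unique[symmetric])
  show "\<forall>z\<in>{lo..hi}. dist a (max lo (min hi a)) \<le> dist a z"
    using assms by (auto simp: dist_real_def max_def min_def)
qed (use assms in auto)

section \<open>The symmetric linear system and the quadratic model\<close>

lemma inner_transpose_null:
  fixes A :: "real^'n^'m"
  assumes "A *v u = 0"
  shows "u \<bullet> (transpose A *v y) = 0"
  by (metis assms dot_lmul_matrix inner_commute inner_zero_left transpose_matrix_vector)

lemma inner_sym_matrix:
  fixes A :: "real^'n^'n"
  assumes "transpose A = A"
  shows "x \<bullet> (A *v y) = (A *v x) \<bullet> y"
  by (metis assms dot_lmul_matrix transpose_matrix_vector)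

text \<open>With zero constraint residual the step lies in the null space of \<open>J\<close>, so
  testing the first block row with \<open>u\<close> removes the multiplier and leaves the curvature
  bound \<zeta> against the right-hand side \<open>n\<close>. This covers both differences of two
  steps and the adjoint steps used for the drift.\<close>

lemma kkt_step_bound:
  assumes kkt: "kkt_solution H J (- n) 0 u z"
    and pd: "\<And>u. J *v u = 0 \<Longrightarrow> u \<bullet> (H *v u) \<ge> \<zeta> * (norm u)\<^sup>2" and \<zeta>: "\<zeta> > 0"
  shows "u \<bullet> (H *v u) = n \<bullet> u" "norm u \<le> norm n / \<zeta>" "n \<bullet> u \<le> (norm n)\<^sup>2 / \<zeta>"
proof -
  have Ju: "J *v u = 0" and eq: "H *v u = n - transpose J *v z"
    using kkt by (auto simp: kkt_solution_def algebra_simps eq_diff_eq)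
  show 1: "u \<bullet> (H *v u) = n \<bullet> u"
    using inner_transpose_null[OF Ju, of z] by (simp add: eq inner_diff_right inner_commute)
  have cs: "n \<bullet> u \<le> norm n * norm u"
    by (rule norm_cauchy_schwarz)
  then have "\<zeta> * (norm u)\<^sup>2 \<le> norm n * norm u"
    using pd[OF Ju] 1 by linarith
  then have "norm u = 0 \<or> \<zeta> * norm u \<le> norm n"
    by (auto simp: power2_eq_square mult.assoc[symmetric] mult_le_cancel_right)
  then show 2: "norm u \<le> norm n / \<zeta>"
    using \<zeta> by (auto simp: field_simps)
  show "n \<bullet> u \<le> (norm n)\<^sup>2 / \<zeta>"
    using cs mult_left_mono[OF 2, of "norm n"] by (simp add: power2_eq_square)
qed

lemma kkt_solution_diff:
  assumes "kkt_solution H J g c d y" "kkt_solution H J g' c d' y'"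
  shows "kkt_solution H J (g - g') 0 (d - d') (y - y')"
  using assms unfolding kkt_solution_def
  by (auto simp: matrix_vector_mult_diff_distrib algebra_simps)

text \<open>Self-adjointness of the solution operator on the null space of \<open>J\<close>: both
  sides equal \<open>u \<bullet> (H *v q)\<close> up to symmetry of \<open>H\<close>. It moves the
  random data from the step onto the right-hand side.\<close>

lemma kkt_inner_adjoint:
  assumes H: "transpose H = H"
    and u: "kkt_solution H J n 0 u z" and q: "kkt_solution H J (- v) 0 q w"
  shows "v \<bullet> u = - (n \<bullet> q)"
proof -
  have Ju: "J *v u = 0" and Jq: "J *v q = 0"
    and v: "v = H *v q + transpose J *v w" and n: "n = - (H *v u + transpose J *v z)"
    using u q by (auto simp: kkt_solution_def)
  have "v \<bullet> u = u \<bullet> (H *v q)"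
    using inner_transpose_null[OF Ju, of w] by (simp add: v inner_add_right inner_commute[of _ u])
  moreover have "n \<bullet> q = - (q \<bullet> (H *v u))"
    using inner_transpose_null[OF Jq, of z] by (simp add: n inner_add_right inner_diff_right inner_commute[of _ q] del: transpose_matrix_vector)
  ultimately show ?thesis
    using inner_sym_matrix[OF H, of u q] by (simp add: inner_commute)
qed

text \<open>The slope of \<open>delta_q\<close> in \<open>\<tau>\<close>, up to sign. Isolating it
  makes differences of reductions at two values of \<open>\<tau>\<close>, or at two steps, free of
  the constraint term.\<close>

definition q_model :: "real^'n \<Rightarrow> real^'n^'n \<Rightarrow> real^'n \<Rightarrow> real" where
  "q_model g H d = g \<bullet> d + 1/2 * max (d \<bullet> (H *v d)) 0"

lemma delta_q_eq: "delta_q c x \<tau> g H d = - \<tau> * q_model g H d + l1_norm (c x)"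
  by (simp add: delta_q_def q_model_def)

lemma inner_matrix_le:
  fixes A :: "real^'n^'n"
  assumes "onorm ((*v) A) \<le> \<kappa>"
  shows "\<bar>x \<bullet> (A *v y)\<bar> \<le> \<kappa> * norm x * norm y"
proof -
  have "norm (A *v y) \<le> onorm ((*v) A) * norm y"
    by (intro onorm matrix_vector_mul_bounded_linear)
  also have "\<dots> \<le> \<kappa> * norm y"
    using assms by (intro mult_right_mono) auto
  finally have "norm x * norm (A *v y) \<le> norm x * (\<kappa> * norm y)"
    by (intro mult_left_mono) auto
  then show ?thesis
    using Cauchy_Schwarz_ineq2[of x "A *v y"] by (simp add: mult_ac)
qed

text \<open>The right-hand side is the factor that, multiplied by \<open>V\<close>, becomes
  \<open>\<kappa>\<^sub>q\<^sub>1\<close>.\<close>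

lemma q_model_bound:
  assumes H: "onorm ((*v) H) \<le> \<kappa>H" and "norm g \<le> \<kappa>g" "norm d \<le> \<kappa>d * \<kappa>g" "\<kappa>H \<ge> 0"
  shows "\<bar>q_model g H d\<bar> \<le> \<kappa>d * \<kappa>g\<^sup>2 * (1 + 1/2 * \<kappa>H * \<kappa>d)"
proof -
  have pos: "0 \<le> \<kappa>g" "0 \<le> \<kappa>d * \<kappa>g"
    using assms(2,3) norm_ge_zero order_trans by blast+
  have "\<bar>g \<bullet> d\<bar> \<le> norm g * norm d"
    by (rule Cauchy_Schwarz_ineq2)
  also have "\<dots> \<le> \<kappa>g * (\<kappa>d * \<kappa>g)"
    using assms pos by (intro mult_mono) auto
  finally have 1: "\<bar>g \<bullet> d\<bar> \<le> \<kappa>g * (\<kappa>d * \<kappa>g)" .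
  have "\<bar>d \<bullet> (H *v d)\<bar> \<le> \<kappa>H * norm d * norm d"
    by (rule inner_matrix_le[OF H])
  also have "\<dots> \<le> \<kappa>H * (\<kappa>d * \<kappa>g) * (\<kappa>d * \<kappa>g)"
    using assms pos by (intro mult_mono) auto
  finally have 2: "\<bar>max (d \<bullet> (H *v d)) 0\<bar> \<le> \<kappa>H * (\<kappa>d * \<kappa>g) * (\<kappa>d * \<kappa>g)"
    by (auto simp: max_def)
  have "\<kappa>d * \<kappa>g\<^sup>2 * (1 + 1/2 * \<kappa>H * \<kappa>d) = \<kappa>g * (\<kappa>d * \<kappa>g) + 1/2 * (\<kappa>H * (\<kappa>d * \<kappa>g) * (\<kappa>d * \<kappa>g))"
    by (simp add: algebra_simps power2_eq_square)
  then show ?thesis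
    using 1 2 unfolding q_model_def by linarith
qed

text \<open>The quadratic form of \<open>H\<close> is convex along the null space of \<open>J\<close>, so its positive part lies
  above the subgradient inequality at \<open>dt\<close>; in conditional mean only the last term survives.\<close>
lemma q_model_gap_le:
  assumes kg: "kkt_solution H J g c d y" and kt: "kkt_solution H J gt c dt yt"
    and H: "transpose H = H"
    and pd: "\<And>u. J *v u = 0 \<Longrightarrow> u \<bullet> (H *v u) \<ge> \<zeta> * (norm u)\<^sup>2" and \<zeta>: "\<zeta> > 0"
  shows "q_model gt H dt - q_model g H d \<le> - ((g - gt) \<bullet> dt)
    - (if dt \<bullet> (H *v dt) > 0 then 0 else 1) * (gt \<bullet> (d - dt)) + (norm (g - gt))\<^sup>2 / \<zeta>"
proof -
  define u n where "u = d - dt" and "n = g - gt"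
  have ku: "kkt_solution H J n 0 u (y - yt)"
    unfolding u_def n_def by (rule kkt_solution_diff[OF kg kt])
  then have Ju: "J *v u = 0" by (simp add: kkt_solution_def)
  have ku': "kkt_solution H J (- (- n)) 0 u (y - yt)" using ku by simp
  have nu: "- (n \<bullet> u) \<le> (norm n)\<^sup>2 / \<zeta>"
    using kkt_step_bound(3)[OF ku' pd \<zeta>] by simp
  \<comment> \<open>The first block row of the true system, tested with the null-space vector
    \<open>u\<close>, expresses the cross term of the quadratic form through the true
    gradient.\<close>
  have "u \<bullet> (H *v dt + transpose J *v yt) = - (gt \<bullet> u)"
    using kt by (simp add: kkt_solution_def inner_commute)
  then have "dt \<bullet> (H *v u) = - (gt \<bullet> u)"
    using inner_transpose_null[OF Ju, of yt] inner_sym_matrix[OF H, of dt u]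
    by (simp add: inner_add_right inner_commute)
  moreover have "u \<bullet> (H *v dt) = dt \<bullet> (H *v u)"
    using inner_sym_matrix[OF H, of dt u] by (simp add: inner_commute)
  moreover have "0 \<le> u \<bullet> (H *v u)"
    using pd[OF Ju] \<zeta> by (smt (verit) mult_nonneg_nonneg zero_le_power2)
  moreover have d: "d = dt + u" by (simp add: u_def)
  ultimately have "d \<bullet> (H *v d) \<ge> dt \<bullet> (H *v dt) - 2 * (gt \<bullet> u)"
    by (simp add: matrix_vector_right_distrib inner_add_left inner_add_right)
  \<comment> \<open>For positive curvature at \<open>dt\<close>, half of the subgradient term
    cancels the \<open>gt \<bullet> u\<close> contained in \<open>g \<bullet> d\<close>; otherwise
    the subgradient is 0 and \<open>gt \<bullet> u\<close> survives. This is the origin of the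
    coefficient 0 or 1 in the claim.\<close>
  then have "max (d \<bullet> (H *v d)) 0 \<ge> max (dt \<bullet> (H *v dt)) 0
      - 2 * (if dt \<bullet> (H *v dt) > 0 then 1 else 0) * (gt \<bullet> u)"
    by auto
  moreover have "g \<bullet> d = gt \<bullet> dt + n \<bullet> dt + gt \<bullet> u + n \<bullet> u"
    by (simp add: n_def d inner_diff_left inner_add_right)
  ultimately show ?thesis
    using nu unfolding q_model_def u_def[symmetric] n_def[symmetric] by (auto split: if_splits)
qed

text \<open>A two-sided bound by norms alone, to be multiplied by a weight that depends on the
  noise, where a signed linear term would not average out.\<close>

lemma q_model_gap_abs:
  assumes kg: "kkt_solution H J g c d y" and kt: "kkt_solution H J gt c dt yt"
    and H: "transpose H = H" "onorm ((*v) H) \<le> \<kappa>H" "\<kappa>H \<ge> 0"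
    and bounds: "norm gt \<le> \<kappa>g" "norm dt \<le> \<kappa>d * \<kappa>g" "norm (d - dt) \<le> \<kappa>d * norm (g - gt)"
      "\<kappa>d > 0"
  shows "\<bar>q_model gt H dt - q_model g H d\<bar>
    \<le> 2 * \<kappa>d * \<kappa>g * norm (g - gt) + \<kappa>d * (norm (g - gt))\<^sup>2
      + \<kappa>H * \<kappa>d\<^sup>2 * (\<kappa>g\<^sup>2 / 2 + (norm (g - gt))\<^sup>2)"
proof -
  define u n N where "u = d - dt" and "n = g - gt" and "N = norm n"
  have N: "N \<ge> 0" and \<kappa>g: "\<kappa>g \<ge> 0" and nu: "norm u \<le> \<kappa>d * N"
    using bounds order_trans[OF norm_ge_zero bounds(1)] by (auto simp: N_def u_def n_def)
  have d: "d = dt + u" by (simp add: u_def)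
  have "\<bar>n \<bullet> dt\<bar> \<le> N * (\<kappa>d * \<kappa>g)"
    using Cauchy_Schwarz_ineq2[of n dt] mult_left_mono[OF bounds(2) N] by (simp add: N_def)
  moreover have "\<bar>gt \<bullet> u\<bar> \<le> \<kappa>g * (\<kappa>d * N)"
    using Cauchy_Schwarz_ineq2[of gt u] mult_mono[OF bounds(1) nu \<kappa>g] by simp
  moreover have "\<bar>n \<bullet> u\<bar> \<le> N * (\<kappa>d * N)"
    using Cauchy_Schwarz_ineq2[of n u] mult_left_mono[OF nu N] by (simp add: N_def)
  moreover have "g \<bullet> d = gt \<bullet> dt + n \<bullet> dt + gt \<bullet> u + n \<bullet> u"
    by (simp add: n_def d inner_diff_left inner_add_right)
  ultimately have lin: "\<bar>gt \<bullet> dt - g \<bullet> d\<bar> \<le> N * (\<kappa>d * \<kappa>g) + \<kappa>g * (\<kappa>d * N) + N * (\<kappa>d * N)"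
    by linarith
  have "u \<bullet> (H *v dt) = dt \<bullet> (H *v u)"
    using inner_sym_matrix[OF H(1), of dt u] by (simp add: inner_commute)
  then have "d \<bullet> (H *v d) = dt \<bullet> (H *v dt) + 2 * (dt \<bullet> (H *v u)) + u \<bullet> (H *v u)"
    by (simp add: d matrix_vector_right_distrib inner_add_left inner_add_right)
  moreover have "\<bar>dt \<bullet> (H *v u)\<bar> \<le> \<kappa>H * (\<kappa>d * \<kappa>g) * (\<kappa>d * N)"
  proof -
    have "\<kappa>H * norm dt * norm u \<le> \<kappa>H * (\<kappa>d * \<kappa>g) * (\<kappa>d * N)"
      using bounds H \<kappa>g nu by (intro mult_mono) auto
    then show ?thesis using inner_matrix_le[OF H(2), of dt u] by linarith
  qed
  moreover have "\<bar>u \<bullet> (H *v u)\<bar> \<le> \<kappa>H * (\<kappa>d * N) * (\<kappa>d * N)"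
  proof -
    have "\<kappa>H * norm u * norm u \<le> \<kappa>H * (\<kappa>d * N) * (\<kappa>d * N)"
      using bounds H nu N by (intro mult_mono) auto
    then show ?thesis using inner_matrix_le[OF H(2), of u u] by linarith
  qed
  ultimately have quad: "\<bar>max (dt \<bullet> (H *v dt)) 0 - max (d \<bullet> (H *v d)) 0\<bar>
      \<le> 2 * (\<kappa>H * (\<kappa>d * \<kappa>g) * (\<kappa>d * N)) + \<kappa>H * (\<kappa>d * N) * (\<kappa>d * N)"
    by linarith
  \<comment> \<open>Expanding the square absorbs the cross term \<open>\<kappa>g * N\<close> of the
    quadratic form and produces the noise-free part \<open>\<kappa>g\<^sup>2 / 2\<close>.\<close>
  have "0 \<le> \<kappa>H * \<kappa>d\<^sup>2 * (\<kappa>g - N)\<^sup>2"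
    using H by simp
  then have "2 * (\<kappa>H * (\<kappa>d * \<kappa>g) * (\<kappa>d * N)) + \<kappa>H * (\<kappa>d * N) * (\<kappa>d * N)
      \<le> 2 * (\<kappa>H * \<kappa>d\<^sup>2 * (\<kappa>g\<^sup>2 / 2 + N\<^sup>2))"
    by (simp add: power2_eq_square algebra_simps)
  then have "\<bar>q_model gt H dt - q_model g H d\<bar>
      \<le> N * (\<kappa>d * \<kappa>g) + \<kappa>g * (\<kappa>d * N) + N * (\<kappa>d * N) + \<kappa>H * \<kappa>d\<^sup>2 * (\<kappa>g\<^sup>2 / 2 + N\<^sup>2)"
    using lin quad unfolding q_model_def by linarith
  also have "\<dots> = 2 * \<kappa>d * \<kappa>g * N + \<kappa>d * N\<^sup>2 + \<kappa>H * \<kappa>d\<^sup>2 * (\<kappa>g\<^sup>2 / 2 + N\<^sup>2)"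
    by (simp add: power2_eq_square algebra_simps)
  finally show ?thesis by (simp add: N_def n_def)
qed

section \<open>Parameter updates and the decrease of the merit function in one iteration\<close>

lemma tau_trial_nonneg: "\<sigma> < 1 \<Longrightarrow> 0 \<le> tau_trial \<sigma> c x g H d"
  unfolding tau_trial_def by (auto intro!: mult_nonneg_nonneg divide_nonneg_pos l1_norm_nonneg)

lemma tau_update_le:
  assumes "0 \<le> t" "\<epsilon> \<in> {0<..<1}"
  shows "tau_update \<epsilon> t \<tau> \<le> \<tau>" "ereal (tau_update \<epsilon> t \<tau>) \<le> t"
proof -
  have "tau_update \<epsilon> t \<tau> \<le> \<tau> \<and> ereal (tau_update \<epsilon> t \<tau>) \<le> t"
  proof (cases "ereal \<tau> \<le> t")
    case False
    then obtain r where r: "t = ereal r" "0 \<le> r" "r < \<tau>"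
      using assms(1) by (cases t) auto
    have "(1 - \<epsilon>) * r \<le> 1 * r"
      using assms(2) r by (intro mult_right_mono) auto
    then show ?thesis
      using False r by (auto simp: tau_update_def)
  qed (auto simp: tau_update_def)
  then show "tau_update \<epsilon> t \<tau> \<le> \<tau>" "ereal (tau_update \<epsilon> t \<tau>) \<le> t" by auto
qed

text \<open>For a negative trial value, shrinking by \<open>1 - \<epsilon>\<close> moves it up, so
  the second bound would fail. Positivity of the updated value, which holds on \<open>E\<close>,
  excludes this case.\<close>

lemma xi_update_le:
  assumes "\<epsilon> \<in> {0<..<1}" "\<xi> > 0"
  shows "xi_update \<epsilon> t \<xi> \<le> \<xi>"
    and "xi_update \<epsilon> t \<xi> > 0 \<Longrightarrow> xi_update \<epsilon> t \<xi> \<le> t"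
proof -
  have *: "(1 - \<epsilon>) * t \<le> 1 * t" if "t \<ge> 0"
    using assms that by (intro mult_right_mono) auto
  have neg: "(1 - \<epsilon>) * t \<le> 0" if "t < 0"
    using assms that by (intro mult_nonneg_nonpos) auto
  show "xi_update \<epsilon> t \<xi> \<le> \<xi>"
    using * neg assms by (cases "t \<ge> 0") (auto simp: xi_update_def)
  show "xi_update \<epsilon> t \<xi> \<le> t" if "xi_update \<epsilon> t \<xi> > 0"
    using * neg that by (cases "t \<ge> 0") (auto simp: xi_update_def split: if_splits)
qed

text \<open>The trial value keeps \<open>\<tau> * m\<close> below
  \<open>(1 - \<sigma>) * l1_norm (c x)\<close>, where \<open>m\<close> counts the positive
  curvature in full. The reduction counts only half of it and so cannot exceed
  \<open>\<tau> * m\<close> in the negative part.\<close>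

lemma delta_q_nonneg:
  assumes "ereal \<tau> \<le> tau_trial \<sigma> c x g H d" "\<tau> \<ge> 0" "\<sigma> \<ge> 0"
  shows "delta_q c x \<tau> g H d \<ge> 0"
proof -
  define m where "m = g \<bullet> d + max (d \<bullet> (H *v d)) 0"
  have "\<tau> * m \<le> l1_norm (c x)"
  proof (cases "m \<le> 0")
    case True
    then show ?thesis
      using assms l1_norm_nonneg[of "c x"] mult_nonneg_nonpos[of \<tau> m] by linarith
  next
    case False
    then have "\<tau> \<le> (1 - \<sigma>) * l1_norm (c x) / m"
      using assms(1) by (simp add: tau_trial_def m_def)
    then have "\<tau> * m \<le> (1 - \<sigma>) * l1_norm (c x)"
      using False by (simp add: field_simps)
    also have "\<dots> \<le> 1 * l1_norm (c x)"
      using assms l1_norm_nonneg by (intro mult_right_mono) auto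
    finally show ?thesis by simp
  qed
  moreover have "\<tau> * q_model g H d \<le> \<tau> * m"
    using assms(2) unfolding q_model_def m_def by (intro mult_left_mono) auto
  ultimately show ?thesis by (simp add: delta_q_eq)
qed

text \<open>When \<open>d = 0\<close> the algorithm takes \<open>\<alpha> = 1\<close>, but every step size gives the same next iterate;
  the witness \<open>a\<close> is chosen in the projection interval in that case as well.\<close>
lemma iteration_descent:
  fixes f :: "real^'n \<Rightarrow> real" and c :: "real^'n \<Rightarrow> real^'m"
  assumes it: "sqp_iteration c J \<epsilon>\<^sub>\<tau> \<epsilon>\<^sub>\<xi> \<sigma> \<theta> L \<Gamma> b H g x \<tau>p \<xi>p d y \<tau> \<xi> \<alpha> x'"
    and pars: "\<epsilon>\<^sub>\<xi> \<in> {0<..<1}" "\<theta> \<ge> 0" "L > 0" "\<Gamma> > 0" "b > 0" "\<tau> > 0" "\<xi> > 0" "\<xi>p > 0"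
    and lower_end: "b * \<xi> * \<tau> / (\<tau> * L + \<Gamma>) \<le> 1"
    and S: "convex S" "x \<in> S" "x' \<in> S"
    and f: "\<And>z. z \<in> S \<Longrightarrow> (f has_derivative (\<lambda>h. gradf z \<bullet> h)) (at z)" "L-lipschitz_on S gradf"
    and c: "\<And>x. x \<in> S \<Longrightarrow> (c has_derivative (\<lambda>h. J x *v h)) (at x)"
      "\<And>i. (\<gamma> i)-lipschitz_on S (\<lambda>x. J x $ i)" "\<Gamma> \<ge> (\<Sum>i\<in>UNIV. \<gamma> i)"
  obtains a where "b * \<xi> * \<tau> / (\<tau> * L + \<Gamma>) \<le> a" "a \<le> b * \<xi> * \<tau> / (\<tau> * L + \<Gamma>) + \<theta> * b\<^sup>2"
    "\<tau> * f x' + l1_norm (c x') \<le> \<tau> * f x + l1_norm (c x) - a * delta_q c x \<tau> (gradf x) H dt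
      + 1/2 * a * b * delta_q c x \<tau> g H d + a * \<tau> * (gradf x \<bullet> (d - dt))"
    "0 \<le> delta_q c x \<tau> g H d"
proof -
  define W lo where "W = \<tau> * L + \<Gamma>" and "lo = b * \<xi> * \<tau> / W"
  have W: "W > 0" using pars by (simp add: W_def add_pos_pos)
  have lo: "lo \<ge> 0" using W pars by (simp add: lo_def)
  have "J x *v d = - c x"
    using it by (simp add: sqp_iteration_def kkt_solution_def)
  have dq_true: "delta_q c x \<tau> (gradf x) H dt \<le> - \<tau> * (gradf x \<bullet> dt) + l1_norm (c x)"
  proof -
    have "0 \<le> \<tau> * (1/2 * max (dt \<bullet> (H *v dt)) 0)" using pars by simp
    then show ?thesis by (simp add: delta_q_def algebra_simps)
  qed
  \<comment> \<open>A bound in terms of the full step suffices: writing \<open>d\<close> as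
    \<open>dt\<close> plus the step error turns the directional derivative and the constraint term
    into the true reduction plus the drift.\<close>
  have reduce: "\<tau> * f x' + l1_norm (c x') \<le> \<tau> * f x + l1_norm (c x) - a * delta_q c x \<tau> (gradf x) H dt
      + 1/2 * a * b * delta_q c x \<tau> g H d + a * \<tau> * (gradf x \<bullet> (d - dt))"
    if "0 \<le> a" "\<tau> * f x' + l1_norm (c x')
        \<le> \<tau> * f x + l1_norm (c x) + a * \<tau> * (gradf x \<bullet> d) - a * l1_norm (c x)
          + 1/2 * a * b * delta_q c x \<tau> g H d" for a
    using that(2) mult_left_mono[OF dq_true that(1)] by (simp add: inner_diff_right algebra_simps)
  show thesis
  proof (cases "d = 0")
    case True
    then have "c x = 0" "x' = x"
      using it by (simp_all add: sqp_iteration_def kkt_solution_def)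
    then show thesis
      using True lo pars by (intro that[of lo] reduce) (auto simp: lo_def W_def delta_q_def l1_norm_def)
  next
    case False
    define \<Delta> where "\<Delta> = delta_q c x \<tau> g H d"
    define C where "C = l1_norm (c x)"
    have C: "C \<ge> 0" by (simp add: C_def l1_norm_nonneg)
    define nn where "nn = (norm d)\<^sup>2"
    have nn: "nn > 0" using False by (simp add: nn_def)
    have \<xi>: "\<xi> = xi_update \<epsilon>\<^sub>\<xi> (xi_trial c x \<tau> g H d) \<xi>p" and x': "x' = x + \<alpha> *\<^sub>R d"
      and \<alpha>: "\<alpha> = step_size c \<theta> L \<Gamma> b x \<tau> \<xi> g H d"
      using it False by (auto simp: sqp_iteration_def)
    have "\<xi> \<le> \<Delta> / (\<tau> * nn)"
      using xi_update_le(2)[OF pars(1) pars(8)] pars(7) unfolding \<xi> xi_trial_def \<Delta>_def nn_def by simp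
    then have \<xi>\<Delta>: "\<xi> * \<tau> * nn \<le> \<Delta>"
      using pars nn by (simp add: field_simps)
    have "0 \<le> \<xi> * \<tau> * nn" using pars nn by simp
    then have \<Delta>: "0 \<le> \<Delta>" using \<xi>\<Delta> by linarith
    define hi hin tin hat til where "hi = lo + \<theta> * b\<^sup>2" and "hin = b * \<Delta> / (W * nn)"
      and "tin = hin - 4 * C / (W * nn)" and "hat = max lo (min hi hin)" and "til = max lo (min hi tin)"
    have lohi: "lo \<le> hi" using pars by (simp add: hi_def)
    have \<alpha>': "\<alpha> = (if hat < 1 then hat else if til \<le> 1 then 1 else til)"
      using lohi unfolding \<alpha> step_size_def Let_def hat_def til_def hi_def lo_def W_def hin_def tin_def
        \<Delta>_def nn_def C_def by (simp add: closest_point_interval)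
    have "b * (\<xi> * \<tau> * nn) \<le> b * \<Delta>" using \<xi>\<Delta> pars by (intro mult_left_mono) auto
    then have "lo \<le> hin" using W nn by (simp add: lo_def hin_def field_simps)
    then have hat: "hat \<le> hin" "hat \<le> hi" "lo \<le> hat" using lohi by (auto simp: hat_def)
    \<comment> \<open>The condition \<open>lower_end\<close> enters here. The raw value
      \<open>tin\<close> may lie below \<open>lo\<close>, and then \<open>til\<close> is
      \<open>lo\<close>; since \<open>lo \<le> 1\<close>, a value of \<open>til\<close> above 1
      cannot have been raised by the projection.\<close>
    have til: "til \<le> hi" "lo \<le> til" "til > 1 \<Longrightarrow> til \<le> tin"
      using lohi lower_end by (auto simp: til_def lo_def W_def)
    have range: "lo \<le> \<alpha>" "\<alpha> \<le> hi"
      using hat til unfolding \<alpha>' by auto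
    then have \<alpha>0: "0 \<le> \<alpha>" using lo by linarith
    have f': "f x' \<le> f x + \<alpha> * (gradf x \<bullet> d) + L / 2 * (\<alpha>\<^sup>2 * nn)"
      using quadratic_upper_bound[OF S f] by (simp add: x' nn_def power_mult_distrib)
    have c': "l1_norm (c x') \<le> \<bar>1 - \<alpha>\<bar> * C + \<Gamma> / 2 * (\<alpha>\<^sup>2 * nn)"
      using l1_norm_linearization[OF S(1,2) S(3)[unfolded x'] c \<open>J x *v d = - c x\<close>]
      by (simp add: x' nn_def C_def mult.assoc)
    have "\<tau> * f x' \<le> \<tau> * (f x + \<alpha> * (gradf x \<bullet> d) + L / 2 * (\<alpha>\<^sup>2 * nn))"
      using f' pars by (intro mult_left_mono) auto
    then have merit: "\<tau> * f x' + l1_norm (c x') \<le> \<tau> * f x + \<alpha> * \<tau> * (gradf x \<bullet> d) + \<bar>1 - \<alpha>\<bar> * C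
        + 1/2 * \<alpha> * (\<alpha> * (W * nn))"
      using c' by (simp add: W_def algebra_simps power2_eq_square)
    have "\<bar>1 - \<alpha>\<bar> * C + 1/2 * \<alpha> * (\<alpha> * (W * nn)) \<le> C - \<alpha> * C + 1/2 * \<alpha> * (b * \<Delta>)"
    proof (cases "\<alpha> \<le> 1")
      case True
      then have "\<alpha> \<le> hin" using hat til unfolding \<alpha>' by (auto split: if_splits)
      then have "\<alpha> * (W * nn) \<le> b * \<Delta>"
        using W nn by (simp add: hin_def field_simps)
      then have "1/2 * \<alpha> * (\<alpha> * (W * nn)) \<le> 1/2 * \<alpha> * (b * \<Delta>)"
        using \<alpha>0 by (intro mult_left_mono) auto
      then show ?thesis using True by (simp add: algebra_simps)
    next
      \<comment> \<open>Beyond the unit step, \<open>\<bar>1 - \<alpha>\<bar> * C\<close> exceeds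
        \<open>(1 - \<alpha>) * C\<close> by \<open>2 * (\<alpha> - 1) * C\<close>. The
        \<open>4 * C\<close> subtracted in \<open>tin\<close>, halved by the factor 1/2 of the
        quadratic term, pays \<open>2 * \<alpha> * C\<close>.\<close>
      case gt: False
      then have "\<alpha> \<le> tin" using til unfolding \<alpha>' by (auto split: if_splits)
      then have "\<alpha> \<le> (b * \<Delta> - 4 * C) / (W * nn)"
        by (simp add: tin_def hin_def diff_divide_distrib)
      then have "\<alpha> * (W * nn) \<le> b * \<Delta> - 4 * C"
        using W nn by (simp add: field_simps)
      then have "1/2 * \<alpha> * (\<alpha> * (W * nn)) \<le> 1/2 * \<alpha> * (b * \<Delta> - 4 * C)"
        using \<alpha>0 by (intro mult_left_mono) auto
      then show ?thesis using gt C by (simp add: algebra_simps)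
    qed
    then show thesis
      using range \<Delta> merit \<alpha>0
      by (intro that[of \<alpha>] reduce) (auto simp: lo_def W_def hi_def \<Delta>_def C_def)
  qed
qed

lemma iteration_parameters_le:
  assumes it: "sqp_iteration c J \<epsilon>\<^sub>\<tau> \<epsilon>\<^sub>\<xi> \<sigma> \<theta> L \<Gamma> b H g x \<tau>p \<xi>p d y \<tau> \<xi> \<alpha> x'"
    and pars: "\<epsilon>\<^sub>\<tau> \<in> {0<..<1}" "\<epsilon>\<^sub>\<xi> \<in> {0<..<1}" "\<sigma> < 1"
  shows "\<tau> \<le> \<tau>p" "\<xi>p > 0 \<Longrightarrow> \<xi> \<le> \<xi>p"
  using it tau_update_le(1)[OF tau_trial_nonneg[OF pars(3)] pars(1)] xi_update_le(1)[OF pars(2)]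
  unfolding sqp_iteration_def by (auto split: if_splits)

text \<open>The trial value decreases as its denominator grows. Hence a stochastic denominator at
  least as large as the true one pushes the stochastic trial below \<open>\<tau>p\<close> too, and
  the update must follow. This turns the event of (A4) into a countable decrease of
  \<open>\<tau>\<close>.\<close>

lemma tau_decrease:
  assumes it: "sqp_iteration c J \<epsilon>\<^sub>\<tau> \<epsilon>\<^sub>\<xi> \<sigma> \<theta> L \<Gamma> b H g x \<tau>p \<xi>p d y \<tau> \<xi> \<alpha> x'"
    and pars: "\<epsilon>\<^sub>\<tau> \<in> {0<..<1}" "\<sigma> < 1"
    and trial: "tau_trial \<sigma> c x gt H dt < ereal \<tau>p"
    and le: "gt \<bullet> dt + max (dt \<bullet> (H *v dt)) 0 \<le> g \<bullet> d + max (d \<bullet> (H *v d)) 0"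
  shows "\<tau> < \<tau>p"
proof -
  let ?mt = "gt \<bullet> dt + max (dt \<bullet> (H *v dt)) 0" and ?m = "g \<bullet> d + max (d \<bullet> (H *v d)) 0"
  have mt: "?mt > 0"
    using trial by (auto simp: tau_trial_def split: if_splits)
  then have m: "?m > 0" using le by linarith
  then have d: "d \<noteq> 0" by auto
  have "(1 - \<sigma>) * l1_norm (c x) / ?m \<le> (1 - \<sigma>) * l1_norm (c x) / ?mt"
    using mt m le pars l1_norm_nonneg by (intro divide_left_mono mult_nonneg_nonneg mult_pos_pos) auto
  then have "tau_trial \<sigma> c x g H d < ereal \<tau>p"
    using trial mt m by (simp add: tau_trial_def)
  moreover have "ereal \<tau> \<le> tau_trial \<sigma> c x g H d"
    using it d tau_update_le(2)[OF tau_trial_nonneg[OF pars(2)] pars(1)] by (simp add: sqp_iteration_def)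
  ultimately show ?thesis by (metis ereal_less_eq(3) not_le order.strict_trans1)
qed

lemma ratio_mono:
  fixes x y L \<Gamma> :: real
  assumes "0 < x" "x \<le> y" "L > 0" "\<Gamma> > 0"
  shows "x / (x * L + \<Gamma>) \<le> y / (y * L + \<Gamma>)"
proof -
  have "x * L + \<Gamma> > 0" "y * L + \<Gamma> > 0" using assms by (auto intro!: add_pos_pos mult_pos_pos)
  moreover have "x * \<Gamma> \<le> y * \<Gamma>" using assms by simp
  ultimately show ?thesis by (simp add: field_simps)
qed

text \<open>\<open>\<tau>\<close> is random and correlated with the gap, so the one-sided bound
  \<open>u\<close> can only be used with a deterministic weight. Expanding about the midpoint of the
  range gives \<open>u\<close> the fixed weight and leaves to the cruder \<open>v\<close> a
  deviation of at most half the length. This is where the factors \<open>\<tau>i + \<tau>m\<close>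
  and \<open>\<tau>i - \<tau>m\<close> of \<open>Mbar\<close> come from.\<close>

lemma weighted_gap_le:
  fixes \<tau> :: real
  assumes "\<tau>m \<le> \<tau>" "\<tau> \<le> \<tau>i" "0 < \<tau>m" "gap \<le> u" "\<bar>gap\<bar> \<le> v"
  shows "\<tau> * gap \<le> (\<tau>i + \<tau>m) / 2 * u + (\<tau>i - \<tau>m) / 2 * v"
proof -
  have "(\<tau>i + \<tau>m) / 2 * gap \<le> (\<tau>i + \<tau>m) / 2 * u"
    using assms by (intro mult_left_mono) auto
  moreover have "(\<tau> - (\<tau>i + \<tau>m) / 2) * gap \<le> (\<tau>i - \<tau>m) / 2 * v"
  proof -
    have "\<bar>\<tau> - (\<tau>i + \<tau>m) / 2\<bar> \<le> (\<tau>i - \<tau>m) / 2"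
      using assms unfolding abs_le_iff by (simp add: field_simps)
    then have "\<bar>\<tau> - (\<tau>i + \<tau>m) / 2\<bar> * \<bar>gap\<bar> \<le> (\<tau>i - \<tau>m) / 2 * v"
      using assms by (intro mult_mono) auto
    then show ?thesis by (metis abs_ge_self abs_mult order.trans)
  qed
  moreover have "\<tau> * gap = (\<tau>i + \<tau>m) / 2 * gap + (\<tau> - (\<tau>i + \<tau>m) / 2) * gap"
    by (simp add: field_simps)
  ultimately show ?thesis by linarith
qed

text \<open>The descent estimate with all random coefficients replaced: every factor in front of a
  term linear in the noise is determined by the past or constant, and the remaining terms are norms
  of the noise or carry one of the two case distinctions.\<close>

lemma merit_decrease_bound:
  fixes f :: "real^'n \<Rightarrow> real" and c :: "real^'n \<Rightarrow> real^'m"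
  assumes it: "sqp_iteration c J \<epsilon>\<^sub>\<tau> \<epsilon>\<^sub>\<xi> \<sigma> \<theta> L \<Gamma> b H g x \<tau>p \<xi>p d y \<tau> \<xi> \<alpha> x'"
    and true: "kkt_solution H (J x) (gradf x) (c x) dt yt"
    and pars: "\<epsilon>\<^sub>\<tau> \<in> {0<..<1}" "\<epsilon>\<^sub>\<xi> \<in> {0<..<1}" "\<sigma> \<in> {0<..<1}" "\<theta> \<ge> 0" "L > 0" "\<Gamma> > 0" "b > 0"
    and lower_end: "b * \<xi> * \<tau> / (\<tau> * L + \<Gamma>) \<le> 1"
    and S: "convex S" "x \<in> S" "x' \<in> S"
    and f: "\<And>z. z \<in> S \<Longrightarrow> (f has_derivative (\<lambda>h. gradf z \<bullet> h)) (at z)" "L-lipschitz_on S gradf"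
    and c: "\<And>x. x \<in> S \<Longrightarrow> (c has_derivative (\<lambda>h. J x *v h)) (at x)"
      "\<And>i. (\<gamma> i)-lipschitz_on S (\<lambda>x. J x $ i)" "\<Gamma> \<ge> (\<Sum>i\<in>UNIV. \<gamma> i)"
    and H: "transpose H = H" "onorm ((*v) H) \<le> \<kappa>H" "\<kappa>H \<ge> 0"
      "\<And>u. J x *v u = 0 \<Longrightarrow> u \<bullet> (H *v u) \<ge> \<zeta> * (norm u)\<^sup>2" "\<zeta> > 0"
    and bounds: "norm (gradf x) \<le> \<kappa>g" "norm dt \<le> \<kappa>d * norm (gradf x)"
      "norm (d - dt) \<le> \<kappa>d * norm (g - gradf x)" "\<kappa>d > 0"
    and rng: "0 < \<tau>m" "\<tau>m \<le> \<tau>" "\<tau>p \<le> \<tau>i" "0 < \<xi>" "\<xi> \<le> \<xi>i" "0 < \<xi>p"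
    and Ttt: "Ttt = tau_trial \<sigma> c x (gradf x) H dt" "ereal \<tau>m \<le> Ttt"
    and hat: "hat = real_of_ereal (min (ereal \<tau>) Ttt)"
    and Amin: "Amin = \<xi> * \<tau>m / (\<tau>m * L + \<Gamma>)" and Amax: "Amax = \<xi>i * \<tau>i / (\<tau>i * L + \<Gamma>)"
    and U: "U = Amax + \<theta> * b" "b * U \<le> Amin" and V: "V = U * \<tau>i - Amin * \<tau>m"
  defines "n \<equiv> g - gradf x" and "r \<equiv> gradf x \<bullet> (d - dt)"
  shows "1/2 * Amin * b * delta_q c x hat (gradf x) H dt \<le>
      \<tau> * (f x - f x') + l1_norm (c x) - l1_norm (c x')
      + 1/2 * U * b\<^sup>2 * ((\<tau>i + \<tau>m) / 2 *
            (- (n \<bullet> dt) - (if dt \<bullet> (H *v dt) > 0 then 0 else 1) * r + (norm n)\<^sup>2 / \<zeta>)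
          + (\<tau>i - \<tau>m) / 2 * (2 * \<kappa>d * \<kappa>g * norm n + \<kappa>d * (norm n)\<^sup>2
              + \<kappa>H * \<kappa>d\<^sup>2 * (\<kappa>g\<^sup>2 / 2 + (norm n)\<^sup>2)))
      + b * (V * (\<kappa>d * \<kappa>g\<^sup>2 * (1 + 1/2 * \<kappa>H * \<kappa>d))) * (if Ttt < ereal \<tau>p then 1 else 0)
      + b * \<xi> * \<tau>p / (\<tau>p * L + \<Gamma>) * \<tau>p * r + \<theta> * b\<^sup>2 * \<tau>i * (\<kappa>g * \<kappa>d) * norm n
      + b * V * (\<kappa>g * \<kappa>d) * (norm n * (if r < 0 \<and> \<tau> < \<tau>p then 1 else 0))"
proof -
  have \<tau>: "0 < \<tau>" "\<tau> \<le> \<tau>p" "\<tau> \<le> \<tau>i"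
    using rng iteration_parameters_le(1)[OF it pars(1,2)] pars(3) by auto
  have \<kappa>g: "0 \<le> \<kappa>g" using bounds(1) norm_ge_zero order_trans by blast
  have dt: "norm dt \<le> \<kappa>d * \<kappa>g"
    using bounds by (smt (verit) mult_left_mono)
  have hat': "\<tau>m \<le> hat" "hat \<le> \<tau>" "ereal hat \<le> Ttt"
    using rng(2) Ttt(2) by (cases Ttt; auto simp: hat min_def)+
  then have Z: "0 \<le> delta_q c x hat (gradf x) H dt"
    using delta_q_nonneg[of hat \<sigma> c x "gradf x" H dt] pars rng Ttt by auto
  define lo where "lo t = b * \<xi> * t / (t * L + \<Gamma>)" for t
  have lo_eq: "lo t = b * \<xi> * (t / (t * L + \<Gamma>))" for t by (simp add: lo_def)
  have lo_mono: "lo s \<le> lo t" if "0 < s" "s \<le> t" for s t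
    unfolding lo_eq using rng pars ratio_mono[OF that] by (intro mult_left_mono) auto
  have \<tau>p: "0 < \<tau>p" and \<tau>i: "0 < \<tau>i" using \<tau> by linarith+
  have lo_max: "lo \<tau>i \<le> b * Amax"
  proof -
    have "\<xi> * (\<tau>i / (\<tau>i * L + \<Gamma>)) \<le> \<xi>i * (\<tau>i / (\<tau>i * L + \<Gamma>))"
      using rng \<tau>i pars by (intro mult_right_mono) auto
    then have "b * (\<xi> * (\<tau>i / (\<tau>i * L + \<Gamma>))) \<le> b * (\<xi>i * (\<tau>i / (\<tau>i * L + \<Gamma>)))"
      using pars by (intro mult_left_mono) auto
    then show ?thesis by (simp add: lo_eq Amax mult.assoc)
  qed
  have lo_min: "lo \<tau>m = b * Amin" by (simp add: lo_def Amin)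
  have Apos: "Amin > 0" unfolding Amin using rng pars by (intro divide_pos_pos mult_pos_pos add_pos_pos)
  obtain a where a: "lo \<tau> \<le> a" "a \<le> lo \<tau> + \<theta> * b\<^sup>2"
    and desc: "\<tau> * f x' + l1_norm (c x') \<le> \<tau> * f x + l1_norm (c x) - a * delta_q c x \<tau> (gradf x) H dt
      + 1/2 * a * b * delta_q c x \<tau> g H d + a * \<tau> * (gradf x \<bullet> (d - dt))"
    and Dg0: "0 \<le> delta_q c x \<tau> g H d"
    unfolding lo_def
    by (rule iteration_descent[OF it pars(2,4-7) \<tau>(1) rng(4,6) lower_end S f c])
  define Dg Z where "Dg = delta_q c x \<tau> g H d" and "Z = delta_q c x hat (gradf x) H dt"
  define qt qg where "qt = q_model (gradf x) H dt" and "qg = q_model g H d"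
  define N where "N = norm n"
  have N: "N \<ge> 0" by (simp add: N_def)
  have Dt: "delta_q c x \<tau> (gradf x) H dt = Z - (\<tau> - hat) * qt"
    by (simp add: Z_def delta_q_eq qt_def algebra_simps)
  have Dg: "Dg = Z - (\<tau> - hat) * qt + \<tau> * (qt - qg)"
    by (simp add: Dg_def Z_def delta_q_eq qt_def qg_def algebra_simps)
  have a_ge: "b * Amin \<le> a"
    using lo_mono[OF rng(1,2)] a lo_min by linarith
  have a_lob: "a \<le> lo \<tau>p + \<theta> * b\<^sup>2"
    using a lo_mono[OF \<tau>(1,2)] by linarith
  have a_le: "a \<le> b * U"
  proof -
    have "a \<le> lo \<tau>i + \<theta> * b\<^sup>2" using a lo_mono[OF \<tau>(1,3)] by linarith
    also have "\<dots> \<le> b * U" using lo_max by (simp add: U algebra_simps power2_eq_square)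
    finally show ?thesis .
  qed
  have a0: "0 \<le> a" using a_ge Apos pars by (smt (verit) mult_pos_pos)
  \<comment> \<open>Since \<open>a \<le> b * U\<close>, \<open>w\<close> dominates the factor
    \<open>1/2 * a * b\<close> in front of the stochastic reduction. The condition
    \<open>b * U \<le> Amin\<close> makes it at most half of the least step size
    \<open>b * Amin\<close>, so half of the decrease survives.\<close>
  define w where "w = b * U * b / 2"
  have w: "0 \<le> w" "w \<le> 1/2 * Amin * b"
  proof -
    show "0 \<le> w" using a0 a_le pars by (simp add: w_def)
    have "b * U * b \<le> Amin * b" using U pars by (intro mult_right_mono) auto
    then show "w \<le> 1/2 * Amin * b" by (simp add: w_def)
  qed
  have gap: "\<tau> * (qt - qg) \<le> (\<tau>i + \<tau>m) / 2 *
            (- (n \<bullet> dt) - (if dt \<bullet> (H *v dt) > 0 then 0 else 1) * r + N\<^sup>2 / \<zeta>)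
          + (\<tau>i - \<tau>m) / 2 * (2 * \<kappa>d * \<kappa>g * N + \<kappa>d * N\<^sup>2
              + \<kappa>H * \<kappa>d\<^sup>2 * (\<kappa>g\<^sup>2 / 2 + N\<^sup>2))" (is "_ \<le> ?gap")
  proof (rule weighted_gap_le)
    have k: "kkt_solution H (J x) g (c x) d y" using it by (simp add: sqp_iteration_def)
    show "qt - qg \<le> - (n \<bullet> dt) - (if dt \<bullet> (H *v dt) > 0 then 0 else 1) * r + N\<^sup>2 / \<zeta>"
      unfolding qt_def qg_def n_def r_def N_def by (rule q_model_gap_le[OF k true H(1) H(4,5)])
    show "\<bar>qt - qg\<bar> \<le> 2 * \<kappa>d * \<kappa>g * N + \<kappa>d * N\<^sup>2 + \<kappa>H * \<kappa>d\<^sup>2 * (\<kappa>g\<^sup>2 / 2 + N\<^sup>2)"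
      unfolding qt_def qg_def n_def N_def
      by (rule q_model_gap_abs[OF k true H(1-3) bounds(1) dt bounds(3,4)])
  qed (use rng \<tau> in auto)
  \<comment> \<open>\<open>b * V\<close> is the spread of step size times merit parameter: the first
    factor ranges between \<open>b * Amin\<close> and \<open>b * U\<close>, the second between
    \<open>\<tau>m\<close> and \<open>\<tau>i\<close>.\<close>
  have wV: "a * (\<tau> - hat) \<le> b * V"
  proof -
    have "a * \<tau> \<le> (b * U) * \<tau>i" using a_le \<tau> a0 by (intro mult_mono) auto
    moreover have "(b * Amin) * \<tau>m \<le> a * hat" using a_ge hat' rng a0 by (intro mult_mono) auto
    ultimately show ?thesis by (simp add: V algebra_simps)
  qed
  have lo\<tau>i: "lo \<tau>p * \<tau>p \<le> b * U * \<tau>i"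
  proof -
    have "lo \<tau>p \<le> b * U"
      using lo_mono[OF \<tau>p rng(3)] lo_max pars by (simp add: U algebra_simps)
         (smt (verit) mult_nonneg_nonneg)
    moreover have "0 \<le> lo \<tau>p" using \<tau>p pars rng by (simp add: lo_def)
    ultimately show ?thesis using \<tau>p rng by (intro mult_mono) auto
  qed
  have V0: "0 \<le> b * V"
  proof -
    have "b * Amin \<le> lo \<tau>p" using lo_mono[of \<tau>m \<tau>p] lo_min rng \<tau> by simp
    then have "b * Amin * \<tau>m \<le> lo \<tau>p * \<tau>p"
      using rng \<tau> Apos pars by (intro mult_mono) (auto intro: order_trans[rotated])
    then show ?thesis using lo\<tau>i by (simp add: V algebra_simps)
  qed
  \<comment> \<open>Replacing \<open>\<tau>\<close> by \<open>hat\<close> costs something only if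
    the true trial value lies below \<open>\<tau>\<close>, hence below \<open>\<tau>p\<close>. The
    coarser condition is used because it depends on the past alone.\<close>
  have tail: "(a - w) * ((\<tau> - hat) * qt)
      \<le> b * (V * (\<kappa>d * \<kappa>g\<^sup>2 * (1 + 1/2 * \<kappa>H * \<kappa>d))) * (if Ttt < ereal \<tau>p then 1 else 0)"
  proof (cases "Ttt < ereal \<tau>p")
    case True
    have w': "0 \<le> a - w" "a - w \<le> a" using w a_ge Apos pars by (auto simp: algebra_simps)
    have Q: "\<bar>qt\<bar> \<le> \<kappa>d * \<kappa>g\<^sup>2 * (1 + 1/2 * \<kappa>H * \<kappa>d)"
      unfolding qt_def by (rule q_model_bound[OF H(2) bounds(1) dt H(3)])
    have "(a - w) * ((\<tau> - hat) * qt) \<le> (a - w) * ((\<tau> - hat) * \<bar>qt\<bar>)"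
      using w' hat' by (intro mult_left_mono) auto
    also have "\<dots> \<le> a * ((\<tau> - hat) * \<bar>qt\<bar>)"
      using w' hat' by (intro mult_right_mono) auto
    also have "\<dots> = a * (\<tau> - hat) * \<bar>qt\<bar>" by simp
    also have "\<dots> \<le> b * V * (\<kappa>d * \<kappa>g\<^sup>2 * (1 + 1/2 * \<kappa>H * \<kappa>d))"
      by (rule mult_mono[OF wV Q V0 abs_ge_zero])
    finally show ?thesis using True by (simp add: mult.assoc)
  next
    case False
    then have "ereal \<tau> \<le> Ttt" using \<tau>(2) by (meson ereal_less_eq(3) not_le order_trans)
    then have "hat = \<tau>" by (simp add: hat min_def)
    then show ?thesis using False by simp
  qed
  have r_abs: "\<bar>r\<bar> \<le> \<kappa>g * \<kappa>d * N"
  proof -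
    have "\<bar>r\<bar> \<le> norm (gradf x) * norm (d - dt)"
      unfolding r_def by (rule Cauchy_Schwarz_ineq2)
    also have "\<dots> \<le> \<kappa>g * (\<kappa>d * N)"
      using bounds \<kappa>g unfolding N_def n_def by (intro mult_mono) auto
    finally show ?thesis by simp
  qed
  \<comment> \<open>The reference coefficient is \<open>lo \<tau>p * \<tau>p\<close>. For
    \<open>r \<ge> 0\<close> the actual one exceeds it by at most the width of the projection
    interval times \<open>\<tau>i\<close>; for \<open>r < 0\<close> with unchanged
    \<open>\<tau>\<close> it is at least as large, which is favourable; only \<open>r < 0\<close>
    together with a drop of \<open>\<tau>\<close> costs \<open>b * V\<close>.\<close>
  have step: "a * \<tau> * r \<le> lo \<tau>p * \<tau>p * r + \<theta> * b\<^sup>2 * \<tau>i * (\<kappa>g * \<kappa>d) * N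
      + b * V * (\<kappa>g * \<kappa>d) * (N * (if r < 0 \<and> \<tau> < \<tau>p then 1 else 0))"
  proof (cases "r < 0")
    case False
    have 1: "a * \<tau> \<le> (lo \<tau>p + \<theta> * b\<^sup>2) * \<tau>p"
      using a_lob \<tau> a0 by (intro mult_mono) auto
    have "\<theta> * b\<^sup>2 * \<tau>p \<le> \<theta> * b\<^sup>2 * \<tau>i" using rng pars by (intro mult_left_mono) auto
    then have 2: "a * \<tau> - lo \<tau>p * \<tau>p \<le> \<theta> * b\<^sup>2 * \<tau>i" using 1 by (simp add: algebra_simps)
    have "(a * \<tau> - lo \<tau>p * \<tau>p) * r \<le> \<theta> * b\<^sup>2 * \<tau>i * r"
      using 2 False by (intro mult_right_mono) auto
    also have "\<dots> \<le> \<theta> * b\<^sup>2 * \<tau>i * (\<kappa>g * \<kappa>d * N)"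
      using r_abs False pars \<tau>i by (intro mult_left_mono) auto
    finally show ?thesis using False by (simp add: algebra_simps)
  next
    case neg: True
    have \<theta>N: "0 \<le> \<theta> * b\<^sup>2 * \<tau>i * (\<kappa>g * \<kappa>d) * N"
      using pars \<tau>i \<kappa>g bounds N by simp
    show ?thesis
    proof (cases "\<tau> < \<tau>p")
      case False
      then have "\<tau> = \<tau>p" using \<tau> by simp
      then have "lo \<tau>p * \<tau>p \<le> a * \<tau>" using a a0 \<tau> by (intro mult_mono) auto
      then have "a * \<tau> * r \<le> lo \<tau>p * \<tau>p * r" using neg by (intro mult_right_mono_neg) auto
      then show ?thesis using \<theta>N False by simp
    next
      case True
      have "b * Amin * \<tau>m \<le> a * \<tau>" using a_ge a0 rng \<tau> by (intro mult_mono) auto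
      then have "lo \<tau>p * \<tau>p - a * \<tau> \<le> b * V" using lo\<tau>i by (simp add: V algebra_simps)
      then have "(lo \<tau>p * \<tau>p - a * \<tau>) * (- r) \<le> b * V * (- r)"
        using neg by (intro mult_right_mono) auto
      also have "\<dots> \<le> b * V * (\<kappa>g * \<kappa>d * N)"
        using r_abs V0 by (intro mult_left_mono) auto
      finally show ?thesis using \<theta>N True neg by (simp add: algebra_simps)
    qed
  qed
  have "1/2 * a * b * Dg \<le> w * Dg"
    using Dg0 a_le pars mult_right_mono[of "a" "b * U" "b * Dg / 2"]
    by (simp add: w_def Dg_def mult_ac)
  then have "a * (Z - (\<tau> - hat) * qt) - w * Dg - a * \<tau> * r
      \<le> \<tau> * (f x - f x') + l1_norm (c x) - l1_norm (c x')"
    using desc unfolding Dt Dg_def[symmetric] r_def[symmetric] by (simp add: algebra_simps)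
  moreover have "a * (Z - (\<tau> - hat) * qt) - w * Dg
      = (a - w) * Z - (a - w) * ((\<tau> - hat) * qt) - w * (\<tau> * (qt - qg))"
    by (simp add: Dg algebra_simps)
  moreover have "1/2 * Amin * b * Z \<le> (a - w) * Z"
    using w a_ge Z unfolding Z_def by (intro mult_right_mono) (auto simp: algebra_simps)
  moreover have "w * (\<tau> * (qt - qg)) \<le> 1/2 * U * b\<^sup>2 * ?gap"
    using mult_left_mono[OF gap w(1)] by (simp add: w_def power2_eq_square mult_ac)
  ultimately show "1/2 * Amin * b * delta_q c x hat (gradf x) H dt \<le>
      \<tau> * (f x - f x') + l1_norm (c x) - l1_norm (c x')
      + 1/2 * U * b\<^sup>2 * ((\<tau>i + \<tau>m) / 2 *
            (- (n \<bullet> dt) - (if dt \<bullet> (H *v dt) > 0 then 0 else 1) * r + (norm n)\<^sup>2 / \<zeta>)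
          + (\<tau>i - \<tau>m) / 2 * (2 * \<kappa>d * \<kappa>g * norm n + \<kappa>d * (norm n)\<^sup>2
              + \<kappa>H * \<kappa>d\<^sup>2 * (\<kappa>g\<^sup>2 / 2 + (norm n)\<^sup>2)))
      + b * (V * (\<kappa>d * \<kappa>g\<^sup>2 * (1 + 1/2 * \<kappa>H * \<kappa>d))) * (if Ttt < ereal \<tau>p then 1 else 0)
      + b * \<xi> * \<tau>p / (\<tau>p * L + \<Gamma>) * \<tau>p * r + \<theta> * b\<^sup>2 * \<tau>i * (\<kappa>g * \<kappa>d) * norm n
      + b * V * (\<kappa>g * \<kappa>d) * (norm n * (if r < 0 \<and> \<tau> < \<tau>p then 1 else 0))"
    using tail step unfolding N_def[symmetric] Z_def[symmetric] lo_def by linarith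
qed

section \<open>Measurability of the iterates\<close>

lemma borel_measurable_vecI:
  fixes f :: "'a \<Rightarrow> 'b::euclidean_space ^ 'n"
  assumes "\<And>i. (\<lambda>x. f x $ i) \<in> borel_measurable M"
  shows "f \<in> borel_measurable M"
proof (subst borel_measurable_euclidean_space, intro ballI)
  fix b :: "'b ^ 'n" assume "b \<in> Basis"
  then obtain i u where "b = axis i u" by (auto simp: Basis_vec_def)
  then show "(\<lambda>x. f x \<bullet> b) \<in> borel_measurable M"
    using assms[of i] by (simp add: inner_axis)
qed

lemma borel_measurable_vec_nth [measurable (raw)]:
  fixes f :: "'a \<Rightarrow> 'b::euclidean_space ^ 'n"
  assumes "f \<in> borel_measurable M"
  shows "(\<lambda>x. f x $ i) \<in> borel_measurable M"
proof -
  have "(\<lambda>v :: 'b ^ 'n. v $ i) \<in> borel_measurable borel"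
    by (intro borel_measurable_continuous_onI continuous_intros)
  then show ?thesis using assms by (rule measurable_compose[rotated])
qed

lemma borel_measurable_matrix_vector_mult [measurable (raw)]:
  fixes A :: "'a \<Rightarrow> real^'n^'m"
  assumes "A \<in> borel_measurable M" "v \<in> borel_measurable M"
  shows "(\<lambda>x. A x *v v x) \<in> borel_measurable M"
proof (rule borel_measurable_vecI)
  have "(\<lambda>x. A x $ i $ j * v x $ j) \<in> borel_measurable M" for i j
    using assms by measurable
  then show "(\<lambda>x. (A x *v v x) $ i) \<in> borel_measurable M" for i
    unfolding matrix_vector_mult_def vec_lambda_beta by (rule borel_measurable_sum)
qed

lemma borel_measurable_det:
  fixes A :: "'a \<Rightarrow> real^'n^'n"
  assumes "\<And>i j. (\<lambda>x. A x $ i $ j) \<in> borel_measurable M"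
  shows "(\<lambda>x. det (A x)) \<in> borel_measurable M"
  unfolding det_def using assms
  by (intro borel_measurable_sum borel_measurable_times borel_measurable_prod) auto

text \<open>One square matrix indexed by a sum type, so that determinants and Cramer's rule apply to
  the block system.\<close>

definition kkt_matrix :: "real^'n^'n \<Rightarrow> real^'n^'m \<Rightarrow> real^('n + 'm)^('n + 'm)" where
  "kkt_matrix H J = (\<chi> i j. case i of
      Inl i \<Rightarrow> (case j of Inl j \<Rightarrow> H $ i $ j | Inr j \<Rightarrow> J $ j $ i)
    | Inr i \<Rightarrow> (case j of Inl j \<Rightarrow> J $ i $ j | Inr j \<Rightarrow> 0))"

definition join_vec :: "real^'n \<Rightarrow> real^'m \<Rightarrow> real^('n + 'm)" where
  "join_vec d y = (\<chi> i. case i of Inl i \<Rightarrow> d $ i | Inr i \<Rightarrow> y $ i)"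

lemma join_vec_nth [simp]: "join_vec d y $ Inl i = d $ i" "join_vec d y $ Inr j = y $ j"
  by (simp_all add: join_vec_def)

lemma join_vec_eq_iff: "join_vec d y = join_vec d' y' \<longleftrightarrow> d = d' \<and> y = y'"
  by (auto simp: vec_eq_iff split_sum_all)

lemma join_vec_surj: "\<exists>d y. v = join_vec d y"
  by (rule exI[of _ "\<chi> i. v $ Inl i"], rule exI[of _ "\<chi> i. v $ Inr i"])
    (auto simp: vec_eq_iff split_sum_all)

lemma sum_UNIV_Plus:
  "(\<Sum>i\<in>(UNIV :: ('n::finite + 'm::finite) set). F i) = (\<Sum>i\<in>UNIV. F (Inl i)) + (\<Sum>i\<in>UNIV. F (Inr i))"
  by (subst UNIV_Plus_UNIV[symmetric], subst sum.Plus) auto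

lemma kkt_matrix_mult:
  "kkt_matrix H J *v join_vec d y = join_vec (H *v d + transpose J *v y) (J *v d)"
  by (auto simp: vec_eq_iff split_sum_all kkt_matrix_def matrix_vector_mult_def sum_UNIV_Plus
      transpose_def simp del: transpose_matrix_vector)

lemma kkt_solution_matrix:
  "kkt_solution H J g c d y \<longleftrightarrow> kkt_matrix H J *v join_vec d y = join_vec (- g) (- c)"
  by (simp add: kkt_solution_def kkt_matrix_mult join_vec_eq_iff)

text \<open>A kernel vector is a step for zero data: the curvature bound kills its \<open>d\<close>
  part, and the full row rank of \<open>J\<close> then kills the multiplier.\<close>

lemma det_kkt_matrix_nonzero:
  fixes H :: "real^'n^'n" and J :: "real^'n^'m"
  assumes pd: "\<And>u. J *v u = 0 \<Longrightarrow> u \<bullet> (H *v u) \<ge> \<zeta> * (norm u)\<^sup>2" and \<zeta>: "\<zeta> > 0"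
    and rank: "\<And>y. transpose J *v y = 0 \<Longrightarrow> y = 0"
  shows "det (kkt_matrix H J) \<noteq> 0"
proof -
  have "v = 0" if "kkt_matrix H J *v v = 0" for v
  proof -
    obtain d y where v: "v = join_vec d y" using join_vec_surj by blast
    have zero: "join_vec 0 0 = 0" by (auto simp: vec_eq_iff split_sum_all)
    then have k: "kkt_solution H J (- 0) 0 d y"
      using that v by (simp add: kkt_solution_matrix)
    then have "d = 0" using kkt_step_bound(2)[OF k pd \<zeta>] by simp
    then have "y = 0" using k rank by (simp add: kkt_solution_def)
    then show ?thesis using \<open>d = 0\<close> v zero by simp
  qed
  then have "inj ((*v) (kkt_matrix H J))"
    by (simp add: linear_injective_0)
  then show ?thesis using det_nz_iff_inj[OF matrix_vector_mul_linear, of "kkt_matrix H J"] by simp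
qed

lemma kkt_solution_exists:
  assumes "det (kkt_matrix H J) \<noteq> 0"
  shows "\<exists>d y. kkt_solution H J g c d y"
proof -
  define v where "v = (\<chi> k. det (\<chi> i j. if j = k then join_vec (- g) (- c) $ i else kkt_matrix H J $ i $ j)
    / det (kkt_matrix H J))"
  have v: "kkt_matrix H J *v v = join_vec (- g) (- c)"
    unfolding cramer[OF assms] v_def ..
  obtain d y where "v = join_vec d y" using join_vec_surj by blast
  with v show ?thesis unfolding kkt_solution_matrix by blast
qed

text \<open>The step is known only through a pointwise relation. By Cramer's rule each of its
  components is a quotient of determinants in the entries of measurable data.\<close>

lemma borel_measurable_kkt_solution:
  fixes H :: "'a \<Rightarrow> real^'n^'n" and J :: "'a \<Rightarrow> real^'n^'m"
  assumes [measurable]: "H \<in> borel_measurable M" "J \<in> borel_measurable M"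
      "g \<in> borel_measurable M" "c \<in> borel_measurable M"
    and det: "\<And>x. x \<in> space M \<Longrightarrow> det (kkt_matrix (H x) (J x)) \<noteq> 0"
    and sol: "\<And>x. x \<in> space M \<Longrightarrow> kkt_solution (H x) (J x) (g x) (c x) (d x) (y x)"
  shows "d \<in> borel_measurable M"
proof (rule borel_measurable_vecI)
  fix i
  define A where "A x = kkt_matrix (H x) (J x)" for x
  define b where "b x = join_vec (- g x) (- c x)" for x
  define B where "B x = (\<chi> k l. if l = Inl i then b x $ k else A x $ k $ l)" for x
  have A [measurable]: "(\<lambda>x. A x $ k $ l) \<in> borel_measurable M" for k l
    by (cases k; cases l) (simp_all add: A_def kkt_matrix_def)
  have b [measurable]: "(\<lambda>x. b x $ k) \<in> borel_measurable M" for k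
    by (cases k) (simp_all add: b_def)
  have "(\<lambda>x. B x $ k $ l) \<in> borel_measurable M" for k l
    by (cases "l = Inl i") (simp_all add: B_def)
  then have "(\<lambda>x. det (B x) / det (A x)) \<in> borel_measurable M"
    using borel_measurable_det[of B M] borel_measurable_det[of A M] A
    by (intro borel_measurable_divide) auto
  moreover have "d x $ i = det (B x) / det (A x)" if "x \<in> space M" for x
  proof -
    have "A x *v join_vec (d x) (y x) = b x"
      using sol[OF that] by (simp add: kkt_solution_matrix A_def b_def)
    then have "join_vec (d x) (y x) = (\<chi> k. det (\<chi> i j. if j = k then b x $ i else A x $ i $ j) / det (A x))"
      using cramer det[OF that] unfolding A_def by blast
    from arg_cong[OF this, of "\<lambda>v. v $ Inl i"] show ?thesis
      by (simp add: B_def)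
  qed
  ultimately show "(\<lambda>x. d x $ i) \<in> borel_measurable M"
    by (simp cong: measurable_cong)
qed

lemma singular_values_full_rank:
  assumes "s\<^sub>0 > 0" "\<And>s. singular_value A s \<Longrightarrow> s\<^sub>0 \<le> s" "transpose A *v y = 0"
  shows "y = 0"
proof (rule ccontr)
  assume "y \<noteq> 0"
  then have "singular_value A 0"
    unfolding singular_value_def using assms(3)
    by (intro conjI exI[of _ y]) (simp_all add: matrix_vector_mul_assoc[symmetric] del: transpose_matrix_vector)
  then show False using assms by force
qed

context
  fixes M :: "'a measure" and c :: "real^'n \<Rightarrow> real^'m" and X g d :: "'a \<Rightarrow> real^'n"
    and H :: "'a \<Rightarrow> real^'n^'n" and \<tau> :: "'a \<Rightarrow> real"
  assumes meas [measurable]: "(\<lambda>\<omega>. c (X \<omega>)) \<in> borel_measurable M" "g \<in> borel_measurable M"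
    "d \<in> borel_measurable M" "H \<in> borel_measurable M" "\<tau> \<in> borel_measurable M"
begin

lemma borel_measurable_l1_norm: "(\<lambda>\<omega>. l1_norm (c (X \<omega>))) \<in> borel_measurable M"
  unfolding l1_norm_def by measurable

lemma borel_measurable_delta_q: "(\<lambda>\<omega>. delta_q c (X \<omega>) (\<tau> \<omega>) (g \<omega>) (H \<omega>) (d \<omega>)) \<in> borel_measurable M"
  unfolding delta_q_def l1_norm_def by measurable

lemma borel_measurable_tau_trial: "(\<lambda>\<omega>. tau_trial \<sigma> c (X \<omega>) (g \<omega>) (H \<omega>) (d \<omega>)) \<in> borel_measurable M"
  unfolding tau_trial_def l1_norm_def by measurable

lemma borel_measurable_xi_trial: "(\<lambda>\<omega>. xi_trial c (X \<omega>) (\<tau> \<omega>) (g \<omega>) (H \<omega>) (d \<omega>)) \<in> borel_measurable M"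
  unfolding xi_trial_def using borel_measurable_delta_q by measurable

lemma borel_measurable_step_size:
  assumes [measurable]: "\<xi> \<in> borel_measurable M" and "\<theta> \<ge> 0"
  shows "(\<lambda>\<omega>. step_size c \<theta> L \<Gamma> b (X \<omega>) (\<tau> \<omega>) (\<xi> \<omega>) (g \<omega>) (H \<omega>) (d \<omega>)) \<in> borel_measurable M"
proof -
  note [measurable] = borel_measurable_delta_q borel_measurable_l1_norm
  \<comment> \<open>This makes the projection interval nonempty, so that
    \<open>closest_point\<close> can be rewritten with \<open>max\<close> and \<open>min\<close>,
    which preserve measurability.\<close>
  have "0 \<le> \<theta> * b\<^sup>2" using assms by simp
  then show ?thesis
    unfolding step_size_def Let_def by (subst closest_point_interval, simp)+ measurable
qed

end

lemma borel_measurable_tau_update: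
  assumes [measurable]: "t \<in> borel_measurable M" "\<tau> \<in> borel_measurable M"
  shows "(\<lambda>\<omega>. tau_update \<epsilon> (t \<omega>) (\<tau> \<omega>)) \<in> borel_measurable M"
  unfolding tau_update_def by measurable

lemma borel_measurable_xi_update:
  assumes [measurable]: "t \<in> borel_measurable M" "\<tau> \<in> borel_measurable M"
  shows "(\<lambda>\<omega>. xi_update \<epsilon> (t \<omega>) (\<tau> \<omega>)) \<in> borel_measurable M"
  unfolding xi_update_def by measurable

section \<open>The sigma-algebras generated by the past gradients\<close>

lemma space_past [simp]: "space (past P G k) = space P"
  by (simp add: past_def)

lemma measurable_past:
  assumes "i < k"
  shows "G i \<in> borel_measurable (past P G k)"
proof -
  have "(\<lambda>\<omega>. \<lambda>i\<in>{..<k}. G i \<omega>) \<in> measurable (past P G k) (Pi\<^sub>M {..<k} (\<lambda>_. borel))"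
    unfolding past_def by (rule measurable_vimage_algebra1) (auto simp: space_PiM)
  from measurable_compose[OF this measurable_component_singleton[of i]] assms
  show ?thesis by simp
qed

lemma sets_past_subset:
  assumes "space M = space P" "\<And>i. i < k \<Longrightarrow> G i \<in> borel_measurable M"
  shows "sets (past P G k) \<subseteq> sets M"
proof -
  have "(\<lambda>\<omega>. \<omega>) \<in> measurable M (past P G k)"
    unfolding past_def using assms by (intro measurable_vimage_algebra2 measurable_restrict) auto
  from measurable_sets[OF this] show ?thesis
    using assms(1) sets.sets_into_space[of _ "past P G k"] by (fastforce simp: Int_absorb2)
qed

lemma past_mono: "i \<le> j \<Longrightarrow> sets (past P G i) \<subseteq> sets (past P G j)"
  by (rule sets_past_subset) (auto intro: measurable_past)

lemma measurable_past_mono: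
  assumes "f \<in> measurable (past P G i) N" "i \<le> j"
  shows "f \<in> measurable (past P G j) N"
  using assms measurable_mono[of N N "past P G i" "past P G j"] past_mono[of i j P G] by auto

text \<open>The problem data are continuous only on the set that contains the iterates, so the
  composition is taken through the restricted Borel space.\<close>

lemma borel_measurable_compose_continuous_on:
  assumes "continuous_on S h" "X \<in> borel_measurable M" "\<And>\<omega>. \<omega> \<in> space M \<Longrightarrow> X \<omega> \<in> S"
  shows "(\<lambda>\<omega>. h (X \<omega>)) \<in> borel_measurable M"
proof (rule measurable_compose[of X M "restrict_space borel S"])
  show "X \<in> measurable M (restrict_space borel S)"
    using assms by (intro measurable_restrict_space2) auto
  show "h \<in> borel_measurable (restrict_space borel S)"
    by (rule borel_measurable_continuous_on_restrict[OF assms(1)])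
qed

section \<open>Runs with a constant step parameter, before an output index is drawn\<close>

locale stochastic_sqp = prob_space P for P :: "'a measure" +
  fixes f :: "real^'n \<Rightarrow> real" and gradf :: "real^'n \<Rightarrow> real^'n"
    and c :: "real^'n \<Rightarrow> real^'m" and J :: "real^'n \<Rightarrow> real^'n^'m"
    and \<X> :: "(real^'n) set" and f\<^sub>l\<^sub>o\<^sub>w L \<Gamma> \<kappa>\<^sub>g \<kappa>\<^sub>H \<zeta> \<kappa>\<^sub>d :: real and \<gamma>\<^sub>c :: "'m \<Rightarrow> real"
    and x\<^sub>0 :: "real^'n" and k\<^sub>m\<^sub>a\<^sub>x :: nat and \<tau>\<^sub>i\<^sub>n\<^sub>i\<^sub>t \<epsilon>\<^sub>\<tau> \<epsilon>\<^sub>\<xi> \<sigma> \<xi>\<^sub>i\<^sub>n\<^sub>i\<^sub>t \<theta> \<beta> :: real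
    and G X D Dtrue :: "nat \<Rightarrow> 'a \<Rightarrow> real^'n" and H :: "nat \<Rightarrow> 'a \<Rightarrow> real^'n^'n"
    and Y Ytrue :: "nat \<Rightarrow> 'a \<Rightarrow> real^'m" and T \<Xi> \<A> :: "nat \<Rightarrow> 'a \<Rightarrow> real"
    and Ttt :: "nat \<Rightarrow> 'a \<Rightarrow> ereal" and That :: "nat \<Rightarrow> 'a \<Rightarrow> real"
    and s\<^sub>m\<^sub>a\<^sub>x :: nat and \<tau>\<^sub>m\<^sub>i\<^sub>n \<xi>\<^sub>m\<^sub>i\<^sub>n :: real and E :: "'a set" and M M\<^sub>\<tau> p\<^sub>\<tau> :: real
  assumes inputs: "\<tau>\<^sub>i\<^sub>n\<^sub>i\<^sub>t > 0" "\<epsilon>\<^sub>\<tau> \<in> {0<..<1}" "\<epsilon>\<^sub>\<xi> \<in> {0<..<1}" "\<sigma> \<in> {0<..<1}" "\<xi>\<^sub>i\<^sub>n\<^sub>i\<^sub>t > 0"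
      "\<beta> \<in> {0<..1}" "\<theta> \<ge> 0" "L > 0" "\<And>i. \<gamma>\<^sub>c i > 0" "\<Gamma> \<ge> (\<Sum>i\<in>UNIV. \<gamma>\<^sub>c i)"
    and G_rv: "\<And>k. k \<le> k\<^sub>m\<^sub>a\<^sub>x \<Longrightarrow> G k \<in> borel_measurable P"
    and start: "\<And>\<omega>. \<omega> \<in> space P \<Longrightarrow> X 0 \<omega> = x\<^sub>0"
    and run: "\<And>\<omega> k. \<omega> \<in> space P \<Longrightarrow> k \<le> k\<^sub>m\<^sub>a\<^sub>x \<Longrightarrow>
        sqp_iteration c J \<epsilon>\<^sub>\<tau> \<epsilon>\<^sub>\<xi> \<sigma> \<theta> L \<Gamma> \<beta>
          (H k \<omega>) (G k \<omega>) (X k \<omega>) (prev \<tau>\<^sub>i\<^sub>n\<^sub>i\<^sub>t T k \<omega>) (prev \<xi>\<^sub>i\<^sub>n\<^sub>i\<^sub>t \<Xi> k \<omega>)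
          (D k \<omega>) (Y k \<omega>) (T k \<omega>) (\<Xi> k \<omega>) (\<A> k \<omega>) (X (Suc k) \<omega>)"
    and true_step: "\<And>\<omega> k. \<omega> \<in> space P \<Longrightarrow> k \<le> k\<^sub>m\<^sub>a\<^sub>x \<Longrightarrow>
        kkt_solution (H k \<omega>) (J (X k \<omega>)) (gradf (X k \<omega>)) (c (X k \<omega>)) (Dtrue k \<omega>) (Ytrue k \<omega>)"
    and Ttt: "\<And>k \<omega>. Ttt k \<omega> = tau_trial \<sigma> c (X k \<omega>) (gradf (X k \<omega>)) (H k \<omega>) (Dtrue k \<omega>)"
    and That: "\<And>k \<omega>. That k \<omega> = real_of_ereal (min (ereal (T k \<omega>)) (Ttt k \<omega>))"
    and lower_end: "\<And>\<omega> k. \<omega> \<in> E \<Longrightarrow> k \<le> k\<^sub>m\<^sub>a\<^sub>x \<Longrightarrow>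
        \<beta> * \<Xi> k \<omega> * T k \<omega> / (T k \<omega> * L + \<Gamma>) \<le> 1"
    and A1: "convex \<X>" "\<And>\<omega> k. \<omega> \<in> space P \<Longrightarrow> k \<le> Suc k\<^sub>m\<^sub>a\<^sub>x \<Longrightarrow> X k \<omega> \<in> \<X>"
      "\<And>x. x \<in> \<X> \<Longrightarrow> GDERIV f x :> gradf x" "\<And>x. x \<in> \<X> \<Longrightarrow> f\<^sub>l\<^sub>o\<^sub>w \<le> f x"
      "L-lipschitz_on \<X> gradf"
      "\<And>x. x \<in> \<X> \<Longrightarrow> (c has_derivative (\<lambda>h. J x *v h)) (at x)"
      "bounded (c ` \<X>)" "\<And>i. (\<gamma>\<^sub>c i)-lipschitz_on \<X> (\<lambda>x. J x $ i)"
      "\<exists>s\<^sub>0>0. \<forall>x\<in>\<X>. \<forall>s. singular_value (J x) s \<longrightarrow> s\<^sub>0 \<le> s"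
    and kappa_g: "\<kappa>\<^sub>g > 0" "\<And>\<omega> k. \<omega> \<in> space P \<Longrightarrow> k \<le> k\<^sub>m\<^sub>a\<^sub>x \<Longrightarrow> norm (gradf (X k \<omega>)) \<le> \<kappa>\<^sub>g"
    and A2: "\<And>k. k \<le> k\<^sub>m\<^sub>a\<^sub>x \<Longrightarrow> H k \<in> borel_measurable (past P G k)"
      "\<And>\<omega> k. \<omega> \<in> space P \<Longrightarrow> k \<le> k\<^sub>m\<^sub>a\<^sub>x \<Longrightarrow> transpose (H k \<omega>) = H k \<omega>"
      "\<And>\<omega> k. \<omega> \<in> space P \<Longrightarrow> k \<le> k\<^sub>m\<^sub>a\<^sub>x \<Longrightarrow> onorm ((*v) (H k \<omega>)) \<le> \<kappa>\<^sub>H"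
      "\<zeta> > 0"
      "\<And>\<omega> k u. \<omega> \<in> space P \<Longrightarrow> k \<le> k\<^sub>m\<^sub>a\<^sub>x \<Longrightarrow> J (X k \<omega>) *v u = 0 \<Longrightarrow>
        u \<bullet> (H k \<omega> *v u) \<ge> \<zeta> * (norm u)\<^sup>2"
    and E_params: "\<tau>\<^sub>m\<^sub>i\<^sub>n > 0" "\<xi>\<^sub>m\<^sub>i\<^sub>n > 0"
    and E: "E = {\<omega>\<in>space P.
        (\<forall>k\<le>k\<^sub>m\<^sub>a\<^sub>x. T k \<omega> \<ge> \<tau>\<^sub>m\<^sub>i\<^sub>n \<and> Ttt k \<omega> \<ge> ereal \<tau>\<^sub>m\<^sub>i\<^sub>n \<and> \<Xi> k \<omega> = \<xi>\<^sub>m\<^sub>i\<^sub>n) \<and>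
        card {k. k \<le> k\<^sub>m\<^sub>a\<^sub>x \<and> T k \<omega> < prev \<tau>\<^sub>i\<^sub>n\<^sub>i\<^sub>t T k \<omega>} \<le> s\<^sub>m\<^sub>a\<^sub>x}"
    and E_pos: "measure P E > 0"
    and A3: "M > 0" "M\<^sub>\<tau> > 0"
      "\<And>k i. k \<le> k\<^sub>m\<^sub>a\<^sub>x \<Longrightarrow> AE \<omega> in uniform_measure P E.
        cexp_past P E G k (\<lambda>\<omega>. G k \<omega> $ i) \<omega> = gradf (X k \<omega>) $ i"
      "\<And>k. k \<le> k\<^sub>m\<^sub>a\<^sub>x \<Longrightarrow> AE \<omega> in uniform_measure P E.
        nn_cond_exp (uniform_measure P E) (past P G k)
          (\<lambda>\<omega>. ennreal ((norm (G k \<omega> - gradf (X k \<omega>)))\<^sup>2)) \<omega> \<le> ennreal M"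
      "\<And>k B. k \<le> k\<^sub>m\<^sub>a\<^sub>x \<Longrightarrow>
        B = {\<omega>\<in>space P. gradf (X k \<omega>) \<bullet> (D k \<omega> - Dtrue k \<omega>) < 0 \<and> T k \<omega> < prev \<tau>\<^sub>i\<^sub>n\<^sub>i\<^sub>t T k \<omega>} \<Longrightarrow>
        AE \<omega> in uniform_measure P E.
          cprob_past P E G k B \<omega> = 0 \<or>
          cexp_past_given P E G k B (\<lambda>\<omega>. norm (G k \<omega> - gradf (X k \<omega>))) \<omega> \<le> M\<^sub>\<tau>"
    and A4: "p\<^sub>\<tau> \<in> {0<..1}"
      "\<And>k. k \<le> k\<^sub>m\<^sub>a\<^sub>x \<Longrightarrow> AE \<omega> in uniform_measure P E.
        cprob_past P E G k {\<omega>\<in>space P.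
          G k \<omega> \<bullet> D k \<omega> + max (D k \<omega> \<bullet> (H k \<omega> *v D k \<omega>)) 0
          \<ge> gradf (X k \<omega>) \<bullet> Dtrue k \<omega> + max (Dtrue k \<omega> \<bullet> (H k \<omega> *v Dtrue k \<omega>)) 0} \<omega> \<ge> p\<^sub>\<tau>"
    and kappa_d: "\<kappa>\<^sub>d > 0"
      "\<And>\<omega> k. \<omega> \<in> space P \<Longrightarrow> k \<le> k\<^sub>m\<^sub>a\<^sub>x \<Longrightarrow> norm (Dtrue k \<omega>) \<le> \<kappa>\<^sub>d * norm (gradf (X k \<omega>))"
      "\<And>\<omega> k. \<omega> \<in> space P \<Longrightarrow> k \<le> k\<^sub>m\<^sub>a\<^sub>x \<Longrightarrow>
        norm (D k \<omega> - Dtrue k \<omega>) \<le> \<kappa>\<^sub>d * norm (G k \<omega> - gradf (X k \<omega>))"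
begin

lemma continuous_on_data:
  "continuous_on \<X> gradf" "continuous_on \<X> c" "continuous_on \<X> (\<lambda>x. J x $ i)"
    apply (rule lipschitz_on_continuous_on[OF A1(5)])
   apply (rule has_derivative_continuous_on[OF has_derivative_at_withinI[OF A1(6)]], assumption)
  apply (rule lipschitz_on_continuous_on[OF A1(8)])
  done

lemma measurable_data:
  assumes "k \<le> Suc k\<^sub>m\<^sub>a\<^sub>x" "X k \<in> borel_measurable S" "space S = space P"
  shows "(\<lambda>\<omega>. gradf (X k \<omega>)) \<in> borel_measurable S" "(\<lambda>\<omega>. c (X k \<omega>)) \<in> borel_measurable S"
    "(\<lambda>\<omega>. J (X k \<omega>)) \<in> borel_measurable S"
proof -
  have *: "(\<lambda>\<omega>. h (X k \<omega>)) \<in> borel_measurable S" if "continuous_on \<X> h" for h :: "_ \<Rightarrow> 'b::real_normed_vector"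
    using that assms A1(2) by (intro borel_measurable_compose_continuous_on[OF that]) auto
  show "(\<lambda>\<omega>. gradf (X k \<omega>)) \<in> borel_measurable S" "(\<lambda>\<omega>. c (X k \<omega>)) \<in> borel_measurable S"
    by (intro * continuous_on_data)+
  show "(\<lambda>\<omega>. J (X k \<omega>)) \<in> borel_measurable S"
    by (intro borel_measurable_vecI[of "\<lambda>\<omega>. J (X k \<omega>)"] * continuous_on_data)
qed

lemma det_kkt_nonzero:
  assumes "\<omega> \<in> space P" "k \<le> k\<^sub>m\<^sub>a\<^sub>x"
  shows "det (kkt_matrix (H k \<omega>) (J (X k \<omega>))) \<noteq> 0"
proof (rule det_kkt_matrix_nonzero[OF A2(5)[OF assms] A2(4)])
  obtain s\<^sub>0 where "s\<^sub>0 > 0" "\<And>s. singular_value (J (X k \<omega>)) s \<Longrightarrow> s\<^sub>0 \<le> s"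
    using A1(9) A1(2)[of \<omega> k] assms by auto
  then show "y = 0" if "transpose (J (X k \<omega>)) *v y = 0" for y
    using singular_values_full_rank that by blast
qed

lemma measurable_step:
  assumes k: "k \<le> k\<^sub>m\<^sub>a\<^sub>x"
    and X: "X k \<in> borel_measurable (past P G k)"
    and T: "prev \<tau>\<^sub>i\<^sub>n\<^sub>i\<^sub>t T k \<in> borel_measurable (past P G k)"
    and \<Xi>: "prev \<xi>\<^sub>i\<^sub>n\<^sub>i\<^sub>t \<Xi> k \<in> borel_measurable (past P G k)"
  shows "D k \<in> borel_measurable (past P G (Suc k))" "T k \<in> borel_measurable (past P G (Suc k))"
    "\<Xi> k \<in> borel_measurable (past P G (Suc k))" "X (Suc k) \<in> borel_measurable (past P G (Suc k))"
proof -
  let ?F = "past P G (Suc k)"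
  have lift: "h \<in> borel_measurable ?F" if "h \<in> borel_measurable (past P G k)"
    for h :: "_ \<Rightarrow> 'b::topological_space"
    using that by (rule measurable_past_mono) simp
  note X' [measurable] = lift[OF X]
  note [measurable] = lift[OF T] lift[OF \<Xi>] lift[OF A2(1)[OF k]] measurable_past[of k "Suc k" G P, simplified]
  have k': "k \<le> Suc k\<^sub>m\<^sub>a\<^sub>x" using k by simp
  note [measurable] = measurable_data[OF k' X' space_past]
  show D [measurable]: "D k \<in> borel_measurable ?F"
    by (rule borel_measurable_kkt_solution[where H = "H k" and J = "\<lambda>\<omega>. J (X k \<omega>)" and g = "G k"
          and c = "\<lambda>\<omega>. c (X k \<omega>)" and y = "Y k"])
      (use det_kkt_nonzero[OF _ k] run[OF _ k] in \<open>auto simp: sqp_iteration_def\<close>)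
  have "(\<lambda>\<omega>. if D k \<omega> = 0 then prev \<tau>\<^sub>i\<^sub>n\<^sub>i\<^sub>t T k \<omega>
      else tau_update \<epsilon>\<^sub>\<tau> (tau_trial \<sigma> c (X k \<omega>) (G k \<omega>) (H k \<omega>) (D k \<omega>)) (prev \<tau>\<^sub>i\<^sub>n\<^sub>i\<^sub>t T k \<omega>))
      \<in> borel_measurable ?F"
    by (intro measurable_If borel_measurable_tau_update borel_measurable_tau_trial) measurable
  then show T' [measurable]: "T k \<in> borel_measurable ?F"
    by (rule measurable_cong[THEN iffD1, rotated]) (use run[OF _ k] in \<open>auto simp: sqp_iteration_def\<close>)
  have "(\<lambda>\<omega>. if D k \<omega> = 0 then prev \<xi>\<^sub>i\<^sub>n\<^sub>i\<^sub>t \<Xi> k \<omega>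
      else xi_update \<epsilon>\<^sub>\<xi> (xi_trial c (X k \<omega>) (T k \<omega>) (G k \<omega>) (H k \<omega>) (D k \<omega>)) (prev \<xi>\<^sub>i\<^sub>n\<^sub>i\<^sub>t \<Xi> k \<omega>))
      \<in> borel_measurable ?F"
    by (intro measurable_If borel_measurable_xi_update borel_measurable_xi_trial) measurable
  then show [measurable]: "\<Xi> k \<in> borel_measurable ?F"
    by (rule measurable_cong[THEN iffD1, rotated]) (use run[OF _ k] in \<open>auto simp: sqp_iteration_def\<close>)
  have [measurable]: "(\<lambda>\<omega>. step_size c \<theta> L \<Gamma> \<beta> (X k \<omega>) (T k \<omega>) (\<Xi> k \<omega>) (G k \<omega>) (H k \<omega>) (D k \<omega>))
      \<in> borel_measurable ?F"
    using inputs(7) by (intro borel_measurable_step_size) measurable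
  have "(\<lambda>\<omega>. X k \<omega> + (if D k \<omega> = 0 then 1
      else step_size c \<theta> L \<Gamma> \<beta> (X k \<omega>) (T k \<omega>) (\<Xi> k \<omega>) (G k \<omega>) (H k \<omega>) (D k \<omega>)) *\<^sub>R D k \<omega>)
      \<in> borel_measurable ?F"
    by measurable
  then show "X (Suc k) \<in> borel_measurable ?F"
    by (rule measurable_cong[THEN iffD1, rotated]) (use run[OF _ k] in \<open>auto simp: sqp_iteration_def\<close>)
qed

text \<open>The state entering iteration \<open>k\<close> is a function of the gradients before
  \<open>k\<close>; the outputs \<open>D\<close>, \<open>T\<close>, \<open>\<Xi>\<close> of that
  iteration involve \<open>G k\<close> and belong to index \<open>Suc k\<close>. The induction goes
  one index past the last iteration to include the final iterate.\<close>

lemma measurable_state: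
  assumes "k \<le> Suc k\<^sub>m\<^sub>a\<^sub>x"
  shows "X k \<in> borel_measurable (past P G k) \<and> prev \<tau>\<^sub>i\<^sub>n\<^sub>i\<^sub>t T k \<in> borel_measurable (past P G k)
    \<and> prev \<xi>\<^sub>i\<^sub>n\<^sub>i\<^sub>t \<Xi> k \<in> borel_measurable (past P G k)"
  using assms
proof (induction k)
  case 0
  have "X 0 \<in> borel_measurable (past P G 0)"
    using start by (subst measurable_cong[of _ _ "\<lambda>_. x\<^sub>0"]) auto
  then show ?case by (simp add: prev_def)
next
  case (Suc k)
  have "prev a V (Suc k) = V k" for a and V :: "nat \<Rightarrow> 'a \<Rightarrow> real"
    by (auto simp: prev_def)
  with Suc measurable_step[of k] show ?case by simp
qed

lemma measurable_past_quantities: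
  assumes "k \<le> k\<^sub>m\<^sub>a\<^sub>x"
  shows "X k \<in> borel_measurable (past P G k)"
    "prev \<tau>\<^sub>i\<^sub>n\<^sub>i\<^sub>t T k \<in> borel_measurable (past P G k)"
    "(\<lambda>\<omega>. gradf (X k \<omega>)) \<in> borel_measurable (past P G k)"
    "(\<lambda>\<omega>. c (X k \<omega>)) \<in> borel_measurable (past P G k)"
    "(\<lambda>\<omega>. J (X k \<omega>)) \<in> borel_measurable (past P G k)"
    "Dtrue k \<in> borel_measurable (past P G k)"
    "Ttt k \<in> borel_measurable (past P G k)"
proof -
  let ?F = "past P G k"
  show X: "X k \<in> borel_measurable ?F" "prev \<tau>\<^sub>i\<^sub>n\<^sub>i\<^sub>t T k \<in> borel_measurable (past P G k)"
    using measurable_state[of k] assms by auto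
  have k: "k \<le> Suc k\<^sub>m\<^sub>a\<^sub>x" using assms by simp
  show data: "(\<lambda>\<omega>. gradf (X k \<omega>)) \<in> borel_measurable ?F"
    "(\<lambda>\<omega>. c (X k \<omega>)) \<in> borel_measurable ?F" "(\<lambda>\<omega>. J (X k \<omega>)) \<in> borel_measurable ?F"
    by (rule measurable_data[OF k X(1) space_past])+
  show Dtrue: "Dtrue k \<in> borel_measurable ?F"
    by (rule borel_measurable_kkt_solution[OF A2(1)[OF assms] data(3,1,2), where y = "Ytrue k"])
      (use det_kkt_nonzero[OF _ assms] true_step[OF _ assms] in auto)
  have "Ttt k = (\<lambda>\<omega>. tau_trial \<sigma> c (X k \<omega>) (gradf (X k \<omega>)) (H k \<omega>) (Dtrue k \<omega>))"
    using Ttt by auto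
  then show "Ttt k \<in> borel_measurable ?F"
    using borel_measurable_tau_trial[OF data(2,1) Dtrue A2(1)[OF assms]] by simp
qed

lemma measurable_next_quantities:
  assumes "k \<le> k\<^sub>m\<^sub>a\<^sub>x"
  shows "D k \<in> borel_measurable (past P G (Suc k))" "T k \<in> borel_measurable (past P G (Suc k))"
    "\<Xi> k \<in> borel_measurable (past P G (Suc k))"
  using measurable_step[OF assms] measurable_state[of k] assms by auto

lemma measurable_past_P:
  assumes "h \<in> measurable (past P G k) N" "k \<le> Suc k\<^sub>m\<^sub>a\<^sub>x"
  shows "h \<in> measurable P N"
proof -
  have "sets (past P G k) \<subseteq> sets P"
    using G_rv assms(2) by (intro sets_past_subset) auto
  then show ?thesis using assms(1) measurable_mono[of N N "past P G k" P] by auto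
qed

end

section \<open>Conditional means given the event\<close>

text \<open>The alternative in (A3) is resolved by splitting along the zero set of the conditional
  probability of \<open>B\<close>. On that set \<open>B\<close> is null; off it the quotient can be
  multiplied out to \<open>q \<le> C * p\<close> and integrated.\<close>

lemma (in finite_measure_subalgebra) integral_indicator_le_conditional:
  assumes B [measurable]: "B \<in> sets M" and g: "integrable M g" "\<And>x. 0 \<le> g x" and C: "0 \<le> C"
    and cond: "AE x in M. real_cond_exp M F (indicator B) x = 0 \<or>
      real_cond_exp M F (\<lambda>x. g x * indicator B x) x / real_cond_exp M F (indicator B) x \<le> C"
  shows "(\<integral>x. g x * indicator B x \<partial>M) \<le> C * measure M B"
proof -
  define p q where "p = real_cond_exp M F (indicator B)"
    and "q = real_cond_exp M F (\<lambda>x. g x * indicator B x)"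
  define S where "S = {x \<in> space F. p x = 0}"
  have p [measurable]: "p \<in> borel_measurable F" by (simp add: p_def)
  have S [measurable]: "S \<in> sets F" unfolding S_def by measurable
  have SM [measurable]: "S \<in> sets M" using S subalg by (auto simp: subalgebra_def)
  have space: "space F = space M" using subalg by (simp add: subalgebra_def)
  have gB: "integrable M (\<lambda>x. g x * indicator B x)"
    using integrable_mult_indicator[OF B g(1)] by (simp add: mult.commute)
  have iB: "integrable M (indicator B :: _ \<Rightarrow> real)" by (simp add: emeasure_eq_measure)
  have gm [measurable]: "g \<in> borel_measurable M" using g by auto
  have ind: "integrable M (\<lambda>x. indicator A x * h x)" if "A \<in> sets M" "integrable M h" for A and h :: "_ \<Rightarrow> real"
    using integrable_mult_indicator[OF that] by simp
  have "AE x in M. p x \<ge> 0" unfolding p_def by (rule real_cond_exp_pos) auto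
  have ip: "integrable M p" and iq: "integrable M q"
    unfolding p_def q_def using iB gB by (auto intro: real_cond_exp_int)
  \<comment> \<open>\<open>S\<close> belongs to the sub-algebra, so its intersection with
    \<open>B\<close> has measure equal to the integral of \<open>p\<close> over \<open>S\<close>,
    which is 0 by the choice of \<open>S\<close>.\<close>
  have "(\<integral>x. indicator S x * indicator B x \<partial>M) = (\<integral>x. indicator S x * p x \<partial>M)"
    unfolding p_def using ind[OF SM iB] by (intro real_cond_exp_intg(2)[symmetric]) auto
  also have "\<dots> = 0"
    by (rule integral_eq_zero_AE) (auto simp: S_def indicator_def)
  finally have "AE x in M. indicator S x * indicator B x = (0::real)"
    using ind[OF SM iB] by (subst (asm) integral_nonneg_eq_0_iff_AE) auto
  then have "AE x in M. indicator S x * (g x * indicator B x) = 0"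
    by eventually_elim (auto simp: indicator_def split: if_splits)
  then have zero: "(\<integral>x. indicator S x * (g x * indicator B x) \<partial>M) = 0"
    by (rule integral_eq_zero_AE)
  have SC [measurable]: "space M - S \<in> sets F" and SCM: "space M - S \<in> sets M"
    using sets.compl_sets[OF S] sets.compl_sets[OF SM] by (auto simp: space)
  have "(\<integral>x. g x * indicator B x \<partial>M)
      = (\<integral>x. indicator S x * (g x * indicator B x) + indicator (space M - S) x * (g x * indicator B x) \<partial>M)"
    by (intro Bochner_Integration.integral_cong) (auto simp: indicator_def)
  also have "\<dots> = (\<integral>x. indicator (space M - S) x * (g x * indicator B x) \<partial>M)"
    using zero ind[OF SM gB] ind[OF SCM gB] by (subst Bochner_Integration.integral_add) auto
  also have "\<dots> = (\<integral>x. indicator (space M - S) x * q x \<partial>M)"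
    unfolding q_def using ind[OF SCM gB] by (intro real_cond_exp_intg(2)[symmetric]) auto
  also have "\<dots> \<le> (\<integral>x. C * p x \<partial>M)"
  proof (rule integral_mono_AE)
    show "AE x in M. indicator (space M - S) x * q x \<le> C * p x"
      using cond \<open>AE x in M. p x \<ge> 0\<close> AE_space
      unfolding p_def[symmetric] q_def[symmetric]
    proof eventually_elim
      case (elim x)
      then show ?case
        using C by (auto simp: indicator_def S_def space field_simps)
    qed
  qed (use ip iq ind[OF SCM iq] in auto)
  also have "\<dots> = C * measure M B"
    using real_cond_exp_int(2)[OF iB] by (simp add: p_def)
  finally show ?thesis .
qed

section \<open>Noise, drift and decreases of the merit parameter, conditioned on the event\<close>

context stochastic_sqp
begin

abbreviation Q :: "'a measure" where "Q \<equiv> uniform_measure P E"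

definition noise :: "nat \<Rightarrow> 'a \<Rightarrow> real^'n" where
  "noise k \<omega> = G k \<omega> - gradf (X k \<omega>)"

definition drift :: "nat \<Rightarrow> 'a \<Rightarrow> real" where
  "drift k \<omega> = gradf (X k \<omega>) \<bullet> (D k \<omega> - Dtrue k \<omega>)"

definition decrease :: "nat \<Rightarrow> 'a set" where
  "decrease k = {\<omega>\<in>space P. T k \<omega> < prev \<tau>\<^sub>i\<^sub>n\<^sub>i\<^sub>t T k \<omega>}"

definition bad_decrease :: "nat \<Rightarrow> 'a set" where
  "bad_decrease k = {\<omega>\<in>space P. drift k \<omega> < 0 \<and> T k \<omega> < prev \<tau>\<^sub>i\<^sub>n\<^sub>i\<^sub>t T k \<omega>}"

definition overestimate :: "nat \<Rightarrow> 'a set" where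
  "overestimate k = {\<omega>\<in>space P. Ttt k \<omega> < ereal (prev \<tau>\<^sub>i\<^sub>n\<^sub>i\<^sub>t T k \<omega>)}"

definition q_red :: "nat \<Rightarrow> 'a \<Rightarrow> real" where
  "q_red k \<omega> = delta_q c (X k \<omega>) (That k \<omega>) (gradf (X k \<omega>)) (H k \<omega>) (Dtrue k \<omega>)"

lemma space_nonempty: "\<exists>\<omega>. \<omega> \<in> space P"
  using not_empty by auto

lemma Gamma_pos: "\<Gamma> > 0"
proof -
  have "0 < (\<Sum>i\<in>UNIV. \<gamma>\<^sub>c i)" using inputs(9) by (intro sum_pos) auto
  then show ?thesis using inputs(10) by linarith
qed

lemma kappa_H_nonneg: "0 \<le> \<kappa>\<^sub>H"
proof -
  obtain \<omega> where "\<omega> \<in> space P" using space_nonempty by blast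
  then have "onorm ((*v) (H 0 \<omega>)) \<le> \<kappa>\<^sub>H" by (intro A2(3)) auto
  then show ?thesis
    using onorm_pos_le[OF matrix_vector_mul_bounded_linear, of "H 0 \<omega>"] by linarith
qed

text \<open>A set that is not measurable has \<open>measure\<close> 0 by convention, so positive
  measure already forces membership.\<close>

lemma E_event [measurable]: "E \<in> events"
  using E_pos measure_notin_sets by fastforce

lemma emeasure_E: "emeasure P E \<noteq> 0" "emeasure P E \<noteq> \<infinity>"
  using E_pos by (auto simp: emeasure_eq_measure)

lemma prob_space_Q: "prob_space Q"
  by (rule prob_space_uniform_measure[OF emeasure_E])

sublocale Q: prob_space Q
  by (rule prob_space_Q)

lemma AE_E: "AE \<omega> in Q. \<omega> \<in> E"
  by (rule AE_uniform_measureI) auto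

lemma E_space: "\<omega> \<in> E \<Longrightarrow> \<omega> \<in> space P"
  by (simp add: E)

lemma measurable_quantities:
  assumes "k \<le> k\<^sub>m\<^sub>a\<^sub>x"
  shows "X k \<in> borel_measurable P" "prev \<tau>\<^sub>i\<^sub>n\<^sub>i\<^sub>t T k \<in> borel_measurable P"
    "(\<lambda>\<omega>. gradf (X k \<omega>)) \<in> borel_measurable P" "(\<lambda>\<omega>. c (X k \<omega>)) \<in> borel_measurable P"
    "Dtrue k \<in> borel_measurable P" "Ttt k \<in> borel_measurable P" "H k \<in> borel_measurable P"
    "D k \<in> borel_measurable P" "T k \<in> borel_measurable P" "\<Xi> k \<in> borel_measurable P"
    "noise k \<in> borel_measurable P" "drift k \<in> borel_measurable P"
proof -
  have k: "k \<le> Suc k\<^sub>m\<^sub>a\<^sub>x" "Suc k \<le> Suc k\<^sub>m\<^sub>a\<^sub>x" using assms by auto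
  note p = measurable_past_P[OF _ k(1)]
  show [measurable]: "X k \<in> borel_measurable P" "prev \<tau>\<^sub>i\<^sub>n\<^sub>i\<^sub>t T k \<in> borel_measurable P"
    "(\<lambda>\<omega>. gradf (X k \<omega>)) \<in> borel_measurable P" "(\<lambda>\<omega>. c (X k \<omega>)) \<in> borel_measurable P"
    "Dtrue k \<in> borel_measurable P" "Ttt k \<in> borel_measurable P" "H k \<in> borel_measurable P"
    by (rule p, rule measurable_past_quantities[OF assms] A2(1)[OF assms])+
  show [measurable]: "D k \<in> borel_measurable P" and "T k \<in> borel_measurable P" "\<Xi> k \<in> borel_measurable P"
    by (rule measurable_past_P[OF _ k(2)], rule measurable_next_quantities[OF assms])+
  note [measurable] = G_rv[OF assms]
  show "noise k \<in> borel_measurable P" "drift k \<in> borel_measurable P"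
    unfolding noise_def[abs_def] drift_def[abs_def] by measurable
qed

lemma sets_events:
  assumes "k \<le> k\<^sub>m\<^sub>a\<^sub>x"
  shows "decrease k \<in> events" "bad_decrease k \<in> events" "overestimate k \<in> sets (past P G k)"
    "overestimate k \<in> events"
proof -
  note [measurable] = measurable_quantities[OF assms]
  show "decrease k \<in> events" "bad_decrease k \<in> events" "overestimate k \<in> events"
    unfolding decrease_def bad_decrease_def overestimate_def by measurable
  note [measurable] = measurable_past_quantities[OF assms]
  have "{\<omega>\<in>space (past P G k). Ttt k \<omega> < ereal (prev \<tau>\<^sub>i\<^sub>n\<^sub>i\<^sub>t T k \<omega>)} \<in> sets (past P G k)"
    by measurable
  then show "overestimate k \<in> sets (past P G k)" by (simp add: overestimate_def)
qed

lemma finite_measure_subalgebra_past: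
  assumes "k \<le> k\<^sub>m\<^sub>a\<^sub>x"
  shows "finite_measure_subalgebra Q (past P G k)"
proof unfold_locales
  show "subalgebra Q (past P G k)"
    unfolding subalgebra_def using G_rv assms sets_past_subset[of P P k G] by simp
qed

lemma on_E:
  assumes "\<omega> \<in> E" "k \<le> k\<^sub>m\<^sub>a\<^sub>x"
  shows "\<tau>\<^sub>m\<^sub>i\<^sub>n \<le> T k \<omega>" "ereal \<tau>\<^sub>m\<^sub>i\<^sub>n \<le> Ttt k \<omega>" "\<Xi> k \<omega> = \<xi>\<^sub>m\<^sub>i\<^sub>n" "\<xi>\<^sub>m\<^sub>i\<^sub>n \<le> \<xi>\<^sub>i\<^sub>n\<^sub>i\<^sub>t"
    "T k \<omega> \<le> prev \<tau>\<^sub>i\<^sub>n\<^sub>i\<^sub>t T k \<omega>" "prev \<tau>\<^sub>i\<^sub>n\<^sub>i\<^sub>t T k \<omega> \<le> \<tau>\<^sub>i\<^sub>n\<^sub>i\<^sub>t" "0 < prev \<xi>\<^sub>i\<^sub>n\<^sub>i\<^sub>t \<Xi> k \<omega>"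
proof -
  have \<sigma>: "\<sigma> < 1" using inputs by auto
  show 1: "\<tau>\<^sub>m\<^sub>i\<^sub>n \<le> T k \<omega>" "ereal \<tau>\<^sub>m\<^sub>i\<^sub>n \<le> Ttt k \<omega>" "\<Xi> k \<omega> = \<xi>\<^sub>m\<^sub>i\<^sub>n"
    using assms by (auto simp: E)
  have le: "T j \<omega> \<le> prev \<tau>\<^sub>i\<^sub>n\<^sub>i\<^sub>t T j \<omega>" if "j \<le> k\<^sub>m\<^sub>a\<^sub>x" for j
    using iteration_parameters_le(1)[OF run[OF E_space[OF assms(1)] that] inputs(2,3) \<sigma>] .
  then show "T k \<omega> \<le> prev \<tau>\<^sub>i\<^sub>n\<^sub>i\<^sub>t T k \<omega>" using assms by blast
  have "j \<le> k\<^sub>m\<^sub>a\<^sub>x \<Longrightarrow> prev \<tau>\<^sub>i\<^sub>n\<^sub>i\<^sub>t T j \<omega> \<le> \<tau>\<^sub>i\<^sub>n\<^sub>i\<^sub>t" for j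
  proof (induction j)
    case (Suc j)
    then show ?case using le[of j] by (simp add: prev_def)
  qed (simp add: prev_def)
  then show "prev \<tau>\<^sub>i\<^sub>n\<^sub>i\<^sub>t T k \<omega> \<le> \<tau>\<^sub>i\<^sub>n\<^sub>i\<^sub>t" using assms by blast
  show "0 < prev \<xi>\<^sub>i\<^sub>n\<^sub>i\<^sub>t \<Xi> k \<omega>"
    using assms inputs(5) E_params by (cases k) (auto simp: prev_def E)
  have "\<Xi> 0 \<omega> \<le> prev \<xi>\<^sub>i\<^sub>n\<^sub>i\<^sub>t \<Xi> 0 \<omega>"
    using iteration_parameters_le(2)[OF run[OF E_space[OF assms(1)], of 0] inputs(2,3) \<sigma>] inputs(5)
    by (simp add: prev_def)
  then show "\<xi>\<^sub>m\<^sub>i\<^sub>n \<le> \<xi>\<^sub>i\<^sub>n\<^sub>i\<^sub>t" using assms by (simp add: prev_def E)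
qed

text \<open>(A3) bounds the second moment through the nonnegative conditional expectation, which is
  meaningful before integrability is known; integrating it yields finiteness of both
  moments.\<close>

lemma noise_moments:
  assumes k: "k \<le> k\<^sub>m\<^sub>a\<^sub>x"
  shows "integrable Q (\<lambda>\<omega>. (norm (noise k \<omega>))\<^sup>2)" "(\<integral>\<omega>. (norm (noise k \<omega>))\<^sup>2 \<partial>Q) \<le> M"
    "integrable Q (\<lambda>\<omega>. norm (noise k \<omega>))" "(\<integral>\<omega>. norm (noise k \<omega>) \<partial>Q) \<le> sqrt M"
proof -
  interpret F: finite_measure_subalgebra Q "past P G k"
    by (rule finite_measure_subalgebra_past[OF k])
  note [measurable] = measurable_quantities[OF k]
  let ?h = "\<lambda>\<omega>. ennreal ((norm (noise k \<omega>))\<^sup>2)"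
  have "(\<integral>\<^sup>+\<omega>. ?h \<omega> \<partial>Q) = (\<integral>\<^sup>+\<omega>. nn_cond_exp Q (past P G k) ?h \<omega> \<partial>Q)"
    using F.nn_cond_exp_intg[of "\<lambda>_. 1" ?h] by simp
  also have "\<dots> \<le> (\<integral>\<^sup>+\<omega>. ennreal M \<partial>Q)"
    using A3(4)[OF k] by (intro nn_integral_mono_AE) (simp add: noise_def)
  finally have nn: "(\<integral>\<^sup>+\<omega>. ?h \<omega> \<partial>Q) \<le> ennreal M"
    by (simp add: Q.emeasure_space_1[simplified])
  show sq: "integrable Q (\<lambda>\<omega>. (norm (noise k \<omega>))\<^sup>2)"
    by (rule integrableI_nonneg) (use nn in \<open>auto intro: le_less_trans\<close>)
  show sqM: "(\<integral>\<omega>. (norm (noise k \<omega>))\<^sup>2 \<partial>Q) \<le> M"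
    using nn nn_integral_eq_integral[OF sq] A3(1) by (simp add: integral_nonneg_AE)
  \<comment> \<open>AM-GM: \<open>t \<le> (t\<^sup>2 / \<surd>M + \<surd>M) / 2\<close>\<close>
  have am: "norm (noise k \<omega>) \<le> ((norm (noise k \<omega>))\<^sup>2 / sqrt M + sqrt M) / 2" for \<omega>
  proof -
    have "0 \<le> (norm (noise k \<omega>) - sqrt M)\<^sup>2" by simp
    then show ?thesis using A3(1) by (simp add: field_simps power2_eq_square)
  qed
  have rhs: "integrable Q (\<lambda>\<omega>. ((norm (noise k \<omega>))\<^sup>2 / sqrt M + sqrt M) / 2)"
    using sq by auto
  show int: "integrable Q (\<lambda>\<omega>. norm (noise k \<omega>))"
    by (rule Bochner_Integration.integrable_bound[OF rhs])
      (use am order_trans[OF am abs_ge_self] in auto)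
  have "(\<integral>\<omega>. norm (noise k \<omega>) \<partial>Q) \<le> (\<integral>\<omega>. ((norm (noise k \<omega>))\<^sup>2 / sqrt M + sqrt M) / 2 \<partial>Q)"
    by (rule integral_mono[OF int rhs am])
  also have "\<dots> = ((\<integral>\<omega>. (norm (noise k \<omega>))\<^sup>2 \<partial>Q) / sqrt M + sqrt M) / 2"
    using sq Q.prob_space by simp
  also have "\<dots> \<le> (M / sqrt M + sqrt M) / 2"
    using sqM A3(1) by (simp add: divide_right_mono)
  also have "\<dots> = sqrt M" using A3(1) by (simp add: real_div_sqrt)
  finally show "(\<integral>\<omega>. norm (noise k \<omega>) \<partial>Q) \<le> sqrt M" .
qed

text \<open>The tower property, one component at a time: the past-measurable factor \<open>p\<close>
  is pulled out of the conditional mean of \<open>G\<close>, which is the true gradient. Boundedness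
  of \<open>p\<close> on \<open>E\<close> suffices because \<open>Q\<close> is concentrated there;
  \<open>G\<close> is integrable as noise plus bounded gradient.\<close>

lemma noise_orthogonal:
  assumes k: "k \<le> k\<^sub>m\<^sub>a\<^sub>x" and p: "p \<in> borel_measurable (past P G k)"
    and bound: "\<And>\<omega>. \<omega> \<in> E \<Longrightarrow> norm (p \<omega>) \<le> C"
  shows "integrable Q (\<lambda>\<omega>. noise k \<omega> \<bullet> p \<omega>)" "(\<integral>\<omega>. noise k \<omega> \<bullet> p \<omega> \<partial>Q) = 0"
proof -
  interpret F: finite_measure_subalgebra Q "past P G k"
    by (rule finite_measure_subalgebra_past[OF k])
  note [measurable] = measurable_quantities[OF k] G_rv[OF k]
  have k': "k \<le> Suc k\<^sub>m\<^sub>a\<^sub>x" using k by simp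
  have [measurable]: "p \<in> borel_measurable P" by (rule measurable_past_P[OF p k'])
  have pi: "(\<lambda>\<omega>. p \<omega> $ i) \<in> borel_measurable (past P G k)" for i
    using p by measurable
  have bi: "AE \<omega> in Q. \<bar>p \<omega> $ i\<bar> \<le> \<bar>C\<bar>" for i
    using AE_E
  proof eventually_elim
    case (elim \<omega>)
    then show ?case using bound[OF elim] component_le_norm_cart[of "p \<omega>" i] by linarith
  qed
  have mult: "integrable Q (\<lambda>\<omega>. p \<omega> $ i * h \<omega>)" if h: "integrable Q h" for h i
  proof (rule Bochner_Integration.integrable_bound)
    show "integrable Q (\<lambda>\<omega>. \<bar>C\<bar> * h \<omega>)" using h by auto
    show "AE \<omega> in Q. norm (p \<omega> $ i * h \<omega>) \<le> norm (\<bar>C\<bar> * h \<omega>)"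
      using bi[of i] by eventually_elim (simp add: abs_mult mult_right_mono)
    show "(\<lambda>\<omega>. p \<omega> $ i * h \<omega>) \<in> borel_measurable Q" using h by measurable
  qed
  have grad: "integrable Q (\<lambda>\<omega>. gradf (X k \<omega>) $ i)" for i
  proof (rule Bochner_Integration.integrable_bound)
    show "AE \<omega> in Q. norm (gradf (X k \<omega>) $ i) \<le> norm \<kappa>\<^sub>g"
      using AE_E
    proof eventually_elim
      case (elim \<omega>)
      then show ?case
        using kappa_g(2)[OF E_space[OF elim] k] component_le_norm_cart[of "gradf (X k \<omega>)" i]
        by simp
    qed
  qed auto
  have ni: "integrable Q (\<lambda>\<omega>. noise k \<omega> $ i)" for i
    by (rule Bochner_Integration.integrable_bound[OF noise_moments(3)[OF k]])
      (auto simp: component_le_norm_cart)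
  have Gi: "integrable Q (\<lambda>\<omega>. G k \<omega> $ i)" for i
    using Bochner_Integration.integrable_add[OF ni grad, of i i] by (simp add: noise_def)
  have zero: "(\<integral>\<omega>. p \<omega> $ i * noise k \<omega> $ i \<partial>Q) = 0" for i
  proof -
    have "(\<integral>\<omega>. p \<omega> $ i * G k \<omega> $ i \<partial>Q)
        = (\<integral>\<omega>. p \<omega> $ i * real_cond_exp Q (past P G k) (\<lambda>\<omega>. G k \<omega> $ i) \<omega> \<partial>Q)"
      by (rule F.real_cond_exp_intg(2)[symmetric, OF mult[OF Gi] pi]) measurable
    also have "\<dots> = (\<integral>\<omega>. p \<omega> $ i * gradf (X k \<omega>) $ i \<partial>Q)"
      using A3(3)[OF k, of i] by (intro integral_cong_AE) (auto simp: cexp_past_def)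
    finally show ?thesis
      using mult[OF Gi] mult[OF grad] by (simp add: noise_def right_diff_distrib)
  qed
  have eq: "noise k \<omega> \<bullet> p \<omega> = (\<Sum>i\<in>UNIV. p \<omega> $ i * noise k \<omega> $ i)" for \<omega>
    by (simp add: inner_vec_def mult.commute)
  show "integrable Q (\<lambda>\<omega>. noise k \<omega> \<bullet> p \<omega>)" "(\<integral>\<omega>. noise k \<omega> \<bullet> p \<omega> \<partial>Q) = 0"
    unfolding eq using mult[OF ni] zero by auto
qed

text \<open>The system matrix is symmetric, so \<open>\<nabla>f\<^sup>T(D - D\<^sup>t\<^sup>r\<^sup>u\<^sup>e)\<close> is the noise tested
  against a step that depends on the past only.\<close>
lemma drift_mean_zero:
  assumes k: "k \<le> k\<^sub>m\<^sub>a\<^sub>x" and w: "w \<in> borel_measurable (past P G k)"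
    and bound: "\<And>\<omega>. \<omega> \<in> E \<Longrightarrow> \<bar>w \<omega>\<bar> \<le> C"
  shows "integrable Q (\<lambda>\<omega>. w \<omega> * drift k \<omega>)" "(\<integral>\<omega>. w \<omega> * drift k \<omega> \<partial>Q) = 0"
proof -
  \<comment> \<open>\<open>q\<close> is the adjoint step: it solves the same system with the true
    gradient as right-hand side and zero constraint residual, so only past data enter. It is chosen
    pointwise, and Cramer's rule makes the choice measurable.\<close>
  have "\<exists>q z. kkt_solution (H k \<omega>) (J (X k \<omega>)) (- gradf (X k \<omega>)) 0 q z" if "\<omega> \<in> space P" for \<omega>
    using kkt_solution_exists[OF det_kkt_nonzero[OF that k]] by blast
  then obtain q z where q: "\<And>\<omega>. \<omega> \<in> space P \<Longrightarrow>
      kkt_solution (H k \<omega>) (J (X k \<omega>)) (- gradf (X k \<omega>)) 0 (q \<omega>) (z \<omega>)"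
    by metis
  note m = measurable_past_quantities[OF k]
  have qm: "q \<in> borel_measurable (past P G k)"
    by (rule borel_measurable_kkt_solution[OF A2(1)[OF k] m(5) borel_measurable_uminus[OF m(3)]
          borel_measurable_const, where y = z])
      (use det_kkt_nonzero[OF _ k] q in auto)
  have "norm (- (w \<omega> *\<^sub>R q \<omega>)) \<le> C * (\<kappa>\<^sub>g / \<zeta>)" if "\<omega> \<in> E" for \<omega>
  proof -
    note \<omega> = E_space[OF that]
    have "norm (q \<omega>) \<le> norm (gradf (X k \<omega>)) / \<zeta>"
      by (rule kkt_step_bound(2)[OF q[OF \<omega>] A2(5)[OF \<omega> k] A2(4)])
    also have "\<dots> \<le> \<kappa>\<^sub>g / \<zeta>" using kappa_g(2)[OF \<omega> k] A2(4) by (simp add: divide_right_mono)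
    finally have "norm (q \<omega>) \<le> \<kappa>\<^sub>g / \<zeta>" .
    moreover have "0 \<le> C" using bound[OF that] by linarith
    ultimately have "\<bar>w \<omega>\<bar> * norm (q \<omega>) \<le> C * (\<kappa>\<^sub>g / \<zeta>)"
      using bound[OF that] by (intro mult_mono) auto
    then show ?thesis by simp
  qed
  then have O: "integrable Q (\<lambda>\<omega>. noise k \<omega> \<bullet> (- (w \<omega> *\<^sub>R q \<omega>)))"
    "(\<integral>\<omega>. noise k \<omega> \<bullet> (- (w \<omega> *\<^sub>R q \<omega>)) \<partial>Q) = 0"
    using w qm by (intro noise_orthogonal[OF k]; measurable)+
  have eq: "noise k \<omega> \<bullet> (- (w \<omega> *\<^sub>R q \<omega>)) = w \<omega> * drift k \<omega>" if \<omega>: "\<omega> \<in> space P" for \<omega>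
  proof -
    have "kkt_solution (H k \<omega>) (J (X k \<omega>)) (noise k \<omega>) 0 (D k \<omega> - Dtrue k \<omega>) (Y k \<omega> - Ytrue k \<omega>)"
      unfolding noise_def using run[OF \<omega> k] true_step[OF \<omega> k]
      by (intro kkt_solution_diff[where c = "c (X k \<omega>)"]) (auto simp: sqp_iteration_def)
    from kkt_inner_adjoint[OF A2(2)[OF \<omega> k] this q[OF \<omega>]] show ?thesis
      by (simp add: drift_def)
  qed
  show "integrable Q (\<lambda>\<omega>. w \<omega> * drift k \<omega>)"
    using O(1) by (rule Bochner_Integration.integrable_cong[THEN iffD1, rotated 2])
      (auto simp: eq simp del: inner_minus_right inner_scaleR_right)
  show "(\<integral>\<omega>. w \<omega> * drift k \<omega> \<partial>Q) = 0"
    using O(2) by (subst Bochner_Integration.integral_cong[OF refl eq[symmetric]]) auto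
qed

text \<open>The conditional bound gives \<open>M\<^sub>\<tau>\<close> times the probability of the
  bad decrease, which is enlarged to all decreases because \<open>E\<close> limits the number of
  those.\<close>

lemma bad_decrease_noise:
  assumes k: "k \<le> k\<^sub>m\<^sub>a\<^sub>x"
  shows "integrable Q (\<lambda>\<omega>. norm (noise k \<omega>) * indicator (bad_decrease k) \<omega>)"
    "(\<integral>\<omega>. norm (noise k \<omega>) * indicator (bad_decrease k) \<omega> \<partial>Q) \<le> M\<^sub>\<tau> * measure Q (decrease k)"
proof -
  interpret F: finite_measure_subalgebra Q "past P G k"
    by (rule finite_measure_subalgebra_past[OF k])
  have B: "bad_decrease k \<in> sets Q" using sets_events[OF k] by simp
  show "integrable Q (\<lambda>\<omega>. norm (noise k \<omega>) * indicator (bad_decrease k) \<omega>)"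
    using integrable_mult_indicator[OF B noise_moments(3)[OF k]] by (simp add: mult.commute)
  have "(\<integral>\<omega>. norm (noise k \<omega>) * indicator (bad_decrease k) \<omega> \<partial>Q) \<le> M\<^sub>\<tau> * measure Q (bad_decrease k)"
    using A3(5)[OF k bad_decrease_def[unfolded drift_def]] A3(2)
    unfolding cprob_past_def cexp_past_given_def cexp_past_def noise_def[symmetric]
    by (intro F.integral_indicator_le_conditional[OF B noise_moments(3)[OF k]]) auto
  also have "\<dots> \<le> M\<^sub>\<tau> * measure Q (decrease k)"
    using A3(2) sets_events[OF k] by (intro mult_left_mono Q.finite_measure_mono)
      (auto simp: decrease_def bad_decrease_def)
  finally show "(\<integral>\<omega>. norm (noise k \<omega>) * indicator (bad_decrease k) \<omega> \<partial>Q)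
      \<le> M\<^sub>\<tau> * measure Q (decrease k)" .
qed

text \<open>Whether the true trial value lies below the incoming parameter is decided by the past,
  so the lower bound of (A4) can be integrated over this event. Where it meets the event
  \<open>W\<close> of (A4), the parameter must drop.\<close>

lemma overestimate_prob:
  assumes k: "k \<le> k\<^sub>m\<^sub>a\<^sub>x"
  shows "p\<^sub>\<tau> * measure Q (overestimate k) \<le> measure Q (decrease k)"
proof -
  interpret F: finite_measure_subalgebra Q "past P G k"
    by (rule finite_measure_subalgebra_past[OF k])
  note [measurable] = measurable_quantities[OF k] G_rv[OF k]
  define W where "W = {\<omega>\<in>space P.
          G k \<omega> \<bullet> D k \<omega> + max (D k \<omega> \<bullet> (H k \<omega> *v D k \<omega>)) 0
          \<ge> gradf (X k \<omega>) \<bullet> Dtrue k \<omega> + max (Dtrue k \<omega> \<bullet> (H k \<omega> *v Dtrue k \<omega>)) 0}"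
  have W [measurable]: "W \<in> sets Q" unfolding W_def by measurable
  let ?C = "overestimate k"
  have C: "?C \<in> sets (past P G k)" "?C \<in> sets Q" using sets_events[OF k] by auto
  have iW: "integrable Q (indicator W :: _ \<Rightarrow> real)"
    using W by (simp add: Q.emeasure_eq_measure)
  have iCW: "integrable Q (\<lambda>\<omega>. indicator ?C \<omega> * indicator W \<omega> :: real)"
    using integrable_mult_indicator[OF C(2) iW] by simp
  have "p\<^sub>\<tau> * measure Q ?C = (\<integral>\<omega>. indicator ?C \<omega> * p\<^sub>\<tau> \<partial>Q)"
    using C by (simp add: mult.commute)
  also have "\<dots> \<le> (\<integral>\<omega>. indicator ?C \<omega> * real_cond_exp Q (past P G k) (indicator W) \<omega> \<partial>Q)"
  proof (rule integral_mono_AE)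
    show "AE \<omega> in Q. indicator ?C \<omega> * p\<^sub>\<tau>
        \<le> indicator ?C \<omega> * real_cond_exp Q (past P G k) (indicator W) \<omega>"
      using A4(2)[OF k] unfolding W_def[symmetric] cprob_past_def cexp_past_def
      by eventually_elim (auto simp: indicator_def)
    show "integrable Q (\<lambda>\<omega>. indicator ?C \<omega> * real_cond_exp Q (past P G k) (indicator W) \<omega>)"
      using iCW C by (intro F.real_cond_exp_intg(1)) auto
  qed (use C in \<open>simp add: Q.emeasure_eq_measure\<close>)
  also have "\<dots> = (\<integral>\<omega>. indicator ?C \<omega> * indicator W \<omega> \<partial>Q)"
    using iCW C by (intro F.real_cond_exp_intg(2)) auto
  also have "\<dots> = measure Q (?C \<inter> W)"
  proof -
    have "?C \<inter> W \<inter> space P = ?C \<inter> W" by (auto simp: W_def)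
    then show ?thesis by (simp add: indicator_inter_arith[symmetric])
  qed
  also have "\<dots> \<le> measure Q (decrease k)"
  proof (rule Q.finite_measure_mono)
    show "?C \<inter> W \<subseteq> decrease k"
    proof
      fix \<omega> assume \<omega>: "\<omega> \<in> ?C \<inter> W"
      then have \<omega>P: "\<omega> \<in> space P" by (simp add: W_def)
      have "T k \<omega> < prev \<tau>\<^sub>i\<^sub>n\<^sub>i\<^sub>t T k \<omega>"
        by (rule tau_decrease[OF run[OF \<omega>P k] inputs(2)])
          (use \<omega> inputs(4) in \<open>auto simp: W_def overestimate_def Ttt\<close>)
      then show "\<omega> \<in> decrease k" using \<omega>P by (simp add: decrease_def)
    qed
  qed (use sets_events[OF k] in auto)
  finally show ?thesis .
qed

lemma expected_decreases: "(\<Sum>k\<le>k\<^sub>m\<^sub>a\<^sub>x. measure Q (decrease k)) \<le> s\<^sub>m\<^sub>a\<^sub>x"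
proof -
  have i: "integrable Q (indicator (decrease k) :: _ \<Rightarrow> real)" if "k \<le> k\<^sub>m\<^sub>a\<^sub>x" for k
    using sets_events[OF that] by (simp add: Q.emeasure_eq_measure)
  have "(\<Sum>k\<le>k\<^sub>m\<^sub>a\<^sub>x. measure Q (decrease k)) = (\<integral>\<omega>. (\<Sum>k\<le>k\<^sub>m\<^sub>a\<^sub>x. indicator (decrease k) \<omega>) \<partial>Q)"
    using sets_events i by (subst Bochner_Integration.integral_sum) (auto intro!: sum.cong)
  also have "\<dots> \<le> (\<integral>\<omega>. real s\<^sub>m\<^sub>a\<^sub>x \<partial>Q)"
  proof (rule integral_mono_AE)
    show "AE \<omega> in Q. (\<Sum>k\<le>k\<^sub>m\<^sub>a\<^sub>x. indicator (decrease k) \<omega>) \<le> real s\<^sub>m\<^sub>a\<^sub>x"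
      using AE_E
    proof eventually_elim
      case (elim \<omega>)
      have "(\<Sum>k\<le>k\<^sub>m\<^sub>a\<^sub>x. indicator (decrease k) \<omega>)
          = real (card {k. k \<le> k\<^sub>m\<^sub>a\<^sub>x \<and> T k \<omega> < prev \<tau>\<^sub>i\<^sub>n\<^sub>i\<^sub>t T k \<omega>})"
        using E_space[OF elim]
        by (simp add: decrease_def indicator_def sum.If_cases Int_def of_bool_def)
      then show ?case using elim by (simp add: E)
    qed
  qed (use i in auto)
  also have "\<dots> = s\<^sub>m\<^sub>a\<^sub>x" using Q.prob_space by simp
  finally show ?thesis .
qed

end

section \<open>The random output index and the expected reduction\<close>

lemma (in prob_space) integral_uniform_measure:
  fixes h :: "'a \<Rightarrow> real"
  assumes h: "h \<in> borel_measurable M" and A: "A \<in> events" "prob A > 0"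
  shows "(\<integral>x. h x \<partial>uniform_measure M A) = (\<integral>x. indicator A x * h x \<partial>M) / prob A"
proof -
  have "uniform_measure M A = density M (\<lambda>x. ennreal (indicator A x / prob A))"
    unfolding uniform_measure_def using A
    by (intro arg_cong[where f = "density M"] ext)
      (simp add: emeasure_eq_measure divide_ennreal ennreal_indicator[symmetric] del: ennreal_indicator)
  then have "(\<integral>x. h x \<partial>uniform_measure M A) = (\<integral>x. (indicator A x / prob A) *\<^sub>R h x \<partial>M)"
    using h A by (simp add: integral_density)
  also have "\<dots> = (\<integral>x. (indicator A x * h x) / prob A \<partial>M)"
    by (simp add: field_simps)
  finally show ?thesis by simp
qed

text \<open>Only an inequality: outside the null set \<open>K > n\<close> nothing is known about \<open>Z\<close>, and
  if \<open>Z (K \<omega>) \<omega>\<close> fails to be measurable there then its integral is \<open>0\<close> by convention.\<close>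
lemma (in prob_space) integral_at_uniform_index_le:
  fixes Z :: "nat \<Rightarrow> 'a \<Rightarrow> real"
  assumes K [measurable]: "K \<in> measurable M (count_space UNIV)"
    and distr: "distr M (count_space UNIV) K = measure_pmf (pmf_of_set {0..n})"
    and indep: "indep_set (sets (vimage_algebra (space M) K (count_space UNIV))) (sets F)"
    and F: "space F = space M" "sets F \<subseteq> events"
    and A: "A \<in> sets F" "prob A > 0"
    and Z: "\<And>k. k \<le> n \<Longrightarrow> Z k \<in> borel_measurable F"
    and int: "\<And>k. k \<le> n \<Longrightarrow> integrable M (\<lambda>\<omega>. indicator A \<omega> * Z k \<omega>)"
    and nonneg: "\<And>k \<omega>. k \<le> n \<Longrightarrow> \<omega> \<in> A \<Longrightarrow> 0 \<le> Z k \<omega>"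
  shows "(\<integral>\<omega>. Z (K \<omega>) \<omega> \<partial>uniform_measure M A) \<le> (\<Sum>k\<le>n. \<integral>\<omega>. Z k \<omega> \<partial>uniform_measure M A) / (n + 1)"
proof -
  have AM: "A \<in> events" using A F by auto
  have FM: "h \<in> borel_measurable M" if "h \<in> borel_measurable F" for h :: "'a \<Rightarrow> real"
    using that F by (auto simp: measurable_def)
  have Zk: "(\<integral>\<omega>. Z k \<omega> \<partial>uniform_measure M A) = (\<integral>\<omega>. indicator A \<omega> * Z k \<omega> \<partial>M) / prob A"
    if "k \<le> n" for k
    using that by (intro integral_uniform_measure FM Z AM A)
  have Z0: "0 \<le> (\<integral>\<omega>. Z k \<omega> \<partial>uniform_measure M A)" if "k \<le> n" for k
    unfolding Zk[OF that] using nonneg[OF that]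
    by (intro divide_nonneg_nonneg Bochner_Integration.integral_nonneg) (auto simp: indicator_def)
  show ?thesis
  proof (cases "(\<lambda>\<omega>. Z (K \<omega>) \<omega>) \<in> borel_measurable M")
    case False
    then have "\<not> integrable (uniform_measure M A) (\<lambda>\<omega>. Z (K \<omega>) \<omega>)"
      using borel_measurable_integrable by force
    then show ?thesis
      using Z0 by (auto simp: not_integrable_integral_eq intro!: divide_nonneg_nonneg sum_nonneg)
  next
    case True
    have prob_K: "prob {\<omega> \<in> space M. K \<omega> = k} = 1 / (n + 1)" if "k \<le> n" for k
    proof -
      have "prob {\<omega> \<in> space M. K \<omega> = k} = measure (distr M (count_space UNIV) K) {k}"
        by (subst measure_distr) (auto intro!: arg_cong[where f = prob])
      also have "\<dots> = 1 / (n + 1)"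
        unfolding distr using that by (simp add: measure_pmf_single)
      finally show ?thesis .
    qed
    have AE_K: "AE \<omega> in M. K \<omega> \<le> n"
    proof -
      have "AE k in distr M (count_space UNIV) K. k \<le> n"
        unfolding distr by (auto simp: AE_measure_pmf_iff)
      then show ?thesis by (subst (asm) AE_distr_iff) auto
    qed
    have prod: "(\<integral>\<omega>. indicator {\<omega> \<in> space M. K \<omega> = k} \<omega> * (indicator A \<omega> * Z k \<omega>) \<partial>M)
        = 1 / (n + 1) * (\<integral>\<omega>. indicator A \<omega> * Z k \<omega> \<partial>M)"
      "integrable M (\<lambda>\<omega>. indicator {\<omega> \<in> space M. K \<omega> = k} \<omega> * (indicator A \<omega> * Z k \<omega>))"
      if k: "k \<le> n" for k
    proof -
      let ?X1 = "indicator {\<omega> \<in> space M. K \<omega> = k} :: 'a \<Rightarrow> real" and ?X2 = "\<lambda>\<omega>. indicator A \<omega> * Z k \<omega>"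
      let ?\<K> = "vimage_algebra (space M) K (count_space UNIV)"
      have "K -` {k} \<inter> space M \<in> sets ?\<K>"
        by (rule in_vimage_algebra) simp
      also have "K -` {k} \<inter> space M = {\<omega> \<in> space M. K \<omega> = k}" by auto
      finally have m1: "?X1 \<in> borel_measurable ?\<K>" by (rule borel_measurable_indicator)
      have m2: "?X2 \<in> borel_measurable F"
        using Z[OF k] A by (intro borel_measurable_times borel_measurable_indicator)
      have s1: "sigma_sets (space M) {?X1 -` B \<inter> space M |B. B \<in> sets borel} \<subseteq> sets ?\<K>"
        using measurable_sets[OF m1]
        by (intro sets.sigma_sets_subset[where M = ?\<K>, unfolded space_vimage_algebra]) auto
      have s2: "sigma_sets (space M) {?X2 -` B \<inter> space M |B. B \<in> sets borel} \<subseteq> sets F"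
        using measurable_sets[OF m2] by (intro sets.sigma_sets_subset[where M = F, unfolded F(1)]) (auto simp: F(1))
      \<comment> \<open>The first factor depends on \<open>K\<close> alone and the second is
        \<open>F\<close>-measurable. The latter requires \<open>A\<close> itself to belong to
        \<open>F\<close>, not merely to the events.\<close>
      have "indep_set (sigma_sets (space M) {?X1 -` B \<inter> space M |B. B \<in> sets borel})
          (sigma_sets (space M) {?X2 -` B \<inter> space M |B. B \<in> sets borel})"
        using indep s1 s2 unfolding indep_sets2_eq by (meson subset_trans subsetD)
      moreover have "?X1 \<in> borel_measurable M" by measurable
      ultimately have iv: "indep_var borel ?X1 borel ?X2"
        using FM[OF m2] unfolding indep_var_eq by blast
      have i1: "integrable M ?X1" by (simp add: emeasure_eq_measure)
      show "integrable M (\<lambda>\<omega>. ?X1 \<omega> * ?X2 \<omega>)"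
        by (rule indep_var_integrable[OF iv i1 int[OF k]])
      show "(\<integral>\<omega>. ?X1 \<omega> * ?X2 \<omega> \<partial>M) = 1 / (n + 1) * (\<integral>\<omega>. ?X2 \<omega> \<partial>M)"
        using indep_var_lebesgue_integral[OF iv i1 int[OF k]] prob_K[OF k] by simp
    qed
    have "(\<integral>\<omega>. indicator A \<omega> * Z (K \<omega>) \<omega> \<partial>M)
        = (\<integral>\<omega>. (\<Sum>k\<le>n. indicator {\<omega> \<in> space M. K \<omega> = k} \<omega> * (indicator A \<omega> * Z k \<omega>)) \<partial>M)"
    proof (rule integral_cong_AE)
      show "AE \<omega> in M. indicator A \<omega> * Z (K \<omega>) \<omega>
          = (\<Sum>k\<le>n. indicator {\<omega> \<in> space M. K \<omega> = k} \<omega> * (indicator A \<omega> * Z k \<omega>))"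
        using AE_K AE_space
      proof eventually_elim
        case (elim \<omega>)
        then have "(\<Sum>k\<le>n. indicator {\<omega> \<in> space M. K \<omega> = k} \<omega> * (indicator A \<omega> * Z k \<omega>))
            = (\<Sum>k\<le>n. if k = K \<omega> then indicator A \<omega> * Z k \<omega> else 0)"
          by (intro sum.cong) (auto simp: indicator_def)
        then show ?case using elim by simp
      qed
      show "(\<lambda>\<omega>. indicator A \<omega> * Z (K \<omega>) \<omega>) \<in> borel_measurable M"
        using True AM by (intro borel_measurable_times borel_measurable_indicator)
      show "(\<lambda>\<omega>. \<Sum>k\<le>n. indicator {\<omega> \<in> space M. K \<omega> = k} \<omega> * (indicator A \<omega> * Z k \<omega>))
          \<in> borel_measurable M"
        using prod(2)[THEN borel_measurable_integrable] by (intro borel_measurable_sum) blast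
    qed
    also have "\<dots> = (\<Sum>k\<le>n. 1 / (n + 1) * (\<integral>\<omega>. indicator A \<omega> * Z k \<omega> \<partial>M))"
      using prod by (subst Bochner_Integration.integral_sum) (auto intro!: sum.cong)
    finally have "(\<integral>\<omega>. Z (K \<omega>) \<omega> \<partial>uniform_measure M A)
        = (\<Sum>k\<le>n. 1 / (n + 1) * (\<integral>\<omega>. indicator A \<omega> * Z k \<omega> \<partial>M)) / prob A"
      by (simp add: integral_uniform_measure[OF True AM A(2)])
    also have "\<dots> = (\<Sum>k\<le>n. \<integral>\<omega>. Z k \<omega> \<partial>uniform_measure M A) / (n + 1)"
      by (simp add: Zk sum_divide_distrib sum_distrib_left mult.commute)
    finally show ?thesis by simp
  qed
qed

section \<open>Measurability, telescoping and integrability of the model reduction\<close>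

context stochastic_sqp
begin

lemma measurable_q_red:
  assumes "k \<le> k\<^sub>m\<^sub>a\<^sub>x"
  shows "q_red k \<in> borel_measurable (past P G (Suc k))"
proof -
  let ?F = "past P G (Suc k)"
  note lift = measurable_past_mono[where i = k and j = "Suc k", OF _ le_SucI[OF order_refl]]
  note p = lift[OF measurable_past_quantities(3)[OF assms]] lift[OF measurable_past_quantities(4)[OF assms]]
    lift[OF measurable_past_quantities(6)[OF assms]] lift[OF A2(1)[OF assms]]
  note [measurable] = lift[OF measurable_past_quantities(7)[OF assms]] measurable_next_quantities(2)[OF assms]
  have "(\<lambda>\<omega>. real_of_ereal (min (ereal (T k \<omega>)) (Ttt k \<omega>))) \<in> borel_measurable ?F" by measurable
  then have "That k \<in> borel_measurable ?F" by (simp add: That[abs_def] cong: measurable_cong)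
  from borel_measurable_delta_q[OF p(2,1,3,4) this] show ?thesis
    by (simp add: q_red_def[abs_def])
qed

text \<open>The output index is independent of the gradients, so conditioning on \<open>E\<close>
  leaves its law unchanged only once \<open>E\<close> is known to be determined by them. The
  cardinality is written as a finite sum of indicators to make it measurable.\<close>

lemma E_past: "E \<in> sets (past P G (Suc k\<^sub>m\<^sub>a\<^sub>x))"
proof -
  let ?F = "past P G (Suc k\<^sub>m\<^sub>a\<^sub>x)"
  have [measurable]: "T k \<in> borel_measurable ?F" "\<Xi> k \<in> borel_measurable ?F"
    "Ttt k \<in> borel_measurable ?F" "prev \<tau>\<^sub>i\<^sub>n\<^sub>i\<^sub>t T k \<in> borel_measurable ?F" if "k \<in> {..k\<^sub>m\<^sub>a\<^sub>x}" for k
    using that measurable_next_quantities[of k] measurable_past_quantities[of k]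
    by (auto intro: measurable_past_mono)
  have "real (card {k. k \<le> k\<^sub>m\<^sub>a\<^sub>x \<and> T k \<omega> < prev \<tau>\<^sub>i\<^sub>n\<^sub>i\<^sub>t T k \<omega>})
      = (\<Sum>k\<in>{..k\<^sub>m\<^sub>a\<^sub>x}. if T k \<omega> < prev \<tau>\<^sub>i\<^sub>n\<^sub>i\<^sub>t T k \<omega> then 1 else 0)" for \<omega>
    by (simp add: sum.If_cases Int_def)
  then have "E = {\<omega>\<in>space ?F.
        (\<forall>k\<in>{..k\<^sub>m\<^sub>a\<^sub>x}. T k \<omega> \<ge> \<tau>\<^sub>m\<^sub>i\<^sub>n \<and> Ttt k \<omega> \<ge> ereal \<tau>\<^sub>m\<^sub>i\<^sub>n \<and> \<Xi> k \<omega> = \<xi>\<^sub>m\<^sub>i\<^sub>n) \<and>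
        (\<Sum>k\<in>{..k\<^sub>m\<^sub>a\<^sub>x}. if T k \<omega> < prev \<tau>\<^sub>i\<^sub>n\<^sub>i\<^sub>t T k \<omega> then 1 else 0) \<le> real s\<^sub>m\<^sub>a\<^sub>x}"
    unfolding E by (metis (no_types, lifting) atMost_iff of_nat_le_iff space_past)
  also have "\<dots> \<in> sets ?F" by measurable
  finally show ?thesis .
qed

text \<open>The weights \<open>T k\<close> vary, so the sum does not telescope by itself. Measuring
  \<open>f\<close> from its lower bound makes the gap nonnegative, and then a drop of
  \<open>T\<close> can only lower the weighted gap carried through the induction.\<close>

lemma merit_telescope:
  assumes \<omega>: "\<omega> \<in> E"
  shows "(\<Sum>k\<le>k\<^sub>m\<^sub>a\<^sub>x. T k \<omega> * (f (X k \<omega>) - f (X (Suc k) \<omega>))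
      + l1_norm (c (X k \<omega>)) - l1_norm (c (X (Suc k) \<omega>)))
    \<le> \<tau>\<^sub>i\<^sub>n\<^sub>i\<^sub>t * (f x\<^sub>0 - f\<^sub>l\<^sub>o\<^sub>w) + l1_norm (c x\<^sub>0)"
proof -
  have low: "f\<^sub>l\<^sub>o\<^sub>w \<le> f (X k \<omega>)" if "k \<le> Suc k\<^sub>m\<^sub>a\<^sub>x" for k
    using A1(4) A1(2)[OF E_space[OF \<omega>] that] by blast
  have start_\<omega>: "X 0 \<omega> = x\<^sub>0" using start E_space[OF \<omega>] by blast
  have "n \<le> k\<^sub>m\<^sub>a\<^sub>x \<Longrightarrow> (\<Sum>k\<le>n. T k \<omega> * (f (X k \<omega>) - f (X (Suc k) \<omega>))
      + l1_norm (c (X k \<omega>)) - l1_norm (c (X (Suc k) \<omega>)))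
    \<le> \<tau>\<^sub>i\<^sub>n\<^sub>i\<^sub>t * (f x\<^sub>0 - f\<^sub>l\<^sub>o\<^sub>w) + l1_norm (c x\<^sub>0)
      - T n \<omega> * (f (X (Suc n) \<omega>) - f\<^sub>l\<^sub>o\<^sub>w) - l1_norm (c (X (Suc n) \<omega>))" for n
  proof (induction n)
    case 0
    have "T 0 \<omega> * (f x\<^sub>0 - f\<^sub>l\<^sub>o\<^sub>w) \<le> \<tau>\<^sub>i\<^sub>n\<^sub>i\<^sub>t * (f x\<^sub>0 - f\<^sub>l\<^sub>o\<^sub>w)"
      using on_E(5,6)[OF \<omega>, of 0] low[of 0] start_\<omega> by (intro mult_right_mono) auto
    then show ?case using start_\<omega> by (simp add: algebra_simps)
  next
    case (Suc n)
    have "T (Suc n) \<omega> * (f (X (Suc n) \<omega>) - f\<^sub>l\<^sub>o\<^sub>w) \<le> T n \<omega> * (f (X (Suc n) \<omega>) - f\<^sub>l\<^sub>o\<^sub>w)"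
      using on_E(5)[OF \<omega>, of "Suc n"] low[of "Suc n"] Suc.prems
      by (intro mult_right_mono) (auto simp: prev_def)
    then show ?case using Suc by (simp add: algebra_simps)
  qed
  from this[of k\<^sub>m\<^sub>a\<^sub>x]
  have "(\<Sum>k\<le>k\<^sub>m\<^sub>a\<^sub>x. T k \<omega> * (f (X k \<omega>) - f (X (Suc k) \<omega>))
      + l1_norm (c (X k \<omega>)) - l1_norm (c (X (Suc k) \<omega>)))
    \<le> \<tau>\<^sub>i\<^sub>n\<^sub>i\<^sub>t * (f x\<^sub>0 - f\<^sub>l\<^sub>o\<^sub>w) + l1_norm (c x\<^sub>0)
      - T k\<^sub>m\<^sub>a\<^sub>x \<omega> * (f (X (Suc k\<^sub>m\<^sub>a\<^sub>x) \<omega>) - f\<^sub>l\<^sub>o\<^sub>w) - l1_norm (c (X (Suc k\<^sub>m\<^sub>a\<^sub>x) \<omega>))" by simp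
  moreover have "0 \<le> T k\<^sub>m\<^sub>a\<^sub>x \<omega> * (f (X (Suc k\<^sub>m\<^sub>a\<^sub>x) \<omega>) - f\<^sub>l\<^sub>o\<^sub>w)"
    using low[of "Suc k\<^sub>m\<^sub>a\<^sub>x"] on_E(1)[OF \<omega>, of k\<^sub>m\<^sub>a\<^sub>x] E_params by simp
  ultimately show ?thesis using l1_norm_nonneg[of "c (X (Suc k\<^sub>m\<^sub>a\<^sub>x) \<omega>)"] by linarith
qed

lemma That_on_E:
  assumes "\<omega> \<in> E" "k \<le> k\<^sub>m\<^sub>a\<^sub>x"
  shows "0 \<le> That k \<omega>" "That k \<omega> \<le> \<tau>\<^sub>i\<^sub>n\<^sub>i\<^sub>t" "ereal (That k \<omega>) \<le> Ttt k \<omega>"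
  using on_E(1,2,5,6)[OF assms] E_params
  by (cases "Ttt k \<omega>"; auto simp: That min_def)+

text \<open>The upper bound makes the reduction integrable; the lower one is what the averaging over
  the random index requires.\<close>

lemma q_red_bounds:
  obtains C where "\<And>k \<omega>. k \<le> k\<^sub>m\<^sub>a\<^sub>x \<Longrightarrow> \<omega> \<in> E \<Longrightarrow> 0 \<le> q_red k \<omega> \<and> q_red k \<omega> \<le> C"
proof -
  obtain B where B: "\<And>x. x \<in> \<X> \<Longrightarrow> norm (c x) \<le> B"
    using A1(7) by (auto simp: bounded_iff)
  let ?\<kappa> = "\<kappa>\<^sub>d * \<kappa>\<^sub>g\<^sup>2 * (1 + 1/2 * \<kappa>\<^sub>H * \<kappa>\<^sub>d)"
  have "0 \<le> q_red k \<omega> \<and> q_red k \<omega> \<le> \<tau>\<^sub>i\<^sub>n\<^sub>i\<^sub>t * ?\<kappa> + real CARD('m) * B"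
    if k: "k \<le> k\<^sub>m\<^sub>a\<^sub>x" and \<omega>: "\<omega> \<in> E" for k \<omega>
  proof
    note \<omega>P = E_space[OF \<omega>]
    note That_\<omega> = That_on_E[OF \<omega> k]
    show "0 \<le> q_red k \<omega>"
      unfolding q_red_def using That_\<omega> inputs(4) by (intro delta_q_nonneg[of _ \<sigma>]) (auto simp: Ttt)
    have "norm (Dtrue k \<omega>) \<le> \<kappa>\<^sub>d * \<kappa>\<^sub>g"
      using kappa_d(2)[OF \<omega>P k] kappa_d(1) kappa_g(2)[OF \<omega>P k] by (smt (verit) mult_left_mono)
    then have "\<bar>q_model (gradf (X k \<omega>)) (H k \<omega>) (Dtrue k \<omega>)\<bar> \<le> ?\<kappa>"
      by (rule q_model_bound[OF A2(3)[OF \<omega>P k] kappa_g(2)[OF \<omega>P k] _ kappa_H_nonneg])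
    then have "That k \<omega> * \<bar>q_model (gradf (X k \<omega>)) (H k \<omega>) (Dtrue k \<omega>)\<bar> \<le> \<tau>\<^sub>i\<^sub>n\<^sub>i\<^sub>t * ?\<kappa>"
      using That_\<omega> inputs(1) by (intro mult_mono) auto
    moreover have "- That k \<omega> * q_model (gradf (X k \<omega>)) (H k \<omega>) (Dtrue k \<omega>)
        \<le> That k \<omega> * \<bar>q_model (gradf (X k \<omega>)) (H k \<omega>) (Dtrue k \<omega>)\<bar>"
      using mult_left_mono[OF abs_ge_minus_self That_\<omega>(1)] by simp
    moreover have "l1_norm (c (X k \<omega>)) \<le> (\<Sum>i\<in>(UNIV :: 'm set). B)"
      unfolding l1_norm_def using B[OF A1(2)[OF \<omega>P]] k
      by (intro sum_mono order_trans[OF component_le_norm_cart]) auto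
    ultimately show "q_red k \<omega> \<le> \<tau>\<^sub>i\<^sub>n\<^sub>i\<^sub>t * ?\<kappa> + real CARD('m) * B"
      unfolding q_red_def delta_q_eq by simp
  qed
  then show thesis using that by blast
qed

lemma integrable_q_red:
  assumes k: "k \<le> k\<^sub>m\<^sub>a\<^sub>x"
  shows "integrable Q (q_red k)" "integrable P (\<lambda>\<omega>. indicator E \<omega> * q_red k \<omega>)"
proof -
  obtain C where C: "\<And>k \<omega>. k \<le> k\<^sub>m\<^sub>a\<^sub>x \<Longrightarrow> \<omega> \<in> E \<Longrightarrow> 0 \<le> q_red k \<omega> \<and> q_red k \<omega> \<le> C"
    using q_red_bounds by blast
  have [measurable]: "q_red k \<in> borel_measurable P"
    by (rule measurable_past_P[OF measurable_q_red[OF k]]) (use k in simp)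
  show "integrable Q (q_red k)"
  proof (rule Q.integrable_const_bound[of _ C])
    show "AE \<omega> in Q. norm (q_red k \<omega>) \<le> C"
      using AE_E by eventually_elim (use C[OF k] in auto)
  qed simp
  show "integrable P (\<lambda>\<omega>. indicator E \<omega> * q_red k \<omega>)"
    by (rule integrable_const_bound[of _ "\<bar>C\<bar>"]) (use C[OF k] in \<open>auto simp: indicator_def intro!: AE_I2 order_trans[OF _ abs_ge_self]\<close>)
qed

end

section \<open>Averaging the bound for one iteration\<close>

context stochastic_sqp
begin

context
  fixes Amin Amax U V :: real
  assumes Amin: "Amin = \<xi>\<^sub>m\<^sub>i\<^sub>n * \<tau>\<^sub>m\<^sub>i\<^sub>n / (\<tau>\<^sub>m\<^sub>i\<^sub>n * L + \<Gamma>)"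
    and Amax: "Amax = \<xi>\<^sub>i\<^sub>n\<^sub>i\<^sub>t * \<tau>\<^sub>i\<^sub>n\<^sub>i\<^sub>t / (\<tau>\<^sub>i\<^sub>n\<^sub>i\<^sub>t * L + \<Gamma>)"
    and U: "U = Amax + \<theta> * \<beta>" "\<beta> * U \<le> Amin"
    and V: "V = U * \<tau>\<^sub>i\<^sub>n\<^sub>i\<^sub>t - Amin * \<tau>\<^sub>m\<^sub>i\<^sub>n"
begin

text \<open>Relations between deterministic constants, read off at a single outcome:
  \<open>E\<close> has positive probability and is therefore nonempty, and along a run in
  \<open>E\<close> both parameters only decrease from their initial values.\<close>

lemma constants_bounds:
  "\<tau>\<^sub>m\<^sub>i\<^sub>n \<le> \<tau>\<^sub>i\<^sub>n\<^sub>i\<^sub>t" "0 < Amin" "Amin \<le> Amax" "0 \<le> U" "0 \<le> V"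
proof -
  obtain \<omega> where \<omega>: "\<omega> \<in> E" using E_pos by (metis equals0I less_irrefl measure_empty)
  show \<tau>: "\<tau>\<^sub>m\<^sub>i\<^sub>n \<le> \<tau>\<^sub>i\<^sub>n\<^sub>i\<^sub>t"
    using on_E(1,5,6)[OF \<omega>, of 0] by simp
  show A0: "0 < Amin" unfolding Amin
    using E_params inputs(8) Gamma_pos by (intro divide_pos_pos mult_pos_pos add_pos_pos)
  have "\<xi>\<^sub>m\<^sub>i\<^sub>n * (\<tau>\<^sub>m\<^sub>i\<^sub>n / (\<tau>\<^sub>m\<^sub>i\<^sub>n * L + \<Gamma>)) \<le> \<xi>\<^sub>i\<^sub>n\<^sub>i\<^sub>t * (\<tau>\<^sub>i\<^sub>n\<^sub>i\<^sub>t / (\<tau>\<^sub>i\<^sub>n\<^sub>i\<^sub>t * L + \<Gamma>))"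
    using ratio_mono[OF E_params(1) \<tau> inputs(8) Gamma_pos] on_E(4)[OF \<omega>, of 0] inputs E_params Gamma_pos
    by (intro mult_mono) auto
  then show AA: "Amin \<le> Amax" by (simp add: Amin Amax)
  have "0 \<le> \<theta> * \<beta>" using inputs by simp
  then have AU: "Amin \<le> U" using AA U by linarith
  then show "0 \<le> U" using A0 by linarith
  then have "Amin * \<tau>\<^sub>m\<^sub>i\<^sub>n \<le> U * \<tau>\<^sub>i\<^sub>n\<^sub>i\<^sub>t"
    using AU \<tau> E_params by (intro mult_mono) auto
  then show "0 \<le> V" by (simp add: V)
qed

text \<open>The right-hand side of the bound for one iteration without its telescoping part, with
  the case distinctions written as indicators of events so that it can be integrated term by
  term.\<close>

definition remainder :: "nat \<Rightarrow> 'a \<Rightarrow> real" where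
  "remainder k \<omega> =
      1/2 * U * \<beta>\<^sup>2 * ((\<tau>\<^sub>i\<^sub>n\<^sub>i\<^sub>t + \<tau>\<^sub>m\<^sub>i\<^sub>n) / 2 *
            (- (noise k \<omega> \<bullet> Dtrue k \<omega>)
              - (if Dtrue k \<omega> \<bullet> (H k \<omega> *v Dtrue k \<omega>) > 0 then 0 else 1) * drift k \<omega>
              + (norm (noise k \<omega>))\<^sup>2 / \<zeta>)
          + (\<tau>\<^sub>i\<^sub>n\<^sub>i\<^sub>t - \<tau>\<^sub>m\<^sub>i\<^sub>n) / 2 * (2 * \<kappa>\<^sub>d * \<kappa>\<^sub>g * norm (noise k \<omega>) + \<kappa>\<^sub>d * (norm (noise k \<omega>))\<^sup>2
              + \<kappa>\<^sub>H * \<kappa>\<^sub>d\<^sup>2 * (\<kappa>\<^sub>g\<^sup>2 / 2 + (norm (noise k \<omega>))\<^sup>2)))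
      + \<beta> * (V * (\<kappa>\<^sub>d * \<kappa>\<^sub>g\<^sup>2 * (1 + 1/2 * \<kappa>\<^sub>H * \<kappa>\<^sub>d))) * indicator (overestimate k) \<omega>
      + \<beta> * \<xi>\<^sub>m\<^sub>i\<^sub>n * prev \<tau>\<^sub>i\<^sub>n\<^sub>i\<^sub>t T k \<omega> / (prev \<tau>\<^sub>i\<^sub>n\<^sub>i\<^sub>t T k \<omega> * L + \<Gamma>) * prev \<tau>\<^sub>i\<^sub>n\<^sub>i\<^sub>t T k \<omega> * drift k \<omega>
      + \<theta> * \<beta>\<^sup>2 * \<tau>\<^sub>i\<^sub>n\<^sub>i\<^sub>t * (\<kappa>\<^sub>g * \<kappa>\<^sub>d) * norm (noise k \<omega>)
      + \<beta> * V * (\<kappa>\<^sub>g * \<kappa>\<^sub>d) * (norm (noise k \<omega>) * indicator (bad_decrease k) \<omega>)"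

lemma q_red_le_remainder:
  assumes \<omega>: "\<omega> \<in> E" and k: "k \<le> k\<^sub>m\<^sub>a\<^sub>x"
  shows "1/2 * Amin * \<beta> * q_red k \<omega> \<le> T k \<omega> * (f (X k \<omega>) - f (X (Suc k) \<omega>))
      + l1_norm (c (X k \<omega>)) - l1_norm (c (X (Suc k) \<omega>)) + remainder k \<omega>"
proof -
  note \<omega>P = E_space[OF \<omega>] and e = on_E[OF \<omega> k]
  have fd: "(f has_derivative (\<lambda>h. gradf z \<bullet> h)) (at z)" if "z \<in> \<X>" for z
    using A1(3)[OF that] by (simp add: gderiv_def inner_commute)
  have X: "X k \<omega> \<in> \<X>" "X (Suc k) \<omega> \<in> \<X>" using A1(2)[OF \<omega>P] k by auto
  have "0 < \<beta>" using inputs by auto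
  \<comment> \<open>On \<open>E\<close> the value \<open>\<Xi> k \<omega>\<close> equals
    \<open>\<xi>\<^sub>m\<^sub>i\<^sub>n\<close>; it is rewritten before the remaining premises are
    discharged, so that \<open>Amin\<close> has the form that the lemma expects.\<close>
  note bound = merit_decrease_bound[OF run[OF \<omega>P k] true_step[OF \<omega>P k] inputs(2,3,4,7,8) Gamma_pos
      \<open>0 < \<beta>\<close> lower_end[OF \<omega> k] A1(1) X fd A1(5) A1(6) A1(8) inputs(10) A2(2)[OF \<omega>P k]
      A2(3)[OF \<omega>P k] kappa_H_nonneg A2(5)[OF \<omega>P k] A2(4) kappa_g(2)[OF \<omega>P k]
      kappa_d(2,3)[OF \<omega>P k] kappa_d(1) E_params(1) e(1,6) _ _ e(7) Ttt e(2) That _ Amax U V,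
      unfolded e(3), OF _ _ _ E_params(2) e(4) Amin]
  have ind: "indicator (overestimate k) \<omega> = (if Ttt k \<omega> < ereal (prev \<tau>\<^sub>i\<^sub>n\<^sub>i\<^sub>t T k \<omega>) then 1 else (0::real))"
    "indicator (bad_decrease k) \<omega> = (if drift k \<omega> < 0 \<and> T k \<omega> < prev \<tau>\<^sub>i\<^sub>n\<^sub>i\<^sub>t T k \<omega> then 1 else (0::real))"
    using \<omega>P by (auto simp: overestimate_def bad_decrease_def)
  show ?thesis
    unfolding remainder_def q_red_def ind noise_def drift_def
    by (rule order_trans, rule bound, assumption+) linarith
qed

lemma remainder_expectation:
  assumes k: "k \<le> k\<^sub>m\<^sub>a\<^sub>x"
  shows "integrable Q (remainder k)"
    "(\<integral>\<omega>. remainder k \<omega> \<partial>Q) \<le>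
      \<beta>\<^sup>2 * (1/2 * U * ((\<tau>\<^sub>i\<^sub>n\<^sub>i\<^sub>t + \<tau>\<^sub>m\<^sub>i\<^sub>n) / 2 * (M / \<zeta>)
          + (\<tau>\<^sub>i\<^sub>n\<^sub>i\<^sub>t - \<tau>\<^sub>m\<^sub>i\<^sub>n) / 2 * (2 * \<kappa>\<^sub>d * \<kappa>\<^sub>g * sqrt M + \<kappa>\<^sub>d * M + \<kappa>\<^sub>H * \<kappa>\<^sub>d\<^sup>2 * (\<kappa>\<^sub>g\<^sup>2 / 2 + M)))
        + \<theta> * \<tau>\<^sub>i\<^sub>n\<^sub>i\<^sub>t * (\<kappa>\<^sub>g * \<kappa>\<^sub>d) * sqrt M)
      + \<beta> * (V * (\<kappa>\<^sub>d * \<kappa>\<^sub>g\<^sup>2 * (1 + 1/2 * \<kappa>\<^sub>H * \<kappa>\<^sub>d))) * measure Q (overestimate k)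
      + \<beta> * V * (\<kappa>\<^sub>g * \<kappa>\<^sub>d) * (M\<^sub>\<tau> * measure Q (decrease k))"
proof -
  note m = measurable_past_quantities[OF k]
  note [measurable] = m A2(1)[OF k]
  have \<beta>: "0 < \<beta>" using inputs by auto
  \<comment> \<open>\<open>s\<close> and \<open>w\<close> are the coefficients of the drift. Both
    depend on the past only and are bounded on \<open>E\<close>, so the drift terms have mean
    zero.\<close>
  define s where "s \<omega> = (if Dtrue k \<omega> \<bullet> (H k \<omega> *v Dtrue k \<omega>) > 0 then 0 else 1 :: real)" for \<omega>
  define w where "w \<omega> = \<beta> * \<xi>\<^sub>m\<^sub>i\<^sub>n * prev \<tau>\<^sub>i\<^sub>n\<^sub>i\<^sub>t T k \<omega> / (prev \<tau>\<^sub>i\<^sub>n\<^sub>i\<^sub>t T k \<omega> * L + \<Gamma>) * prev \<tau>\<^sub>i\<^sub>n\<^sub>i\<^sub>t T k \<omega>" for \<omega>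
  have 1: "integrable Q (\<lambda>\<omega>. noise k \<omega> \<bullet> Dtrue k \<omega>)" "(\<integral>\<omega>. noise k \<omega> \<bullet> Dtrue k \<omega> \<partial>Q) = 0"
  proof -
    have "norm (Dtrue k \<omega>) \<le> \<kappa>\<^sub>d * \<kappa>\<^sub>g" if "\<omega> \<in> E" for \<omega>
      using kappa_d(1,2) kappa_g(2) k E_space[OF that] by (smt (verit) mult_left_mono)
    then show "integrable Q (\<lambda>\<omega>. noise k \<omega> \<bullet> Dtrue k \<omega>)" "(\<integral>\<omega>. noise k \<omega> \<bullet> Dtrue k \<omega> \<partial>Q) = 0"
      using noise_orthogonal[OF k m(6)] by blast+
  qed
  have 2: "integrable Q (\<lambda>\<omega>. s \<omega> * drift k \<omega>)" "(\<integral>\<omega>. s \<omega> * drift k \<omega> \<partial>Q) = 0"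
  proof -
    have "s \<in> borel_measurable (past P G k)" unfolding s_def by measurable
    then show "integrable Q (\<lambda>\<omega>. s \<omega> * drift k \<omega>)" "(\<integral>\<omega>. s \<omega> * drift k \<omega> \<partial>Q) = 0"
      using drift_mean_zero[OF k, of s 1] by (auto simp: s_def)
  qed
  have 3: "integrable Q (\<lambda>\<omega>. w \<omega> * drift k \<omega>)" "(\<integral>\<omega>. w \<omega> * drift k \<omega> \<partial>Q) = 0"
  proof -
    have wm: "w \<in> borel_measurable (past P G k)" unfolding w_def by measurable
    have "\<bar>w \<omega>\<bar> \<le> \<beta> * \<xi>\<^sub>m\<^sub>i\<^sub>n * (\<tau>\<^sub>i\<^sub>n\<^sub>i\<^sub>t / (\<tau>\<^sub>i\<^sub>n\<^sub>i\<^sub>t * L + \<Gamma>)) * \<tau>\<^sub>i\<^sub>n\<^sub>i\<^sub>t" if \<omega>: "\<omega> \<in> E" for \<omega>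
    proof -
      let ?t = "prev \<tau>\<^sub>i\<^sub>n\<^sub>i\<^sub>t T k \<omega>"
      have t: "0 < ?t" "?t \<le> \<tau>\<^sub>i\<^sub>n\<^sub>i\<^sub>t" using on_E[OF \<omega> k] E_params by auto
      have r: "0 \<le> ?t / (?t * L + \<Gamma>)" "0 \<le> \<tau>\<^sub>i\<^sub>n\<^sub>i\<^sub>t / (\<tau>\<^sub>i\<^sub>n\<^sub>i\<^sub>t * L + \<Gamma>)"
        using t inputs(1,8) Gamma_pos by simp_all
      have "\<beta> * \<xi>\<^sub>m\<^sub>i\<^sub>n * (?t / (?t * L + \<Gamma>)) * ?t \<le> \<beta> * \<xi>\<^sub>m\<^sub>i\<^sub>n * (\<tau>\<^sub>i\<^sub>n\<^sub>i\<^sub>t / (\<tau>\<^sub>i\<^sub>n\<^sub>i\<^sub>t * L + \<Gamma>)) * \<tau>\<^sub>i\<^sub>n\<^sub>i\<^sub>t"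
        using ratio_mono[OF t inputs(8) Gamma_pos] r t \<beta> E_params
        by (intro mult_mono mult_nonneg_nonneg) auto
      moreover have "0 \<le> \<beta> * \<xi>\<^sub>m\<^sub>i\<^sub>n * (?t / (?t * L + \<Gamma>)) * ?t"
        using r t \<beta> E_params by (intro mult_nonneg_nonneg) auto
      moreover have "w \<omega> = \<beta> * \<xi>\<^sub>m\<^sub>i\<^sub>n * (?t / (?t * L + \<Gamma>)) * ?t" by (simp add: w_def)
      ultimately show ?thesis by linarith
    qed
    then show "integrable Q (\<lambda>\<omega>. w \<omega> * drift k \<omega>)" "(\<integral>\<omega>. w \<omega> * drift k \<omega> \<partial>Q) = 0"
      using drift_mean_zero[OF k wm] by blast+
  qed
  note n = noise_moments[OF k] and b = bad_decrease_noise[OF k]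
  have o: "integrable Q (indicator (overestimate k) :: _ \<Rightarrow> real)"
    "(\<integral>\<omega>. indicator (overestimate k) \<omega> \<partial>Q) = measure Q (overestimate k)"
    using sets_events(4)[OF k] sets.sets_into_space[OF sets_events(4)[OF k]]
    by (simp_all add: Q.emeasure_eq_measure Int_absorb2)
  define I1 I2 where "I1 = (\<integral>\<omega>. norm (noise k \<omega>) \<partial>Q)" and "I2 = (\<integral>\<omega>. (norm (noise k \<omega>))\<^sup>2 \<partial>Q)"
  have hb: "has_bochner_integral Q h v" if "integrable Q h" "integral\<^sup>L Q h = v" for h :: "'a \<Rightarrow> real" and v
    using that by (simp add: has_bochner_integral_iff)
  have const: "has_bochner_integral Q (\<lambda>_. v) v" for v :: real
    using Q.prob_space by (simp add: has_bochner_integral_iff)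
  \<comment> \<open>The value copies the shape of the integrand so that the introduction rules apply
    term by term; the entries \<open>- 0\<close>, \<open>- 0\<close> and \<open>+ 0\<close> are the
    three mean-zero terms.\<close>
  have main: "has_bochner_integral Q (remainder k)
     (1/2 * U * \<beta>\<^sup>2 * ((\<tau>\<^sub>i\<^sub>n\<^sub>i\<^sub>t + \<tau>\<^sub>m\<^sub>i\<^sub>n) / 2 * (- 0 - 0 + I2 / \<zeta>)
          + (\<tau>\<^sub>i\<^sub>n\<^sub>i\<^sub>t - \<tau>\<^sub>m\<^sub>i\<^sub>n) / 2 * (2 * \<kappa>\<^sub>d * \<kappa>\<^sub>g * I1 + \<kappa>\<^sub>d * I2
              + \<kappa>\<^sub>H * \<kappa>\<^sub>d\<^sup>2 * (\<kappa>\<^sub>g\<^sup>2 / 2 + I2)))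
      + \<beta> * (V * (\<kappa>\<^sub>d * \<kappa>\<^sub>g\<^sup>2 * (1 + 1/2 * \<kappa>\<^sub>H * \<kappa>\<^sub>d))) * measure Q (overestimate k)
      + 0
      + \<theta> * \<beta>\<^sup>2 * \<tau>\<^sub>i\<^sub>n\<^sub>i\<^sub>t * (\<kappa>\<^sub>g * \<kappa>\<^sub>d) * I1
      + \<beta> * V * (\<kappa>\<^sub>g * \<kappa>\<^sub>d) * (\<integral>\<omega>. norm (noise k \<omega>) * indicator (bad_decrease k) \<omega> \<partial>Q))"
    unfolding remainder_def[abs_def] s_def[symmetric] w_def[symmetric] I1_def I2_def
    by (intro has_bochner_integral_add has_bochner_integral_mult_right has_bochner_integral_diff
        has_bochner_integral_minus has_bochner_integral_divide_zero const
        hb[OF 1] hb[OF 2] hb[OF 3] hb[OF o] hb[OF n(1) refl] hb[OF n(3) refl] hb[OF b(1) refl])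
  show "integrable Q (remainder k)" using main by (simp add: has_bochner_integral_iff)
  have I: "I1 \<le> sqrt M" "I2 \<le> M" using n by (auto simp: I1_def I2_def)
  have z: "I2 / \<zeta> \<le> M / \<zeta>" using I A2(4) by (simp add: divide_right_mono)
  note cb = constants_bounds
  have g1: "(\<tau>\<^sub>i\<^sub>n\<^sub>i\<^sub>t + \<tau>\<^sub>m\<^sub>i\<^sub>n) / 2 * (- 0 - 0 + I2 / \<zeta>) \<le> (\<tau>\<^sub>i\<^sub>n\<^sub>i\<^sub>t + \<tau>\<^sub>m\<^sub>i\<^sub>n) / 2 * (M / \<zeta>)"
    using z inputs(1) E_params by (intro mult_left_mono) auto
  have g2: "(\<tau>\<^sub>i\<^sub>n\<^sub>i\<^sub>t - \<tau>\<^sub>m\<^sub>i\<^sub>n) / 2 * (2 * \<kappa>\<^sub>d * \<kappa>\<^sub>g * I1 + \<kappa>\<^sub>d * I2 + \<kappa>\<^sub>H * \<kappa>\<^sub>d\<^sup>2 * (\<kappa>\<^sub>g\<^sup>2 / 2 + I2))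
      \<le> (\<tau>\<^sub>i\<^sub>n\<^sub>i\<^sub>t - \<tau>\<^sub>m\<^sub>i\<^sub>n) / 2 * (2 * \<kappa>\<^sub>d * \<kappa>\<^sub>g * sqrt M + \<kappa>\<^sub>d * M + \<kappa>\<^sub>H * \<kappa>\<^sub>d\<^sup>2 * (\<kappa>\<^sub>g\<^sup>2 / 2 + M))"
    using I cb(1) kappa_d(1) kappa_g(1) kappa_H_nonneg
    by (intro mult_left_mono add_mono order_refl) auto
  have g: "1/2 * U * \<beta>\<^sup>2 * ((\<tau>\<^sub>i\<^sub>n\<^sub>i\<^sub>t + \<tau>\<^sub>m\<^sub>i\<^sub>n) / 2 * (- 0 - 0 + I2 / \<zeta>)
          + (\<tau>\<^sub>i\<^sub>n\<^sub>i\<^sub>t - \<tau>\<^sub>m\<^sub>i\<^sub>n) / 2 * (2 * \<kappa>\<^sub>d * \<kappa>\<^sub>g * I1 + \<kappa>\<^sub>d * I2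
              + \<kappa>\<^sub>H * \<kappa>\<^sub>d\<^sup>2 * (\<kappa>\<^sub>g\<^sup>2 / 2 + I2)))
      \<le> 1/2 * U * \<beta>\<^sup>2 * ((\<tau>\<^sub>i\<^sub>n\<^sub>i\<^sub>t + \<tau>\<^sub>m\<^sub>i\<^sub>n) / 2 * (M / \<zeta>)
          + (\<tau>\<^sub>i\<^sub>n\<^sub>i\<^sub>t - \<tau>\<^sub>m\<^sub>i\<^sub>n) / 2 * (2 * \<kappa>\<^sub>d * \<kappa>\<^sub>g * sqrt M + \<kappa>\<^sub>d * M + \<kappa>\<^sub>H * \<kappa>\<^sub>d\<^sup>2 * (\<kappa>\<^sub>g\<^sup>2 / 2 + M)))"
    using cb(4) by (intro mult_left_mono add_mono g1 g2) auto
  have h: "\<theta> * \<beta>\<^sup>2 * \<tau>\<^sub>i\<^sub>n\<^sub>i\<^sub>t * (\<kappa>\<^sub>g * \<kappa>\<^sub>d) * I1 \<le> \<theta> * \<beta>\<^sup>2 * \<tau>\<^sub>i\<^sub>n\<^sub>i\<^sub>t * (\<kappa>\<^sub>g * \<kappa>\<^sub>d) * sqrt M"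
    using I inputs(1,7) kappa_d(1) kappa_g(1) by (intro mult_left_mono) auto
  have v: "\<beta> * V * (\<kappa>\<^sub>g * \<kappa>\<^sub>d) * (\<integral>\<omega>. norm (noise k \<omega>) * indicator (bad_decrease k) \<omega> \<partial>Q)
      \<le> \<beta> * V * (\<kappa>\<^sub>g * \<kappa>\<^sub>d) * (M\<^sub>\<tau> * measure Q (decrease k))"
    using b(2) cb(5) \<beta> kappa_d(1) kappa_g(1) by (intro mult_left_mono) auto
  have "(\<integral>\<omega>. remainder k \<omega> \<partial>Q) \<le>
      1/2 * U * \<beta>\<^sup>2 * ((\<tau>\<^sub>i\<^sub>n\<^sub>i\<^sub>t + \<tau>\<^sub>m\<^sub>i\<^sub>n) / 2 * (M / \<zeta>)
          + (\<tau>\<^sub>i\<^sub>n\<^sub>i\<^sub>t - \<tau>\<^sub>m\<^sub>i\<^sub>n) / 2 * (2 * \<kappa>\<^sub>d * \<kappa>\<^sub>g * sqrt M + \<kappa>\<^sub>d * M + \<kappa>\<^sub>H * \<kappa>\<^sub>d\<^sup>2 * (\<kappa>\<^sub>g\<^sup>2 / 2 + M)))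
      + \<beta> * (V * (\<kappa>\<^sub>d * \<kappa>\<^sub>g\<^sup>2 * (1 + 1/2 * \<kappa>\<^sub>H * \<kappa>\<^sub>d))) * measure Q (overestimate k)
      + 0 + \<theta> * \<beta>\<^sup>2 * \<tau>\<^sub>i\<^sub>n\<^sub>i\<^sub>t * (\<kappa>\<^sub>g * \<kappa>\<^sub>d) * sqrt M
      + \<beta> * V * (\<kappa>\<^sub>g * \<kappa>\<^sub>d) * (M\<^sub>\<tau> * measure Q (decrease k))"
    unfolding has_bochner_integral_integral_eq[OF main] by (intro add_mono g h v order_refl)
  also have "\<dots> = \<beta>\<^sup>2 * (1/2 * U * ((\<tau>\<^sub>i\<^sub>n\<^sub>i\<^sub>t + \<tau>\<^sub>m\<^sub>i\<^sub>n) / 2 * (M / \<zeta>)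
          + (\<tau>\<^sub>i\<^sub>n\<^sub>i\<^sub>t - \<tau>\<^sub>m\<^sub>i\<^sub>n) / 2 * (2 * \<kappa>\<^sub>d * \<kappa>\<^sub>g * sqrt M + \<kappa>\<^sub>d * M + \<kappa>\<^sub>H * \<kappa>\<^sub>d\<^sup>2 * (\<kappa>\<^sub>g\<^sup>2 / 2 + M)))
        + \<theta> * \<tau>\<^sub>i\<^sub>n\<^sub>i\<^sub>t * (\<kappa>\<^sub>g * \<kappa>\<^sub>d) * sqrt M)
      + \<beta> * (V * (\<kappa>\<^sub>d * \<kappa>\<^sub>g\<^sup>2 * (1 + 1/2 * \<kappa>\<^sub>H * \<kappa>\<^sub>d))) * measure Q (overestimate k)
      + \<beta> * V * (\<kappa>\<^sub>g * \<kappa>\<^sub>d) * (M\<^sub>\<tau> * measure Q (decrease k))"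
    by (simp only: distrib_left mult_ac add_0_right add_ac)
  finally show "(\<integral>\<omega>. remainder k \<omega> \<partial>Q) \<le> \<dots>" .
qed

lemma expected_reduction_sum:
  "1/2 * Amin * \<beta> * (\<Sum>k\<le>k\<^sub>m\<^sub>a\<^sub>x. \<integral>\<omega>. q_red k \<omega> \<partial>Q) \<le>
    \<tau>\<^sub>i\<^sub>n\<^sub>i\<^sub>t * (f x\<^sub>0 - f\<^sub>l\<^sub>o\<^sub>w) + l1_norm (c x\<^sub>0)
    + (k\<^sub>m\<^sub>a\<^sub>x + 1) * \<beta>\<^sup>2 * (1/2 * U * ((\<tau>\<^sub>i\<^sub>n\<^sub>i\<^sub>t + \<tau>\<^sub>m\<^sub>i\<^sub>n) / 2 * (M / \<zeta>)
          + (\<tau>\<^sub>i\<^sub>n\<^sub>i\<^sub>t - \<tau>\<^sub>m\<^sub>i\<^sub>n) / 2 * (2 * \<kappa>\<^sub>d * \<kappa>\<^sub>g * sqrt M + \<kappa>\<^sub>d * M + \<kappa>\<^sub>H * \<kappa>\<^sub>d\<^sup>2 * (\<kappa>\<^sub>g\<^sup>2 / 2 + M)))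
        + \<theta> * \<tau>\<^sub>i\<^sub>n\<^sub>i\<^sub>t * (\<kappa>\<^sub>g * \<kappa>\<^sub>d) * sqrt M)
    + \<beta> * (V * (\<kappa>\<^sub>d * \<kappa>\<^sub>g\<^sup>2 * (1 + 1/2 * \<kappa>\<^sub>H * \<kappa>\<^sub>d))) * (s\<^sub>m\<^sub>a\<^sub>x / p\<^sub>\<tau>)
    + \<beta> * V * (\<kappa>\<^sub>g * \<kappa>\<^sub>d) * (M\<^sub>\<tau> * s\<^sub>m\<^sub>a\<^sub>x)"
proof -
  let ?C0 = "\<tau>\<^sub>i\<^sub>n\<^sub>i\<^sub>t * (f x\<^sub>0 - f\<^sub>l\<^sub>o\<^sub>w) + l1_norm (c x\<^sub>0)"
  define m where "m = 1/2 * U * ((\<tau>\<^sub>i\<^sub>n\<^sub>i\<^sub>t + \<tau>\<^sub>m\<^sub>i\<^sub>n) / 2 * (M / \<zeta>)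
          + (\<tau>\<^sub>i\<^sub>n\<^sub>i\<^sub>t - \<tau>\<^sub>m\<^sub>i\<^sub>n) / 2 * (2 * \<kappa>\<^sub>d * \<kappa>\<^sub>g * sqrt M + \<kappa>\<^sub>d * M + \<kappa>\<^sub>H * \<kappa>\<^sub>d\<^sup>2 * (\<kappa>\<^sub>g\<^sup>2 / 2 + M)))
        + \<theta> * \<tau>\<^sub>i\<^sub>n\<^sub>i\<^sub>t * (\<kappa>\<^sub>g * \<kappa>\<^sub>d) * sqrt M"
  define a where "a = \<beta> * (V * (\<kappa>\<^sub>d * \<kappa>\<^sub>g\<^sup>2 * (1 + 1/2 * \<kappa>\<^sub>H * \<kappa>\<^sub>d)))"
  define b where "b = \<beta> * V * (\<kappa>\<^sub>g * \<kappa>\<^sub>d) * M\<^sub>\<tau>"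
  have \<beta>: "0 < \<beta>" using inputs by auto
  have ab: "0 \<le> a" "0 \<le> b"
    using \<beta> constants_bounds(5) kappa_d(1) kappa_g(1) kappa_H_nonneg A3(2) by (auto simp: a_def b_def)
  have iR: "integrable Q (\<lambda>\<omega>. \<Sum>k\<le>k\<^sub>m\<^sub>a\<^sub>x. remainder k \<omega>)"
    using remainder_expectation(1) by (intro Bochner_Integration.integrable_sum) auto
  have iZ: "integrable Q (\<lambda>\<omega>. \<Sum>k\<le>k\<^sub>m\<^sub>a\<^sub>x. 1/2 * Amin * \<beta> * q_red k \<omega>)"
    using integrable_q_red(1) by (intro Bochner_Integration.integrable_sum integrable_mult_right) auto
  have "1/2 * Amin * \<beta> * (\<Sum>k\<le>k\<^sub>m\<^sub>a\<^sub>x. \<integral>\<omega>. q_red k \<omega> \<partial>Q)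
      = (\<integral>\<omega>. (\<Sum>k\<le>k\<^sub>m\<^sub>a\<^sub>x. 1/2 * Amin * \<beta> * q_red k \<omega>) \<partial>Q)"
    using integrable_q_red(1)
    by (subst Bochner_Integration.integral_sum) (auto simp: sum_distrib_left)
  also have "\<dots> \<le> (\<integral>\<omega>. ?C0 + (\<Sum>k\<le>k\<^sub>m\<^sub>a\<^sub>x. remainder k \<omega>) \<partial>Q)"
  proof (rule integral_mono_AE[OF iZ])
    show "integrable Q (\<lambda>\<omega>. ?C0 + (\<Sum>k\<le>k\<^sub>m\<^sub>a\<^sub>x. remainder k \<omega>))" using iR by auto
    show "AE \<omega> in Q. (\<Sum>k\<le>k\<^sub>m\<^sub>a\<^sub>x. 1/2 * Amin * \<beta> * q_red k \<omega>) \<le> ?C0 + (\<Sum>k\<le>k\<^sub>m\<^sub>a\<^sub>x. remainder k \<omega>)"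
      using AE_E
    proof eventually_elim
      case (elim \<omega>)
      have "(\<Sum>k\<le>k\<^sub>m\<^sub>a\<^sub>x. 1/2 * Amin * \<beta> * q_red k \<omega>)
          \<le> (\<Sum>k\<le>k\<^sub>m\<^sub>a\<^sub>x. (T k \<omega> * (f (X k \<omega>) - f (X (Suc k) \<omega>))
            + l1_norm (c (X k \<omega>)) - l1_norm (c (X (Suc k) \<omega>))) + remainder k \<omega>)"
        by (intro sum_mono q_red_le_remainder elim) auto
      then show ?case
        using merit_telescope[OF elim] unfolding sum.distrib[of _ "\<lambda>k. remainder k \<omega>"] by linarith
    qed
  qed
  also have "\<dots> = ?C0 + (\<Sum>k\<le>k\<^sub>m\<^sub>a\<^sub>x. \<integral>\<omega>. remainder k \<omega> \<partial>Q)"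
    using iR remainder_expectation(1) Q.prob_space by (simp add: Bochner_Integration.integral_sum)
  also have "\<dots> \<le> ?C0 + (\<Sum>k\<le>k\<^sub>m\<^sub>a\<^sub>x. \<beta>\<^sup>2 * m + a * measure Q (overestimate k) + b * measure Q (decrease k))"
    using remainder_expectation(2) unfolding m_def a_def b_def
    by (intro add_left_mono sum_mono) (auto simp: mult.assoc)
  also have "\<dots> = ?C0 + ((k\<^sub>m\<^sub>a\<^sub>x + 1) * \<beta>\<^sup>2 * m + a * (\<Sum>k\<le>k\<^sub>m\<^sub>a\<^sub>x. measure Q (overestimate k))
      + b * (\<Sum>k\<le>k\<^sub>m\<^sub>a\<^sub>x. measure Q (decrease k)))"
    by (simp add: sum.distrib sum_distrib_left)
  also have "\<dots> \<le> ?C0 + ((k\<^sub>m\<^sub>a\<^sub>x + 1) * \<beta>\<^sup>2 * m + a * (s\<^sub>m\<^sub>a\<^sub>x / p\<^sub>\<tau>) + b * s\<^sub>m\<^sub>a\<^sub>x)"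
  proof (intro add_left_mono add_mono mult_left_mono ab expected_decreases order_refl)
    have p: "p\<^sub>\<tau> > 0" using A4(1) by auto
    \<comment> \<open>Overestimates are charged to decreases, at the expected rate of at least
      \<open>p\<^sub>\<tau>\<close> decreases for each of them.\<close>
    have "p\<^sub>\<tau> * (\<Sum>k\<le>k\<^sub>m\<^sub>a\<^sub>x. measure Q (overestimate k)) \<le> (\<Sum>k\<le>k\<^sub>m\<^sub>a\<^sub>x. measure Q (decrease k))"
      unfolding sum_distrib_left by (intro sum_mono overestimate_prob) simp
    then show "(\<Sum>k\<le>k\<^sub>m\<^sub>a\<^sub>x. measure Q (overestimate k)) \<le> s\<^sub>m\<^sub>a\<^sub>x / p\<^sub>\<tau>"
      using expected_decreases p by (simp add: field_simps)
  qed
  finally show ?thesis by (simp add: m_def a_def b_def mult.assoc add.assoc)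
qed

end

end

section \<open>From the summed bound to the stated constants\<close>

lemma ell_ge:
  assumes "0 < \<delta>" "\<delta> \<le> 1"
  shows "real s \<le> ell s \<delta>"
proof -
  have "0 \<le> ln (1 / \<delta>)" using assms by simp
  then show ?thesis by (simp add: ell_def)
qed

lemma average_bound:
  fixes A \<gamma> K S :: real
  assumes pos: "K > 0" "A > 0" "\<gamma> > 0" and \<beta>: "\<beta> = \<gamma> / sqrt K"
    and S: "1/2 * A * \<beta> * S \<le> C + K * \<beta>\<^sup>2 * m + \<beta> * q1 * t + \<beta> * e * s"
    and le: "m \<le> m'" "t \<le> t'" "s \<le> s'" and nonneg: "0 \<le> q1" "0 \<le> q2" "0 \<le> e" "0 \<le> t'"
  shows "S / K \<le> 2 * ((C + m' * \<gamma>\<^sup>2 + e * \<gamma> * s' / sqrt K) / (A * \<gamma> * sqrt K))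
      + 2 * (q1 * \<gamma> + q2 * \<gamma>\<^sup>2 / sqrt K) / (A * \<gamma> * K) * t'"
proof -
  define r where "r = sqrt K"
  have r: "r > 0" "K = r * r" using pos by (simp_all add: r_def)
  have \<beta>0: "0 \<le> \<beta>" using pos by (simp add: \<beta>)
  define R where "R = C + m' * \<gamma>\<^sup>2 + e * \<gamma> * s' / r + q1 * \<gamma> * t' / r"
  have "R = C + \<gamma>\<^sup>2 * m' + \<beta> * q1 * t' + \<beta> * e * s'"
    by (simp add: R_def \<beta> r_def[symmetric] mult_ac)
  \<comment> \<open>This is the reason for \<open>\<beta> = \<gamma> / sqrt K\<close>: the
    accumulated second-order errors stay bounded in \<open>K\<close>, while dividing by
    \<open>\<beta> * K\<close> still gains a factor \<open>sqrt K\<close>.\<close>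
  moreover have "K * \<beta>\<^sup>2 * m = \<gamma>\<^sup>2 * m"
    using r by (simp add: \<beta> r_def[symmetric] power_divide power2_eq_square)
  moreover have "\<gamma>\<^sup>2 * m \<le> \<gamma>\<^sup>2 * m'" using le by (intro mult_left_mono) auto
  moreover have "\<beta> * q1 * t \<le> \<beta> * q1 * t'" "\<beta> * e * s \<le> \<beta> * e * s'"
    using le nonneg \<beta>0 by (auto intro!: mult_left_mono)
  ultimately have "1/2 * A * \<beta> * S \<le> R"
    using S by linarith
  then have "A * \<gamma> * S \<le> 2 * R * r"
    using r by (simp add: \<beta> r_def[symmetric] field_simps)
  then have "S \<le> 2 * R * r / (A * \<gamma>)"
    using pos by (simp add: field_simps)
  then have "S / K \<le> 2 * R * r / (A * \<gamma>) / K"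
    using pos by (intro divide_right_mono) auto
  also have "\<dots> = 2 * R / (A * \<gamma> * r)"
    using pos r by (simp add: field_simps)
  also have "\<dots> = 2 * ((C + m' * \<gamma>\<^sup>2 + e * \<gamma> * s' / r) / (A * \<gamma> * r)) + 2 * (q1 * \<gamma>) / (A * \<gamma> * K) * t'"
    using pos r by (simp add: R_def field_simps)
  also have "\<dots> \<le> 2 * ((C + m' * \<gamma>\<^sup>2 + e * \<gamma> * s' / r) / (A * \<gamma> * r))
      + 2 * (q1 * \<gamma> + q2 * \<gamma>\<^sup>2 / r) / (A * \<gamma> * K) * t'"
    using pos r nonneg
    by (intro add_left_mono mult_right_mono divide_right_mono mult_left_mono) auto
  finally show ?thesis by (simp add: r_def)
qed

theorem theorem2:
  fixes P :: "'a measure" and N :: "'w measure"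
    and F :: "real^'n \<Rightarrow> 'w \<Rightarrow> real" and f :: "real^'n \<Rightarrow> real" and gradf :: "real^'n \<Rightarrow> real^'n"
    and c :: "real^'n \<Rightarrow> real^'m" and J :: "real^'n \<Rightarrow> real^'n^'m"
    and \<X> :: "(real^'n) set" and f\<^sub>l\<^sub>o\<^sub>w L \<Gamma> \<kappa>\<^sub>g \<kappa>\<^sub>H \<zeta> \<kappa>\<^sub>d :: real and \<gamma>\<^sub>c :: "'m \<Rightarrow> real"
    and x\<^sub>0 :: "real^'n" and k\<^sub>m\<^sub>a\<^sub>x :: nat and \<tau>\<^sub>i\<^sub>n\<^sub>i\<^sub>t \<epsilon>\<^sub>\<tau> \<epsilon>\<^sub>\<xi> \<sigma> \<xi>\<^sub>i\<^sub>n\<^sub>i\<^sub>t \<theta> :: real and \<beta>s :: "nat \<Rightarrow> real"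
    and G X D Dtrue :: "nat \<Rightarrow> 'a \<Rightarrow> real^'n" and H :: "nat \<Rightarrow> 'a \<Rightarrow> real^'n^'n"
    and Y Ytrue :: "nat \<Rightarrow> 'a \<Rightarrow> real^'m" and T \<Xi> \<A> :: "nat \<Rightarrow> 'a \<Rightarrow> real"
    and Ttt :: "nat \<Rightarrow> 'a \<Rightarrow> ereal" and That :: "nat \<Rightarrow> 'a \<Rightarrow> real" and K :: "'a \<Rightarrow> nat"
    and s\<^sub>m\<^sub>a\<^sub>x :: nat and \<tau>\<^sub>m\<^sub>i\<^sub>n \<xi>\<^sub>m\<^sub>i\<^sub>n :: real and E :: "'a set" and M M\<^sub>\<tau> p\<^sub>\<tau> :: real
    and A\<^sub>m\<^sub>i\<^sub>n A\<^sub>m\<^sub>a\<^sub>x \<gamma> \<beta> Mbar \<kappa>\<^sub>E\<^sub>3 \<kappa>\<^sub>q\<^sub>1 \<kappa>\<^sub>q\<^sub>2 \<delta> \<delta>hat :: real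
  assumes "prob_space P" and dims: "CARD('m) \<le> CARD('n)"
    and objective: "prob_space N" "\<And>x. integrable N (F x)" "\<And>x. f x = (\<integral>w. F x w \<partial>N)"
    \<comment> \<open>algorithm inputs\<close>
    and inputs: "\<tau>\<^sub>i\<^sub>n\<^sub>i\<^sub>t > 0" "\<epsilon>\<^sub>\<tau> \<in> {0<..<1}" "\<epsilon>\<^sub>\<xi> \<in> {0<..<1}" "\<sigma> \<in> {0<..<1}" "\<xi>\<^sub>i\<^sub>n\<^sub>i\<^sub>t > 0"
      "\<And>k. k \<le> k\<^sub>m\<^sub>a\<^sub>x \<Longrightarrow> \<beta>s k \<in> {0<..1}" "\<theta> \<ge> 0" "L > 0" "\<And>i. \<gamma>\<^sub>c i > 0"
      "\<Gamma> \<ge> (\<Sum>i\<in>UNIV. \<gamma>\<^sub>c i)"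
    \<comment> \<open>the stochastic process generated by the algorithm\<close>
    and G_rv: "\<And>k. k \<le> k\<^sub>m\<^sub>a\<^sub>x \<Longrightarrow> G k \<in> borel_measurable P"
    and run: "\<And>\<omega>. \<omega> \<in> space P \<Longrightarrow> X 0 \<omega> = x\<^sub>0"
      "\<And>\<omega> k. \<omega> \<in> space P \<Longrightarrow> k \<le> k\<^sub>m\<^sub>a\<^sub>x \<Longrightarrow>
        sqp_iteration c J \<epsilon>\<^sub>\<tau> \<epsilon>\<^sub>\<xi> \<sigma> \<theta> L \<Gamma> (\<beta>s k)
          (H k \<omega>) (G k \<omega>) (X k \<omega>) (prev \<tau>\<^sub>i\<^sub>n\<^sub>i\<^sub>t T k \<omega>) (prev \<xi>\<^sub>i\<^sub>n\<^sub>i\<^sub>t \<Xi> k \<omega>)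
          (D k \<omega>) (Y k \<omega>) (T k \<omega>) (\<Xi> k \<omega>) (\<A> k \<omega>) (X (Suc k) \<omega>)"
    and true_step: "\<And>\<omega> k. \<omega> \<in> space P \<Longrightarrow> k \<le> k\<^sub>m\<^sub>a\<^sub>x \<Longrightarrow>
        kkt_solution (H k \<omega>) (J (X k \<omega>)) (gradf (X k \<omega>)) (c (X k \<omega>)) (Dtrue k \<omega>) (Ytrue k \<omega>)"
    and Ttt: "\<And>k \<omega>. Ttt k \<omega> = tau_trial \<sigma> c (X k \<omega>) (gradf (X k \<omega>)) (H k \<omega>) (Dtrue k \<omega>)"
    and That: "\<And>k \<omega>. That k \<omega> = real_of_ereal (min (ereal (T k \<omega>)) (Ttt k \<omega>))"
    \<comment> \<open>the lower projection bound of the step-size rule does not exceed the unit step\<close>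
    and lower_end: "\<And>\<omega> k. \<omega> \<in> E \<Longrightarrow> k \<le> k\<^sub>m\<^sub>a\<^sub>x \<Longrightarrow>
        \<beta>s k * \<Xi> k \<omega> * T k \<omega> / (T k \<omega> * L + \<Gamma>) \<le> 1"
    \<comment> \<open>(A1)\<close>
    and A1: "open \<X>" "convex \<X>" "\<And>\<omega> k. \<omega> \<in> space P \<Longrightarrow> k \<le> Suc k\<^sub>m\<^sub>a\<^sub>x \<Longrightarrow> X k \<omega> \<in> \<X>"
      "\<And>x. x \<in> \<X> \<Longrightarrow> GDERIV f x :> gradf x" "\<And>x. x \<in> \<X> \<Longrightarrow> f\<^sub>l\<^sub>o\<^sub>w \<le> f x"
      "bounded (gradf ` \<X>)" "L-lipschitz_on \<X> gradf"
      "\<And>x. x \<in> \<X> \<Longrightarrow> (c has_derivative (\<lambda>h. J x *v h)) (at x)"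
      "bounded (c ` \<X>)" "bounded (J ` \<X>)" "\<And>i. (\<gamma>\<^sub>c i)-lipschitz_on \<X> (\<lambda>x. J x $ i)"
      "\<exists>s\<^sub>0>0. \<forall>x\<in>\<X>. \<forall>s. singular_value (J x) s \<longrightarrow> s\<^sub>0 \<le> s"
    and kappa_g: "\<kappa>\<^sub>g > 0" "\<And>\<omega> k. \<omega> \<in> space P \<Longrightarrow> k \<le> k\<^sub>m\<^sub>a\<^sub>x \<Longrightarrow> norm (gradf (X k \<omega>)) \<le> \<kappa>\<^sub>g"
    \<comment> \<open>(A2)\<close>
    and A2: "\<And>k. k \<le> k\<^sub>m\<^sub>a\<^sub>x \<Longrightarrow> H k \<in> borel_measurable (past P G k)"
      "\<And>\<omega> k. \<omega> \<in> space P \<Longrightarrow> k \<le> k\<^sub>m\<^sub>a\<^sub>x \<Longrightarrow> transpose (H k \<omega>) = H k \<omega>"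
      "\<And>\<omega> k. \<omega> \<in> space P \<Longrightarrow> k \<le> k\<^sub>m\<^sub>a\<^sub>x \<Longrightarrow> onorm ((*v) (H k \<omega>)) \<le> \<kappa>\<^sub>H"
      "\<zeta> > 0"
      "\<And>\<omega> k u. \<omega> \<in> space P \<Longrightarrow> k \<le> k\<^sub>m\<^sub>a\<^sub>x \<Longrightarrow> J (X k \<omega>) *v u = 0 \<Longrightarrow>
        u \<bullet> (H k \<omega> *v u) \<ge> \<zeta> * (norm u)\<^sup>2"
    \<comment> \<open>the event E\<close>
    and E_params: "s\<^sub>m\<^sub>a\<^sub>x \<ge> 1" "\<tau>\<^sub>m\<^sub>i\<^sub>n > 0" "\<xi>\<^sub>m\<^sub>i\<^sub>n > 0"
    and E: "E = {\<omega>\<in>space P.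
        (\<forall>k\<le>k\<^sub>m\<^sub>a\<^sub>x. T k \<omega> \<ge> \<tau>\<^sub>m\<^sub>i\<^sub>n \<and> Ttt k \<omega> \<ge> ereal \<tau>\<^sub>m\<^sub>i\<^sub>n \<and> \<Xi> k \<omega> = \<xi>\<^sub>m\<^sub>i\<^sub>n) \<and>
        card {k. k \<le> k\<^sub>m\<^sub>a\<^sub>x \<and> T k \<omega> < prev \<tau>\<^sub>i\<^sub>n\<^sub>i\<^sub>t T k \<omega>} \<le> s\<^sub>m\<^sub>a\<^sub>x}"
    and E_pos: "measure P E > 0"
    \<comment> \<open>(A3)\<close>
    and A3: "M > 0" "M\<^sub>\<tau> > 0"
      "\<And>k i. k \<le> k\<^sub>m\<^sub>a\<^sub>x \<Longrightarrow> AE \<omega> in uniform_measure P E.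
        cexp_past P E G k (\<lambda>\<omega>. G k \<omega> $ i) \<omega> = gradf (X k \<omega>) $ i"
      "\<And>k. k \<le> k\<^sub>m\<^sub>a\<^sub>x \<Longrightarrow> AE \<omega> in uniform_measure P E.
        nn_cond_exp (uniform_measure P E) (past P G k)
          (\<lambda>\<omega>. ennreal ((norm (G k \<omega> - gradf (X k \<omega>)))\<^sup>2)) \<omega> \<le> ennreal M"
      "\<And>k B. k \<le> k\<^sub>m\<^sub>a\<^sub>x \<Longrightarrow>
        B = {\<omega>\<in>space P. gradf (X k \<omega>) \<bullet> (D k \<omega> - Dtrue k \<omega>) < 0 \<and> T k \<omega> < prev \<tau>\<^sub>i\<^sub>n\<^sub>i\<^sub>t T k \<omega>} \<Longrightarrow>
        AE \<omega> in uniform_measure P E.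
          cprob_past P E G k B \<omega> = 0 \<or>
          cexp_past_given P E G k B (\<lambda>\<omega>. norm (G k \<omega> - gradf (X k \<omega>))) \<omega> \<le> M\<^sub>\<tau>"
    \<comment> \<open>(A4)\<close>
    and A4: "p\<^sub>\<tau> \<in> {0<..1}"
      "\<And>k. k \<le> k\<^sub>m\<^sub>a\<^sub>x \<Longrightarrow> AE \<omega> in uniform_measure P E.
        cprob_past P E G k {\<omega>\<in>space P.
          G k \<omega> \<bullet> D k \<omega> + max (D k \<omega> \<bullet> (H k \<omega> *v D k \<omega>)) 0
          \<ge> gradf (X k \<omega>) \<bullet> Dtrue k \<omega> + max (Dtrue k \<omega> \<bullet> (H k \<omega> *v Dtrue k \<omega>)) 0} \<omega> \<ge> p\<^sub>\<tau>"
    and kappa_d: "\<kappa>\<^sub>d > 0"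
      "\<And>\<omega> k. \<omega> \<in> space P \<Longrightarrow> k \<le> k\<^sub>m\<^sub>a\<^sub>x \<Longrightarrow> norm (Dtrue k \<omega>) \<le> \<kappa>\<^sub>d * norm (gradf (X k \<omega>))"
      "\<And>\<omega> k. \<omega> \<in> space P \<Longrightarrow> k \<le> k\<^sub>m\<^sub>a\<^sub>x \<Longrightarrow>
        norm (D k \<omega> - Dtrue k \<omega>) \<le> \<kappa>\<^sub>d * norm (G k \<omega> - gradf (X k \<omega>))"
    \<comment> \<open>the constants of the bound\<close>
    and Amin: "A\<^sub>m\<^sub>i\<^sub>n = \<xi>\<^sub>m\<^sub>i\<^sub>n * \<tau>\<^sub>m\<^sub>i\<^sub>n / (\<tau>\<^sub>m\<^sub>i\<^sub>n * L + \<Gamma>)"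
    and Amax: "A\<^sub>m\<^sub>a\<^sub>x = \<xi>\<^sub>i\<^sub>n\<^sub>i\<^sub>t * \<tau>\<^sub>i\<^sub>n\<^sub>i\<^sub>t / (\<tau>\<^sub>i\<^sub>n\<^sub>i\<^sub>t * L + \<Gamma>)"
    and gamma: "\<gamma> \<in> {0<..A\<^sub>m\<^sub>i\<^sub>n / (A\<^sub>m\<^sub>a\<^sub>x + \<theta>)}"
    and beta: "\<beta> = \<gamma> / sqrt (real k\<^sub>m\<^sub>a\<^sub>x + 1)" "\<And>k. k \<le> k\<^sub>m\<^sub>a\<^sub>x \<Longrightarrow> \<beta>s k = \<beta>"
    and Mbar: "Mbar = 1/4 * (A\<^sub>m\<^sub>a\<^sub>x + \<theta> * \<beta>) * (\<tau>\<^sub>i\<^sub>n\<^sub>i\<^sub>t + \<tau>\<^sub>m\<^sub>i\<^sub>n) * inverse \<zeta> * M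
        + 1/2 * (A\<^sub>m\<^sub>a\<^sub>x + \<theta> * \<beta>) * (\<tau>\<^sub>i\<^sub>n\<^sub>i\<^sub>t - \<tau>\<^sub>m\<^sub>i\<^sub>n) *
            (\<kappa>\<^sub>d * sqrt M * (2 * \<kappa>\<^sub>g + sqrt M) + \<kappa>\<^sub>H * \<kappa>\<^sub>d\<^sup>2 * (M + 3/2 * \<kappa>\<^sub>g\<^sup>2))
        + \<theta> * \<tau>\<^sub>i\<^sub>n\<^sub>i\<^sub>t * \<kappa>\<^sub>g * \<kappa>\<^sub>d * sqrt M"
    and kE3: "\<kappa>\<^sub>E\<^sub>3 = ((A\<^sub>m\<^sub>a\<^sub>x + \<theta> * \<beta>) * \<tau>\<^sub>i\<^sub>n\<^sub>i\<^sub>t - A\<^sub>m\<^sub>i\<^sub>n * \<tau>\<^sub>m\<^sub>i\<^sub>n) * \<kappa>\<^sub>g * \<kappa>\<^sub>d * M\<^sub>\<tau>"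
    and kq1: "\<kappa>\<^sub>q\<^sub>1 = ((A\<^sub>m\<^sub>a\<^sub>x + \<theta> * \<beta>) * \<tau>\<^sub>i\<^sub>n\<^sub>i\<^sub>t - A\<^sub>m\<^sub>i\<^sub>n * \<tau>\<^sub>m\<^sub>i\<^sub>n) * \<kappa>\<^sub>d * \<kappa>\<^sub>g\<^sup>2 * (1 + 1/2 * \<kappa>\<^sub>H * \<kappa>\<^sub>d)"
    and kq2: "\<kappa>\<^sub>q\<^sub>2 = ((A\<^sub>m\<^sub>a\<^sub>x + \<theta> * \<beta>) * \<tau>\<^sub>i\<^sub>n\<^sub>i\<^sub>t - A\<^sub>m\<^sub>i\<^sub>n * \<tau>\<^sub>m\<^sub>i\<^sub>n) * \<kappa>\<^sub>d * (1 + 1/2 * \<kappa>\<^sub>H * \<kappa>\<^sub>d)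
        * (M + \<kappa>\<^sub>g\<^sup>2)"
    \<comment> \<open>the random output index, independent of everything else\<close>
    and K_rv: "K \<in> measurable P (count_space UNIV)"
    and K_distr: "distr P (count_space UNIV) K = measure_pmf (pmf_of_set {0..k\<^sub>m\<^sub>a\<^sub>x})"
    and K_indep: "prob_space.indep_set P
        (sets (vimage_algebra (space P) K (count_space UNIV))) (sets (past P G (Suc k\<^sub>m\<^sub>a\<^sub>x)))"
    and delta: "\<delta> \<in> {0<..<1}"
      "\<delta>hat = \<delta> / (\<Sum>j=0..max (s\<^sub>m\<^sub>a\<^sub>x - 1) 0. real (k\<^sub>m\<^sub>a\<^sub>x choose j))"
  shows "measure P {\<omega>\<in>space P.
      (\<integral>\<omega>'. delta_q c (X (K \<omega>') \<omega>') (That (K \<omega>') \<omega>') (gradf (X (K \<omega>') \<omega>'))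
          (H (K \<omega>') \<omega>') (Dtrue (K \<omega>') \<omega>') \<partial>uniform_measure P E)
      \<le> 2 * ((\<tau>\<^sub>i\<^sub>n\<^sub>i\<^sub>t * (f x\<^sub>0 - f\<^sub>l\<^sub>o\<^sub>w) + l1_norm (c x\<^sub>0) + Mbar * \<gamma>\<^sup>2
              + \<kappa>\<^sub>E\<^sub>3 * \<gamma> * (ell s\<^sub>m\<^sub>a\<^sub>x (\<delta>hat / 2) + 1) / sqrt (real k\<^sub>m\<^sub>a\<^sub>x + 1))
            / (A\<^sub>m\<^sub>i\<^sub>n * \<gamma> * sqrt (real k\<^sub>m\<^sub>a\<^sub>x + 1)))
        + 2 * (\<kappa>\<^sub>q\<^sub>1 * \<gamma> + \<kappa>\<^sub>q\<^sub>2 * \<gamma>\<^sup>2 / sqrt (real k\<^sub>m\<^sub>a\<^sub>x + 1))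
            / (A\<^sub>m\<^sub>i\<^sub>n * \<gamma> * (real k\<^sub>m\<^sub>a\<^sub>x + 1))
          * real_of_int \<lceil>(ell s\<^sub>m\<^sub>a\<^sub>x (\<delta>hat / 2) + 1) / p\<^sub>\<tau>\<rceil>} \<ge> 1 - \<delta>"
proof -
  interpret prob_space P by fact
  have \<beta>01: "\<beta> \<in> {0<..1}" using inputs(6)[of 0] beta(2)[of 0] by simp
  have run': "sqp_iteration c J \<epsilon>\<^sub>\<tau> \<epsilon>\<^sub>\<xi> \<sigma> \<theta> L \<Gamma> \<beta>
          (H k \<omega>) (G k \<omega>) (X k \<omega>) (prev \<tau>\<^sub>i\<^sub>n\<^sub>i\<^sub>t T k \<omega>) (prev \<xi>\<^sub>i\<^sub>n\<^sub>i\<^sub>t \<Xi> k \<omega>)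
          (D k \<omega>) (Y k \<omega>) (T k \<omega>) (\<Xi> k \<omega>) (\<A> k \<omega>) (X (Suc k) \<omega>)"
    if "\<omega> \<in> space P" "k \<le> k\<^sub>m\<^sub>a\<^sub>x" for \<omega> k
    using run(2)[OF that] beta(2)[OF that(2)] by simp
  have lower_end': "\<beta> * \<Xi> k \<omega> * T k \<omega> / (T k \<omega> * L + \<Gamma>) \<le> 1" if "\<omega> \<in> E" "k \<le> k\<^sub>m\<^sub>a\<^sub>x" for \<omega> k
    using lower_end[OF that] beta(2)[OF that(2)] by simp
  interpret S: stochastic_sqp P f gradf c J \<X> f\<^sub>l\<^sub>o\<^sub>w L \<Gamma> \<kappa>\<^sub>g \<kappa>\<^sub>H \<zeta> \<kappa>\<^sub>d \<gamma>\<^sub>c x\<^sub>0 k\<^sub>m\<^sub>a\<^sub>x \<tau>\<^sub>i\<^sub>n\<^sub>i\<^sub>t \<epsilon>\<^sub>\<tau> \<epsilon>\<^sub>\<xi> \<sigma> \<xi>\<^sub>i\<^sub>n\<^sub>i\<^sub>t \<theta> \<beta>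
      G X D Dtrue H Y Ytrue T \<Xi> \<A> Ttt That s\<^sub>m\<^sub>a\<^sub>x \<tau>\<^sub>m\<^sub>i\<^sub>n \<xi>\<^sub>m\<^sub>i\<^sub>n E M M\<^sub>\<tau> p\<^sub>\<tau>
    by unfold_locales (fact \<beta>01 run' lower_end' | fact)+
  define U where "U = A\<^sub>m\<^sub>a\<^sub>x + \<theta> * \<beta>"
  define V where "V = U * \<tau>\<^sub>i\<^sub>n\<^sub>i\<^sub>t - A\<^sub>m\<^sub>i\<^sub>n * \<tau>\<^sub>m\<^sub>i\<^sub>n"
  have Amax_pos: "A\<^sub>m\<^sub>a\<^sub>x > 0" unfolding Amax
    using inputs S.Gamma_pos by (intro divide_pos_pos mult_pos_pos add_pos_pos) auto
  \<comment> \<open>The admissible range of \<open>\<gamma>\<close> is used here: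
    \<open>\<beta> \<le> \<gamma>\<close> because the square root is at least 1, and
    \<open>U \<le> A\<^sub>m\<^sub>a\<^sub>x + \<theta>\<close> because
    \<open>\<beta> \<le> 1\<close>.\<close>
  have \<beta>U: "\<beta> * U \<le> A\<^sub>m\<^sub>i\<^sub>n"
  proof -
    have "\<gamma> / sqrt (real k\<^sub>m\<^sub>a\<^sub>x + 1) \<le> \<gamma> / 1"
      using gamma by (intro divide_left_mono) auto
    then have "\<beta> \<le> \<gamma>" by (simp add: beta(1))
    moreover have "U \<le> A\<^sub>m\<^sub>a\<^sub>x + \<theta>"
      using \<beta>01 inputs(7) mult_left_mono[of \<beta> 1 \<theta>] by (simp add: U_def)
    moreover have "0 \<le> U" using Amax_pos inputs(7) \<beta>01 by (simp add: U_def)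
    ultimately have "\<beta> * U \<le> \<gamma> * (A\<^sub>m\<^sub>a\<^sub>x + \<theta>)"
      using gamma by (intro mult_mono) auto
    also have "\<dots> \<le> A\<^sub>m\<^sub>i\<^sub>n"
      using gamma Amax_pos inputs(7) by (simp add: pos_le_divide_eq)
    finally show ?thesis .
  qed
  note cb = S.constants_bounds[OF Amin Amax U_def \<beta>U V_def]
  note sum_bound = S.expected_reduction_sum[OF Amin Amax U_def \<beta>U V_def]
  define m where "m = 1/2 * U * ((\<tau>\<^sub>i\<^sub>n\<^sub>i\<^sub>t + \<tau>\<^sub>m\<^sub>i\<^sub>n) / 2 * (M / \<zeta>)
          + (\<tau>\<^sub>i\<^sub>n\<^sub>i\<^sub>t - \<tau>\<^sub>m\<^sub>i\<^sub>n) / 2 * (2 * \<kappa>\<^sub>d * \<kappa>\<^sub>g * sqrt M + \<kappa>\<^sub>d * M + \<kappa>\<^sub>H * \<kappa>\<^sub>d\<^sup>2 * (\<kappa>\<^sub>g\<^sup>2 / 2 + M)))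
        + \<theta> * \<tau>\<^sub>i\<^sub>n\<^sub>i\<^sub>t * (\<kappa>\<^sub>g * \<kappa>\<^sub>d) * sqrt M"
  have mM: "m \<le> Mbar"
  proof -
    define B B' where "B = 2 * \<kappa>\<^sub>d * \<kappa>\<^sub>g * sqrt M + \<kappa>\<^sub>d * M + \<kappa>\<^sub>H * \<kappa>\<^sub>d\<^sup>2 * (\<kappa>\<^sub>g\<^sup>2 / 2 + M)"
      and "B' = \<kappa>\<^sub>d * sqrt M * (2 * \<kappa>\<^sub>g + sqrt M) + \<kappa>\<^sub>H * \<kappa>\<^sub>d\<^sup>2 * (M + 3/2 * \<kappa>\<^sub>g\<^sup>2)"
    have nn: "0 \<le> \<kappa>\<^sub>H * \<kappa>\<^sub>d\<^sup>2" using S.kappa_H_nonneg by simp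
    have "\<kappa>\<^sub>H * \<kappa>\<^sub>d\<^sup>2 * (\<kappa>\<^sub>g\<^sup>2 / 2 + M) \<le> \<kappa>\<^sub>H * \<kappa>\<^sub>d\<^sup>2 * (M + 3/2 * \<kappa>\<^sub>g\<^sup>2)"
      by (intro mult_left_mono nn) auto
    moreover have "\<kappa>\<^sub>d * sqrt M * (2 * \<kappa>\<^sub>g + sqrt M) = 2 * \<kappa>\<^sub>d * \<kappa>\<^sub>g * sqrt M + \<kappa>\<^sub>d * M"
      using A3(1) by (simp add: distrib_left mult.assoc)
    ultimately have BB: "B \<le> B'" by (simp add: B_def B'_def)
    have "0 \<le> B"
      using nn kappa_d(1) kappa_g(1) A3(1) S.kappa_H_nonneg unfolding B_def
      by (intro add_nonneg_nonneg mult_nonneg_nonneg) auto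
    \<comment> \<open>\<open>Mbar\<close> carries the factor 1/2 where \<open>m\<close> carries 1/4,
      which allows twice \<open>B'\<close>; nonnegativity of \<open>B\<close> makes this weaker
      comparison valid.\<close>
    then have B: "B \<le> 2 * B'" using BB by linarith
    have UV: "0 \<le> U * (\<tau>\<^sub>i\<^sub>n\<^sub>i\<^sub>t - \<tau>\<^sub>m\<^sub>i\<^sub>n)" using cb by (intro mult_nonneg_nonneg) auto
    have "m = 1/4 * U * (\<tau>\<^sub>i\<^sub>n\<^sub>i\<^sub>t + \<tau>\<^sub>m\<^sub>i\<^sub>n) * inverse \<zeta> * M + 1/4 * (U * (\<tau>\<^sub>i\<^sub>n\<^sub>i\<^sub>t - \<tau>\<^sub>m\<^sub>i\<^sub>n)) * B
        + \<theta> * \<tau>\<^sub>i\<^sub>n\<^sub>i\<^sub>t * \<kappa>\<^sub>g * \<kappa>\<^sub>d * sqrt M"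
    proof -
      define z where "z = inverse \<zeta> * M"
      have "M / \<zeta> = z" by (simp add: z_def divide_inverse)
      then show ?thesis
        unfolding m_def B_def[symmetric] mult.assoc[of _ "inverse \<zeta>" M] z_def[symmetric]
        by (simp add: field_simps)
    qed
    moreover have "1/4 * (U * (\<tau>\<^sub>i\<^sub>n\<^sub>i\<^sub>t - \<tau>\<^sub>m\<^sub>i\<^sub>n)) * B \<le> 1/2 * U * (\<tau>\<^sub>i\<^sub>n\<^sub>i\<^sub>t - \<tau>\<^sub>m\<^sub>i\<^sub>n) * B'"
      using mult_left_mono[OF B UV] by (simp add: algebra_simps)
    ultimately show ?thesis
      unfolding Mbar U_def[symmetric] B'_def[symmetric] by linarith
  qed
  define l where "l = ell s\<^sub>m\<^sub>a\<^sub>x (\<delta>hat / 2) + 1"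
  have sl: "real s\<^sub>m\<^sub>a\<^sub>x \<le> l"
  proof -
    \<comment> \<open>The term \<open>j = 0\<close> alone contributes 1, hence
      \<open>\<delta>hat \<le> \<delta> < 1\<close>, the logarithm in \<open>ell\<close> is
      nonnegative and \<open>ell\<close> is at least
      \<open>s\<^sub>m\<^sub>a\<^sub>x\<close>.\<close>
    have "real (k\<^sub>m\<^sub>a\<^sub>x choose 0) \<le> (\<Sum>j=0..max (s\<^sub>m\<^sub>a\<^sub>x - 1) 0. real (k\<^sub>m\<^sub>a\<^sub>x choose j))"
      by (rule member_le_sum) auto
    then have one: "1 \<le> (\<Sum>j=0..max (s\<^sub>m\<^sub>a\<^sub>x - 1) 0. real (k\<^sub>m\<^sub>a\<^sub>x choose j))" by simp
    then have "0 < \<delta>hat" "\<delta>hat \<le> \<delta>"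
      using delta(1) by (auto simp: delta(2) divide_le_eq intro!: divide_pos_pos)
    then show ?thesis
      using ell_ge[of "\<delta>hat / 2" s\<^sub>m\<^sub>a\<^sub>x] delta(1) by (simp add: l_def)
  qed
  define t where "t = real_of_int \<lceil>l / p\<^sub>\<tau>\<rceil>"
  have p: "0 < p\<^sub>\<tau>" using A4(1) by simp
  have st: "real s\<^sub>m\<^sub>a\<^sub>x / p\<^sub>\<tau> \<le> t"
  proof -
    have "real s\<^sub>m\<^sub>a\<^sub>x / p\<^sub>\<tau> \<le> l / p\<^sub>\<tau>" using sl p by (intro divide_right_mono) auto
    also have "\<dots> \<le> t" unfolding t_def by (rule le_of_int_ceiling)
    finally show ?thesis .
  qed
  have t0: "0 \<le> t" using st p by (meson divide_nonneg_pos of_nat_0_le_iff order_trans)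
  define \<kappa> where "\<kappa> = \<kappa>\<^sub>d * \<kappa>\<^sub>g\<^sup>2 * (1 + 1/2 * \<kappa>\<^sub>H * \<kappa>\<^sub>d)"
  have q1: "\<kappa>\<^sub>q\<^sub>1 = V * \<kappa>" by (simp add: kq1 V_def U_def \<kappa>_def)
  have e3: "\<kappa>\<^sub>E\<^sub>3 = V * (\<kappa>\<^sub>g * \<kappa>\<^sub>d) * M\<^sub>\<tau>" by (simp add: kE3 V_def U_def)
  have q2: "\<kappa>\<^sub>q\<^sub>2 = V * \<kappa>\<^sub>d * (1 + 1/2 * \<kappa>\<^sub>H * \<kappa>\<^sub>d) * (M + \<kappa>\<^sub>g\<^sup>2)" by (simp add: kq2 V_def U_def)
  have nonneg: "0 \<le> \<kappa>\<^sub>q\<^sub>1" "0 \<le> \<kappa>\<^sub>q\<^sub>2" "0 \<le> \<kappa>\<^sub>E\<^sub>3"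
    unfolding q1 q2 e3 \<kappa>_def using cb(5) kappa_d(1) kappa_g(1) S.kappa_H_nonneg A3(1,2) by auto
  let ?S = "\<Sum>k\<le>k\<^sub>m\<^sub>a\<^sub>x. \<integral>\<omega>. S.q_red k \<omega> \<partial>uniform_measure P E"
  let ?bound = "2 * ((\<tau>\<^sub>i\<^sub>n\<^sub>i\<^sub>t * (f x\<^sub>0 - f\<^sub>l\<^sub>o\<^sub>w) + l1_norm (c x\<^sub>0) + Mbar * \<gamma>\<^sup>2
              + \<kappa>\<^sub>E\<^sub>3 * \<gamma> * l / sqrt (real k\<^sub>m\<^sub>a\<^sub>x + 1))
            / (A\<^sub>m\<^sub>i\<^sub>n * \<gamma> * sqrt (real k\<^sub>m\<^sub>a\<^sub>x + 1)))
        + 2 * (\<kappa>\<^sub>q\<^sub>1 * \<gamma> + \<kappa>\<^sub>q\<^sub>2 * \<gamma>\<^sup>2 / sqrt (real k\<^sub>m\<^sub>a\<^sub>x + 1))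
            / (A\<^sub>m\<^sub>i\<^sub>n * \<gamma> * (real k\<^sub>m\<^sub>a\<^sub>x + 1)) * t"
  have "(\<integral>\<omega>. S.q_red (K \<omega>) \<omega> \<partial>uniform_measure P E) \<le> ?S / (k\<^sub>m\<^sub>a\<^sub>x + 1)"
  proof (rule integral_at_uniform_index_le[OF K_rv K_distr K_indep space_past _ S.E_past E_pos])
    show "sets (past P G (Suc k\<^sub>m\<^sub>a\<^sub>x)) \<subseteq> events"
      using G_rv by (intro sets_past_subset) auto
    show "S.q_red k \<in> borel_measurable (past P G (Suc k\<^sub>m\<^sub>a\<^sub>x))" if "k \<le> k\<^sub>m\<^sub>a\<^sub>x" for k
      using S.measurable_q_red[OF that] that by (auto intro: measurable_past_mono)
    show "integrable P (\<lambda>\<omega>. indicator E \<omega> * S.q_red k \<omega>)" if "k \<le> k\<^sub>m\<^sub>a\<^sub>x" for k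
      by (rule S.integrable_q_red[OF that])
    show "0 \<le> S.q_red k \<omega>" if "k \<le> k\<^sub>m\<^sub>a\<^sub>x" "\<omega> \<in> E" for k \<omega>
      using S.q_red_bounds that by metis
  qed
  also have "?S / (k\<^sub>m\<^sub>a\<^sub>x + 1) = ?S / (real k\<^sub>m\<^sub>a\<^sub>x + 1)" by (simp add: add.commute)
  also have "\<dots> \<le> ?bound"
  proof (rule average_bound[OF _ cb(2) _ beta(1) _ mM st sl nonneg t0])
    show "1/2 * A\<^sub>m\<^sub>i\<^sub>n * \<beta> * ?S \<le> \<tau>\<^sub>i\<^sub>n\<^sub>i\<^sub>t * (f x\<^sub>0 - f\<^sub>l\<^sub>o\<^sub>w) + l1_norm (c x\<^sub>0) + (real k\<^sub>m\<^sub>a\<^sub>x + 1) * \<beta>\<^sup>2 * m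
        + \<beta> * \<kappa>\<^sub>q\<^sub>1 * (real s\<^sub>m\<^sub>a\<^sub>x / p\<^sub>\<tau>) + \<beta> * \<kappa>\<^sub>E\<^sub>3 * real s\<^sub>m\<^sub>a\<^sub>x"
      using sum_bound unfolding m_def[symmetric] \<kappa>_def[symmetric] q1 e3 by (simp add: mult.assoc add_ac)
  qed (use gamma in auto)
  finally have "(\<integral>\<omega>. S.q_red (K \<omega>) \<omega> \<partial>uniform_measure P E) \<le> ?bound" .
  then show ?thesis
    using delta(1) prob_space unfolding S.q_red_def l_def t_def by simp
qed

end
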